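(* Let $\mathcal{F}$ be a saturated fusion system over a finite $p$-group $S$. Then the local rank satisfies $\mathrm{rank}_l(\mathcal{F})=2$ if and only if both of the following hold: $\mathcal{F}^{e}\setminus\{O_p(\mathcal{F})\}\neq\emptyset$; and $N_{\mathcal{F}}(Q)^e=\{Q\}$ whenever $Q\in\mathcal{F}^{fcr}\setminus\{S,O_p(\mathcal{F})\}$. Here, for a saturated fusion system $\mathcal{E}$, $\mathcal{E}^e$ is the set of $\mathcal{E}$-essential subgroups, and $\mathcal{E}^{fcr}$ is the set of fully $\mathcal{E}$-normalised, $\mathcal{E}$-centric and $\mathcal{E}$-radical subgroups.
   Context: For a saturated fusion system $\mathcal{F}$ over a finite $p$-group $S$ and $Q\le S$: $Q$ is fully $\mathcal{F}$-normalised if $|N_S(Q)|\ge|N_S(R)|$ for all $R$ $\mathcal{F}$-isomorphic to $Q$; $\mathcal{F}$-centric if $C_S(R)=Z(R)$ for all $R$ $\mathcal{F}$-isomorphic to $Q$; $\mathcal{F}$-radical if $O_p(\mathrm{Out}_{\mathcal{F}}(Q))=1$, where $\mathrm{Out}_{\mathcal{F}}(Q)=\mathrm{Aut}_{\mathcal{F}}(Q)/\mathrm{Inn}(Q)$; $\mathcal{F}$-essential if it is fully $\mathcal{F}$-normalised, $\mathcal{F}$-centric and $\mathrm{Out}_{\mathcal{F}}(Q)$ has a strongly $p$-embedded subgroup. $N_{\mathcal{F}}(Q)$ is the fusion system over $N_S(Q)$ whose morphisms $U\to V$ are those $\varphi\in\mathrm{Hom}_{\mathcal{F}}(U,V)$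 having an extension $\tilde\varphi\in\mathrm{Hom}_{\mathcal{F}}(UQ,VQ)$ with $\tilde\varphi(Q)=Q$ (it is saturated when $Q$ is fully $\mathcal{F}$-normalised); $Q$ is normal in $\mathcal{F}$ if $N_{\mathcal{F}}(Q)=\mathcal{F}$, and $O_p(\mathcal{F})$ is the largest subgroup of $S$ normal in $\mathcal{F}$. The local rank is defined recursively: $\mathrm{rank}_l(\mathcal{F})=0$ if $O_p(\mathcal{F})=S$; if $O_p(\mathcal{F})<S$, then $\mathrm{rank}_l(\mathcal{F})=1+\max\{\mathrm{rank}_l(N_{\mathcal{F}}(R)) : R\in\mathcal{F}^{fcr},\ O_p(\mathcal{F})<R\}$. *)

theory Defs
  imports "HOL-Algebra.Sylow" "HOL-Algebra.Zassenhaus" "HOL-Algebra.SndIsomorphismGrp"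
begin

definition p_group :: "nat \<Rightarrow> ('a, 'b) monoid_scheme \<Rightarrow> bool" where
  "p_group p G \<longleftrightarrow> prime p \<and> group G \<and> (\<exists>n. order G = p ^ n)"

definition sylow_subgroup :: "nat \<Rightarrow> ('a, 'b) monoid_scheme \<Rightarrow> 'a set \<Rightarrow> bool" where
  "sylow_subgroup p G H \<longleftrightarrow> subgroup H G \<and> card H = p ^ multiplicity p (order G)"

definition centralizer :: "('a, 'b) monoid_scheme \<Rightarrow> 'a set \<Rightarrow> 'a set" where
  "centralizer G H = {g \<in> carrier G. \<forall>h\<in>H. g \<otimes>\<^bsub>G\<^esub> h = h \<otimes>\<^bsub>G\<^esub> g}"

definition center :: "('a, 'b) monoid_scheme \<Rightarrow> 'a set" where
  "center G = centralizer G (carrier G)"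

definition p_core :: "nat \<Rightarrow> ('a, 'b) monoid_scheme \<Rightarrow> 'a set" where
  "p_core p G = (GREATEST N. normal N G \<and> (\<exists>n. card N = p ^ n))"

definition strongly_embedded :: "nat \<Rightarrow> ('a, 'b) monoid_scheme \<Rightarrow> 'a set \<Rightarrow> bool" where
  "strongly_embedded p G H \<longleftrightarrow>
     subgroup H G \<and> H \<noteq> carrier G \<and> p dvd card H \<and>
     (\<forall>g \<in> carrier G - H. \<not> p dvd card (H \<inter> (g <#\<^bsub>G\<^esub> H #>\<^bsub>G\<^esub> (inv\<^bsub>G\<^esub> g))))"

definition conj_map :: "('a, 'b) monoid_scheme \<Rightarrow> 'a \<Rightarrow> 'a set \<Rightarrow> 'a \<Rightarrow> 'a" where
  "conj_map G g P = (\<lambda>x\<in>P. g \<otimes>\<^bsub>G\<^esub> x \<otimes>\<^bsub>G\<^esub> inv\<^bsub>G\<^esub> g)"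

definition conj_hom :: "('a, 'b) monoid_scheme \<Rightarrow> 'a set \<Rightarrow> 'a set \<Rightarrow> ('a \<Rightarrow> 'a) set" where
  "conj_hom G P Q = {conj_map G g P | g. g \<in> carrier G \<and> conj_map G g P ` P \<subseteq> Q}"

definition conj_aut :: "('a, 'b) monoid_scheme \<Rightarrow> 'a set \<Rightarrow> ('a \<Rightarrow> 'a) set" where
  "conj_aut G P = {conj_map G g P | g. g \<in> normalizer G P}"

definition inner_aut :: "('a, 'b) monoid_scheme \<Rightarrow> 'a set \<Rightarrow> ('a \<Rightarrow> 'a) set" where
  "inner_aut G P = {conj_map G g P | g. g \<in> P}"

text \<open>
  The underlying group of a fusion system together with its morphism sets. Objects are subgroups,
  given by their carriers. A morphism with domain \<open>P\<close> is a function that is \<^const>\<open>extensional\<close>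
  on \<open>P\<close>; the morphism set is empty if one of its arguments is not a subgroup. Hence equality of
  two records is equality of the two fusion systems.
\<close>
record 'a fusion =
  grp :: "'a monoid"
  Mor :: "'a set \<Rightarrow> 'a set \<Rightarrow> ('a \<Rightarrow> 'a) set"

definition fusion_system :: "nat \<Rightarrow> 'a fusion \<Rightarrow> bool" where
  "fusion_system p F \<longleftrightarrow>
     p_group p (grp F) \<and>
     (\<forall>P Q. Mor F P Q \<noteq> {} \<longrightarrow> subgroup P (grp F) \<and> subgroup Q (grp F)) \<and>
     (\<forall>P Q. subgroup P (grp F) \<longrightarrow> subgroup Q (grp F) \<longrightarrow>
        conj_hom (grp F) P Q \<subseteq> Mor F P Q \<and>
        Mor F P Q \<subseteq> {\<phi> \<in> extensional P.
          \<phi> \<in> hom ((grp F)\<lparr>carrier := P\<rparr>) ((grp F)\<lparr>carrier := Q\<rparr>) \<and> inj_on \<phi> P}) \<and>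
     (\<forall>P Q. \<forall>\<phi> \<in> Mor F P Q.
        \<phi> \<in> Mor F P (\<phi> ` P) \<and> restrict (inv_into P \<phi>) (\<phi> ` P) \<in> Mor F (\<phi> ` P) P) \<and>
     (\<forall>P Q R. \<forall>\<phi> \<in> Mor F P Q. \<forall>\<psi> \<in> Mor F Q R. compose P \<psi> \<phi> \<in> Mor F P R)"

definition fusion_iso :: "'a fusion \<Rightarrow> 'a set \<Rightarrow> 'a set \<Rightarrow> bool" where
  "fusion_iso F P Q \<longleftrightarrow> (\<exists>\<phi> \<in> Mor F P Q. \<phi> ` P = Q)"

definition Aut_fus :: "'a fusion \<Rightarrow> 'a set \<Rightarrow> ('a \<Rightarrow> 'a) monoid" where
  "Aut_fus F Q = (BijGroup Q)\<lparr>carrier := Mor F Q Q\<rparr>"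

definition Out_fus :: "'a fusion \<Rightarrow> 'a set \<Rightarrow> ('a \<Rightarrow> 'a) set monoid" where
  "Out_fus F Q = Aut_fus F Q Mod inner_aut (grp F) Q"

definition fully_automised :: "nat \<Rightarrow> 'a fusion \<Rightarrow> 'a set \<Rightarrow> bool" where
  "fully_automised p F P \<longleftrightarrow> sylow_subgroup p (Aut_fus F P) (conj_aut (grp F) P)"

text \<open>\<open>N\<^sub>\<phi>\<close> for an isomorphism \<open>\<phi> : Q \<rightarrow> P\<close>.\<close>
definition ext_control :: "'a fusion \<Rightarrow> 'a set \<Rightarrow> 'a set \<Rightarrow> ('a \<Rightarrow> 'a) \<Rightarrow> 'a set" where
  "ext_control F Q P \<phi> = {g \<in> normalizer (grp F) Q.
     compose P \<phi> (compose P (conj_map (grp F) g Q) (inv_into Q \<phi>)) \<in> conj_aut (grp F) P}"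

definition receptive :: "'a fusion \<Rightarrow> 'a set \<Rightarrow> bool" where
  "receptive F P \<longleftrightarrow>
     (\<forall>Q. \<forall>\<phi> \<in> Mor F Q P. \<phi> ` Q = P \<longrightarrow>
        (\<exists>\<psi> \<in> Mor F (ext_control F Q P \<phi>) (carrier (grp F)). restrict \<psi> Q = \<phi>))"

text \<open>
  Of the equivalent standard definitions of saturation, this is the one of Aschbacher, Kessar and
  Oliver: each isomorphism class has a fully automised and receptive member.
\<close>
definition saturated :: "nat \<Rightarrow> 'a fusion \<Rightarrow> bool" where
  "saturated p F \<longleftrightarrow> fusion_system p F \<and>
     (\<forall>P. subgroup P (grp F) \<longrightarrow> (\<exists>Q. fusion_iso F P Q \<and> fully_automised p F Q \<and> receptive F Q))"

definition fully_normalised :: "'a fusion \<Rightarrow> 'a set \<Rightarrow> bool" where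
  "fully_normalised F Q \<longleftrightarrow> subgroup Q (grp F) \<and>
     (\<forall>R. fusion_iso F Q R \<longrightarrow> card (normalizer (grp F) R) \<le> card (normalizer (grp F) Q))"

definition centric :: "'a fusion \<Rightarrow> 'a set \<Rightarrow> bool" where
  "centric F Q \<longleftrightarrow> subgroup Q (grp F) \<and>
     (\<forall>R. fusion_iso F Q R \<longrightarrow> centralizer (grp F) R = center ((grp F)\<lparr>carrier := R\<rparr>))"

definition radical :: "nat \<Rightarrow> 'a fusion \<Rightarrow> 'a set \<Rightarrow> bool" where
  "radical p F Q \<longleftrightarrow> subgroup Q (grp F) \<and> p_core p (Out_fus F Q) = {\<one>\<^bsub>Out_fus F Q\<^esub>}"

definition essentials :: "nat \<Rightarrow> 'a fusion \<Rightarrow> 'a set set" where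
  "essentials p F = {Q. fully_normalised F Q \<and> centric F Q \<and> (\<exists>H. strongly_embedded p (Out_fus F Q) H)}"

definition fcr :: "nat \<Rightarrow> 'a fusion \<Rightarrow> 'a set set" where
  "fcr p F = {Q. fully_normalised F Q \<and> centric F Q \<and> radical p F Q}"

definition normalizer_fus :: "'a fusion \<Rightarrow> 'a set \<Rightarrow> 'a fusion" where
  "normalizer_fus F Q =
     \<lparr>grp = (grp F)\<lparr>carrier := normalizer (grp F) Q\<rparr>,
      Mor = (\<lambda>U V. {\<phi> \<in> Mor F U V. U \<subseteq> normalizer (grp F) Q \<and> V \<subseteq> normalizer (grp F) Q \<and>
        (\<exists>\<psi> \<in> Mor F (U <#>\<^bsub>grp F\<^esub> Q) (V <#>\<^bsub>grp F\<^esub> Q). restrict \<psi> U = \<phi> \<and> \<psi> ` Q = Q)})\<rparr>"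

definition normal_in_fus :: "'a set \<Rightarrow> 'a fusion \<Rightarrow> bool" where
  "normal_in_fus Q F \<longleftrightarrow> subgroup Q (grp F) \<and> normalizer_fus F Q = F"

text \<open>\<open>O\<^sub>p(F)\<close>; it exists by \<open>fus_core_greatest\<close> below.\<close>
definition fus_core :: "'a fusion \<Rightarrow> 'a set" where
  "fus_core F = (GREATEST Q. normal_in_fus Q F)"

text \<open>
  The properties of a fusion system that are needed for the existence of the largest normal
  subgroup and are immediately inherited by \<^const>\<open>normalizer_fus\<close>.
\<close>
definition prefusion :: "'a fusion \<Rightarrow> bool" where
  "prefusion F \<longleftrightarrow> group (grp F) \<and> finite (carrier (grp F)) \<and>
     (\<forall>P Q. Mor F P Q \<noteq> {} \<longrightarrow> subgroup P (grp F) \<and> subgroup Q (grp F)) \<and>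
     (\<forall>P Q. Mor F P Q \<subseteq> extensional P \<inter> hom ((grp F)\<lparr>carrier := P\<rparr>) ((grp F)\<lparr>carrier := Q\<rparr>))"

lemma fusion_system_prefusion:
  assumes "fusion_system p F" shows "prefusion F"
proof -
  have "order (grp F) > 0"
    using assms by (auto simp: fusion_system_def p_group_def prime_gt_0_nat)
  then have "finite (carrier (grp F))" by (simp add: order_def card_gt_0_iff)
  then show ?thesis
    using assms unfolding fusion_system_def prefusion_def p_group_def by blast
qed

lemma prefusion_normalizer_fus:
  assumes F: "prefusion F" and Q: "subgroup Q (grp F)"
  shows "prefusion (normalizer_fus F Q)"
proof -
  interpret S: group "grp F" using F by (simp add: prefusion_def)
  have N: "subgroup (normalizer (grp F) Q) (grp F)"
    by (rule S.normalizer_imp_subgroup[OF subgroup.subset[OF Q]])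
  have sub: "subgroup U ((grp F)\<lparr>carrier := normalizer (grp F) Q\<rparr>)"
    if "subgroup U (grp F)" "U \<subseteq> normalizer (grp F) Q" for U
    using S.subgroup_incl[OF that(1) N that(2)] .
  have "group ((grp F)\<lparr>carrier := normalizer (grp F) Q\<rparr>)"
    using S.subgroup_imp_group[OF N] .
  moreover have "finite (normalizer (grp F) Q)"
    using subgroup.subset[OF N] F unfolding prefusion_def by (blast intro: finite_subset)
  moreover have "\<phi> \<in> extensional U \<inter> hom ((grp F)\<lparr>carrier := U\<rparr>) ((grp F)\<lparr>carrier := V\<rparr>)"
    if "\<phi> \<in> Mor F U V" for \<phi> U V
    using F that unfolding prefusion_def by blast
  moreover have "subgroup U (grp F) \<and> subgroup V (grp F)" if "\<phi> \<in> Mor F U V" for \<phi> U V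
    using F that unfolding prefusion_def by blast
  ultimately show ?thesis
    unfolding prefusion_def normalizer_fus_def using sub by auto
qed

lemma normal_in_fus_iff:
  assumes F: "prefusion F"
  shows "normal_in_fus Q F \<longleftrightarrow> subgroup Q (grp F) \<and> normalizer (grp F) Q = carrier (grp F) \<and>
    (\<forall>U V. \<forall>\<phi> \<in> Mor F U V. \<exists>\<psi> \<in> Mor F (U <#>\<^bsub>grp F\<^esub> Q) (V <#>\<^bsub>grp F\<^esub> Q).
       restrict \<psi> U = \<phi> \<and> \<psi> ` Q = Q)" (is "_ \<longleftrightarrow> ?R")
proof
  assume n: "normal_in_fus Q F"
  have "grp (normalizer_fus F Q) = grp F" "\<And>U V. Mor (normalizer_fus F Q) U V = Mor F U V"
    using n by (simp_all add: normal_in_fus_def)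
  moreover have "carrier (grp (normalizer_fus F Q)) = normalizer (grp F) Q"
    by (simp add: normalizer_fus_def)
  ultimately have "normalizer (grp F) Q = carrier (grp F)" by simp
  moreover have "\<exists>\<psi> \<in> Mor F (U <#>\<^bsub>grp F\<^esub> Q) (V <#>\<^bsub>grp F\<^esub> Q). restrict \<psi> U = \<phi> \<and> \<psi> ` Q = Q"
    if "\<phi> \<in> Mor F U V" for U V \<phi>
  proof -
    have "\<phi> \<in> Mor (normalizer_fus F Q) U V" using that n by (simp add: normal_in_fus_def)
    then show ?thesis by (simp add: normalizer_fus_def)
  qed
  ultimately show ?R using n by (auto simp: normal_in_fus_def)
next
  assume r: ?R
  have sub: "U \<subseteq> carrier (grp F) \<and> V \<subseteq> carrier (grp F)" if "\<phi> \<in> Mor F U V" for U V \<phi>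
  proof -
    have "subgroup U (grp F)" "subgroup V (grp F)"
      using F that unfolding prefusion_def by blast+
    then show ?thesis by (simp add: subgroup.subset)
  qed
  have "Mor (normalizer_fus F Q) = Mor F"
  proof (intro ext equalityI subsetI)
    fix U V \<phi> assume "\<phi> \<in> Mor (normalizer_fus F Q) U V"
    then show "\<phi> \<in> Mor F U V" by (simp add: normalizer_fus_def)
  next
    fix U V \<phi> assume "\<phi> \<in> Mor F U V"
    then show "\<phi> \<in> Mor (normalizer_fus F Q) U V"
      using r sub by (simp add: normalizer_fus_def)
  qed
  moreover have "grp (normalizer_fus F Q) = grp F"
    using r by (simp add: normalizer_fus_def)
  ultimately show "normal_in_fus Q F" using r by (simp add: normal_in_fus_def)
qed

lemma (in group) subset_set_mult:
  assumes "H \<subseteq> carrier G" "K \<subseteq> carrier G"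
  shows "\<one> \<in> K \<Longrightarrow> H \<subseteq> H <#> K" and "\<one> \<in> H \<Longrightarrow> K \<subseteq> H <#> K"
proof -
  show "H \<subseteq> H <#> K" if "\<one> \<in> K"
    using mono_set_mult[of H H "{\<one>}" K G] that assms by (simp flip: r_coset_eq_set_mult)
  show "K \<subseteq> H <#> K" if "\<one> \<in> H"
    using mono_set_mult[of "{\<one>}" H K K G] that assms lcos_mult_one[of K]
    by (simp flip: l_coset_eq_set_mult)
qed

lemma (in group) normal_iff_normalizer:
  assumes "subgroup Q G"
  shows "normal Q G \<longleftrightarrow> normalizer G Q = carrier G"
proof
  assume n: "normal Q G"
  have Q: "Q \<subseteq> carrier G" using assms subgroup.subset by blast
  have "g <#\<^bsub>G\<^esub> Q #> inv g = Q" if g: "g \<in> carrier G" for g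
  proof -
    have "g <#\<^bsub>G\<^esub> Q = Q #> g" using n g by (simp add: normal.coset_eq)
    then show ?thesis using Q g by (simp add: coset_mult_inv1 coset_mult_assoc)
  qed
  then show "normalizer G Q = carrier G"
    using Q by (auto simp: normalizer_def stabilizer_def)
next
  assume "normalizer G Q = carrier G"
  then show "normal Q G" using subgroup_in_normalizer[OF assms] by simp
qed

lemma normal_in_fus_trivial:
  assumes F: "prefusion F"
  shows "normal_in_fus {\<one>\<^bsub>grp F\<^esub>} F"
proof -
  interpret S: group "grp F" using F by (simp add: prefusion_def)
  have mult1: "U <#>\<^bsub>grp F\<^esub> {\<one>\<^bsub>grp F\<^esub>} = U" if "subgroup U (grp F)" for U
    using subgroup.subset[OF that] by (simp flip: r_coset_eq_set_mult)
  have "\<exists>\<psi> \<in> Mor F (U <#>\<^bsub>grp F\<^esub> {\<one>\<^bsub>grp F\<^esub>}) (V <#>\<^bsub>grp F\<^esub> {\<one>\<^bsub>grp F\<^esub>}).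
      restrict \<psi> U = \<phi> \<and> \<psi> ` {\<one>\<^bsub>grp F\<^esub>} = {\<one>\<^bsub>grp F\<^esub>}" if \<phi>: "\<phi> \<in> Mor F U V" for U V \<phi>
  proof -
    have UV: "subgroup U (grp F)" "subgroup V (grp F)" "\<phi> \<in> extensional U"
      "\<phi> \<in> hom ((grp F)\<lparr>carrier := U\<rparr>) ((grp F)\<lparr>carrier := V\<rparr>)"
      using F \<phi> unfolding prefusion_def by blast+
    have "\<phi> \<one>\<^bsub>grp F\<^esub> = \<one>\<^bsub>grp F\<^esub>"
      using hom_one[OF UV(4) S.subgroup_imp_group[OF UV(1)] S.subgroup_imp_group[OF UV(2)]] by simp
    then show ?thesis
      using UV \<phi> mult1 by (auto intro!: bexI[of _ \<phi>] simp: extensional_restrict)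
  qed
  moreover have "normalizer (grp F) {\<one>\<^bsub>grp F\<^esub>} = carrier (grp F)"
    using S.normal_iff_normalizer[OF S.triv_subgroup] S.one_is_normal by simp
  ultimately show ?thesis unfolding normal_in_fus_iff[OF F] using S.triv_subgroup by simp
qed

lemma normal_in_fus_mult:
  assumes F: "prefusion F" and Q: "normal_in_fus Q F" and R: "normal_in_fus R F"
  shows "normal_in_fus (Q <#>\<^bsub>grp F\<^esub> R) F"
proof -
  interpret S: group "grp F" using F by (simp add: prefusion_def)
  note Q' = Q[unfolded normal_in_fus_iff[OF F]] and R' = R[unfolded normal_in_fus_iff[OF F]]
  have nQ: "normal Q (grp F)" and nR: "normal R (grp F)"
    using S.normal_iff_normalizer[of Q] S.normal_iff_normalizer[of R] Q' R' by simp_all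
  have sub: "Q \<subseteq> carrier (grp F)" "R \<subseteq> carrier (grp F)"
    using Q' R' by (simp_all add: subgroup.subset)
  have nQR: "normal (Q <#>\<^bsub>grp F\<^esub> R) (grp F)"
    using S.normal_subgroup_set_mult_closed[OF nQ nR] .
  then have sQR: "subgroup (Q <#>\<^bsub>grp F\<^esub> R) (grp F)"
    using normal_imp_subgroup by blast
  have "\<exists>\<psi> \<in> Mor F (U <#>\<^bsub>grp F\<^esub> (Q <#>\<^bsub>grp F\<^esub> R)) (V <#>\<^bsub>grp F\<^esub> (Q <#>\<^bsub>grp F\<^esub> R)).
      restrict \<psi> U = \<phi> \<and> \<psi> ` (Q <#>\<^bsub>grp F\<^esub> R) = Q <#>\<^bsub>grp F\<^esub> R" if \<phi>: "\<phi> \<in> Mor F U V" for U V \<phi>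
  proof -
    have UV: "subgroup U (grp F)" "subgroup V (grp F)"
      using F \<phi> unfolding prefusion_def by blast+
    then have UVs: "U \<subseteq> carrier (grp F)" "V \<subseteq> carrier (grp F)"
      using subgroup.subset by blast+
    obtain \<psi> where \<psi>: "\<psi> \<in> Mor F (U <#>\<^bsub>grp F\<^esub> Q) (V <#>\<^bsub>grp F\<^esub> Q)"
        "restrict \<psi> U = \<phi>" "\<psi> ` Q = Q"
      using Q' \<phi> by meson
    obtain \<chi> where \<chi>: "\<chi> \<in> Mor F (U <#>\<^bsub>grp F\<^esub> Q <#>\<^bsub>grp F\<^esub> R) (V <#>\<^bsub>grp F\<^esub> Q <#>\<^bsub>grp F\<^esub> R)"
        "restrict \<chi> (U <#>\<^bsub>grp F\<^esub> Q) = \<psi>" "\<chi> ` R = R"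
      using R' \<psi>(1) by meson
    have oneU: "\<one>\<^bsub>grp F\<^esub> \<in> U" and oneQ: "\<one>\<^bsub>grp F\<^esub> \<in> Q" and oneR: "\<one>\<^bsub>grp F\<^esub> \<in> R"
      using UV(1) Q' R' by (simp_all add: subgroup.one_closed)
    have U_le: "U \<subseteq> U <#>\<^bsub>grp F\<^esub> Q"
      using S.subset_set_mult(1)[OF UVs(1) sub(1) oneQ] .
    have Q_le: "Q \<subseteq> U <#>\<^bsub>grp F\<^esub> Q"
      using S.subset_set_mult(2)[OF UVs(1) sub(1) oneU] .
    have UQs: "U <#>\<^bsub>grp F\<^esub> Q \<subseteq> carrier (grp F)"
      using UVs(1) sub(1) by (simp add: S.set_mult_closed)
    have restr: "restrict \<chi> U = \<phi>"
      using \<psi>(2) \<chi>(2) U_le by (metis restrict_restrict Int_absorb1)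
    have "\<psi> x = \<chi> x" if "x \<in> Q" for x
      using that Q_le unfolding \<chi>(2)[symmetric] by (simp add: subsetD)
    then have \<chi>Q: "\<chi> ` Q = Q"
      using \<psi>(3) by simp
    have hom: "\<chi> \<in> hom ((grp F)\<lparr>carrier := U <#>\<^bsub>grp F\<^esub> Q <#>\<^bsub>grp F\<^esub> R\<rparr>)
        ((grp F)\<lparr>carrier := V <#>\<^bsub>grp F\<^esub> Q <#>\<^bsub>grp F\<^esub> R\<rparr>)"
      using F \<chi>(1) unfolding prefusion_def by blast
    have Q_le': "Q \<subseteq> U <#>\<^bsub>grp F\<^esub> Q <#>\<^bsub>grp F\<^esub> R"
      using S.subset_set_mult(1)[OF UQs sub(2) oneR] Q_le by blast
    have R_le': "R \<subseteq> U <#>\<^bsub>grp F\<^esub> Q <#>\<^bsub>grp F\<^esub> R"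
      using S.subset_set_mult(2)[OF UQs sub(2)] Q_le oneQ by blast
    have "\<chi> ` (Q <#>\<^bsub>grp F\<^esub> R) = (\<chi> ` Q) <#>\<^bsub>grp F\<^esub> (\<chi> ` R)"
    proof -
      have mul: "\<chi> (a \<otimes>\<^bsub>grp F\<^esub> b) = \<chi> a \<otimes>\<^bsub>grp F\<^esub> \<chi> b" if "a \<in> Q" "b \<in> R" for a b
        using hom_mult[OF hom, of a b] that Q_le' R_le' by auto
      show ?thesis
        unfolding set_mult_def by (simp add: image_UN mul)
    qed
    then have "\<chi> ` (Q <#>\<^bsub>grp F\<^esub> R) = Q <#>\<^bsub>grp F\<^esub> R" using \<chi>Q \<chi>(3) by simp
    moreover have "\<chi> \<in> Mor F (U <#>\<^bsub>grp F\<^esub> (Q <#>\<^bsub>grp F\<^esub> R)) (V <#>\<^bsub>grp F\<^esub> (Q <#>\<^bsub>grp F\<^esub> R))"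
      using \<chi>(1) UVs sub by (simp add: S.set_mult_assoc)
    ultimately show ?thesis using restr by blast
  qed
  moreover have "normalizer (grp F) (Q <#>\<^bsub>grp F\<^esub> R) = carrier (grp F)"
    using S.normal_iff_normalizer[OF sQR] nQR by simp
  ultimately show ?thesis unfolding normal_in_fus_iff[OF F] using sQR by simp
qed

lemma fus_core_greatest:
  assumes F: "prefusion F"
  shows "normal_in_fus (fus_core F) F" and "normal_in_fus Q F \<Longrightarrow> Q \<subseteq> fus_core F"
proof -
  interpret S: group "grp F" using F by (simp add: prefusion_def)
  let ?A = "{Q. normal_in_fus Q F}"
  have sub: "Q \<subseteq> carrier (grp F)" if "normal_in_fus Q F" for Q
    using that subgroup.subset unfolding normal_in_fus_def by blast
  have fin: "finite (carrier (grp F))" using F by (simp add: prefusion_def)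
  have "finite ?A"
    by (rule finite_subset[of _ "Pow (carrier (grp F))"]) (use sub fin in auto)
  moreover have "?A \<noteq> {}" using normal_in_fus_trivial[OF F] by blast
  ultimately obtain M where M: "M \<in> ?A" and max: "\<And>B. B \<in> ?A \<Longrightarrow> M \<subseteq> B \<Longrightarrow> M = B"
    using finite_has_maximal[of ?A] by blast
  have top: "Q \<subseteq> M" if Q: "normal_in_fus Q F" for Q
  proof -
    have one: "\<one>\<^bsub>grp F\<^esub> \<in> M" "\<one>\<^bsub>grp F\<^esub> \<in> Q"
      using M Q by (simp_all add: normal_in_fus_def subgroup.one_closed)
    have "M \<subseteq> M <#>\<^bsub>grp F\<^esub> Q"
      using S.subset_set_mult(1)[of M Q] sub M Q one by simp
    moreover have "Q \<subseteq> M <#>\<^bsub>grp F\<^esub> Q"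
      using S.subset_set_mult(2)[of M Q] sub M Q one by simp
    ultimately show ?thesis using max[of "M <#>\<^bsub>grp F\<^esub> Q"] normal_in_fus_mult[OF F _ Q, of M] M by auto
  qed
  have "fus_core F = M"
    unfolding fus_core_def by (rule Greatest_equality) (use M top in auto)
  then show "normal_in_fus (fus_core F) F" and "normal_in_fus Q F \<Longrightarrow> Q \<subseteq> fus_core F"
    using M top by auto
qed

lemma normal_in_normalizer_fus:
  assumes F: "prefusion F" and Q: "subgroup Q (grp F)"
  shows "normal_in_fus Q (normalizer_fus F Q)"
proof -
  interpret S: group "grp F" using F by (simp add: prefusion_def)
  let ?N = "normalizer (grp F) Q"
  let ?E = "normalizer_fus F Q"
  have E: "prefusion ?E" using prefusion_normalizer_fus[OF F Q] .
  then interpret N: group "grp ?E" by (simp add: prefusion_def)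
  have gE: "grp ?E = (grp F)\<lparr>carrier := ?N\<rparr>" by (simp add: normalizer_fus_def)
  have nQ: "normal Q (grp ?E)" unfolding gE using S.subgroup_in_normalizer[OF Q] .
  then have sQ: "subgroup Q (grp ?E)" using normal_imp_subgroup by blast
  have Qs: "Q \<subseteq> carrier (grp F)" using Q subgroup.subset by blast
  have QN: "Q \<subseteq> ?N" using subgroup.subset[OF sQ] by (simp add: gE)
  have sN: "subgroup ?N (grp F)" using S.normalizer_imp_subgroup[OF Qs] .
  have mult: "U <#>\<^bsub>grp ?E\<^esub> Q = U <#>\<^bsub>grp F\<^esub> Q" for U by (simp add: gE set_mult_def)
  have "\<exists>\<psi> \<in> Mor ?E (U <#>\<^bsub>grp ?E\<^esub> Q) (V <#>\<^bsub>grp ?E\<^esub> Q). restrict \<psi> U = \<phi> \<and> \<psi> ` Q = Q"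
    if \<phi>: "\<phi> \<in> Mor ?E U V" for U V \<phi>
  proof -
    have UV: "U \<subseteq> ?N" "V \<subseteq> ?N" using \<phi> by (simp_all add: normalizer_fus_def)
    have UVs: "U \<subseteq> carrier (grp F)" "V \<subseteq> carrier (grp F)"
      using UV subgroup.subset[OF sN] by blast+
    obtain \<psi> where \<psi>: "\<psi> \<in> Mor F (U <#>\<^bsub>grp F\<^esub> Q) (V <#>\<^bsub>grp F\<^esub> Q)" "restrict \<psi> U = \<phi>" "\<psi> ` Q = Q"
      using \<phi> by (auto simp: normalizer_fus_def)
    have QQ: "Q <#>\<^bsub>grp F\<^esub> Q = Q" using S.set_mult_subgroup_idem[OF Q S.subgroup_incl[OF Q Q order_refl]] .
    have idem: "X <#>\<^bsub>grp F\<^esub> Q <#>\<^bsub>grp F\<^esub> Q = X <#>\<^bsub>grp F\<^esub> Q" if "X \<subseteq> carrier (grp F)" for X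
      using S.set_mult_assoc[OF that Qs Qs] QQ by simp
    have inN: "X <#>\<^bsub>grp F\<^esub> Q \<subseteq> ?N" if "X \<subseteq> ?N" for X
      using that QN subgroup.m_closed[OF sN] unfolding set_mult_def by blast
    have "\<psi> \<in> extensional (U <#>\<^bsub>grp F\<^esub> Q)" using F \<psi>(1) unfolding prefusion_def by blast
    then have "\<psi> \<in> Mor ?E (U <#>\<^bsub>grp F\<^esub> Q) (V <#>\<^bsub>grp F\<^esub> Q)"
      unfolding normalizer_fus_def using \<psi> idem UVs inN UV
      by (auto intro!: bexI[of _ \<psi>] simp: extensional_restrict)
    then show ?thesis using \<psi>(2,3) mult by auto
  qed
  moreover have "normalizer (grp ?E) Q = carrier (grp ?E)"
    using N.normal_iff_normalizer[OF sQ] nQ by simp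
  ultimately show ?thesis unfolding normal_in_fus_iff[OF E] using sQ by simp
qed

text \<open>
  The test for \<^const>\<open>fusion_system\<close> only serves termination: if \<open>F\<close> is saturated, so is
  each \<^term>\<open>normalizer_fus F R\<close> occurring in the recursion. The maximum is taken over a
  nonempty set when \<open>F\<close> is saturated, because the underlying group itself belongs to \<^term>\<open>fcr p F\<close>.
\<close>
function local_rank :: "nat \<Rightarrow> 'a fusion \<Rightarrow> nat" where
  "local_rank p F =
     (if \<not> fusion_system p F \<or> fus_core F = carrier (grp F) then 0
      else 1 + (MAX R \<in> {R \<in> fcr p F. fus_core F \<subset> R}. local_rank p (normalizer_fus F R)))"
  by auto
termination
proof (relation "measure (\<lambda>(p, F). card (carrier (grp F)) - card (fus_core F))", goal_cases)
  case 1 show ?case by simp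
next
  case (2 p F R)
  then have F: "prefusion F" and lt: "fus_core F \<subset> R" and R: "subgroup R (grp F)"
    using fusion_system_prefusion by (auto simp: fcr_def fully_normalised_def)
  interpret S: group "grp F" using F by (simp add: prefusion_def)
  let ?E = "normalizer_fus F R"
  have E: "prefusion ?E" using prefusion_normalizer_fus[OF F R] .
  have gE: "carrier (grp ?E) = normalizer (grp F) R" by (simp add: normalizer_fus_def)
  have fin: "finite (carrier (grp F))" "finite (carrier (grp ?E))"
    using E F by (simp_all add: prefusion_def)
  have NS: "carrier (grp ?E) \<subseteq> carrier (grp F)"
    unfolding gE by (auto simp: normalizer_def stabilizer_def)
  have "R \<subseteq> fus_core ?E"
    using fus_core_greatest(2)[OF E normal_in_normalizer_fus[OF F R]] .
  moreover have core: "fus_core ?E \<subseteq> carrier (grp ?E)"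
    using fus_core_greatest(1)[OF E] subgroup.subset unfolding normal_in_fus_def by blast
  ultimately have "card (fus_core F) < card (fus_core ?E)"
    using lt fin(2) by (intro psubset_card_mono) (auto intro: finite_subset)
  moreover have "card (fus_core ?E) \<le> card (carrier (grp ?E))"
    using core fin by (simp add: card_mono)
  moreover have "card (carrier (grp ?E)) \<le> card (carrier (grp F))"
    using NS fin by (simp add: card_mono)
  ultimately show ?case by auto
qed

declare local_rank.simps [simp del]

end

theory Submission
  imports Defs "HOL-Algebra.Multiplicative_Group"
begin

text \<open>
  Write \<open>S\<close> for the underlying group of \<open>F\<close>. The proof compares radical
  and essential subgroups, by two arguments.

  The first is \<open>radical_absorbs\<close>. Let \<open>R\<close> be centric and radical, and
  let \<open>M \<le> N\<^sub>S(R)\<close> be such that \<open>Aut\<^sub>F(R)\<close> normalises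
  the group of automorphisms of \<open>R\<close> induced by \<open>M\<close>. That group is a
  normal \<open>p\<close>-subgroup of \<open>Aut\<^sub>F(R)\<close>, hence consists of inner
  automorphisms, and so \<open>M \<le> R C\<^sub>S(R) = R\<close>. With \<open>M =
  N\<^sub>K(R)\<close> for \<open>K = O\<^sub>p(F)\<close> this gives \<open>O\<^sub>p(F) \<le>
  R\<close>, and with \<open>M = O\<^sub>p(N\<^sub>F(R))\<close> it gives
  \<open>O\<^sub>p(N\<^sub>F(R)) = R\<close>. Therefore \<open>N\<^sub>F(R)\<close> has local rank
  \<open>0\<close> only if \<open>R = N\<^sub>S(R)\<close>, that is, if \<open>R = S\<close>. As
  \<open>S\<close> itself is in \<open>F\<^sup>f\<^sup>c\<^sup>r\<close>, local rank
  \<open>2\<close> means that \<open>F\<^sup>f\<^sup>c\<^sup>r\<close> has a member other than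
  \<open>S\<close> and \<open>O\<^sub>p(F)\<close>, and that \<open>N\<^sub>F(Q)\<close> has local
  rank \<open>1\<close> for each such member \<open>Q\<close>; and the latter means that
  \<open>Q\<close> and \<open>N\<^sub>S(Q)\<close> are the only members of
  \<open>N\<^sub>F(Q)\<^sup>f\<^sup>c\<^sup>r\<close>.

  The second, \<open>exists_essential\<close>, is the core of the Alperin-Goldschmidt theorem: if
  \<open>R \<noteq> S\<close> is centric and radical, there is an essential subgroup of order at
  least that of \<open>R\<close>. By \<open>radical_absorbs\<close> with \<open>M =
  N\<^sub>S(R)\<close>, some automorphism of \<open>R\<close> does not extend to \<open>S\<close>.
  Choose a morphism that does not extend to an automorphism of \<open>S\<close> and whose domain
  has the largest possible order; the domain is isomorphic to a fully automised and receptive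
  subgroup \<open>V\<close>, and \<open>V\<close> is essential: modulo \<open>Inn(V)\<close>, the
  automorphisms of \<open>V\<close> that extend to \<open>S\<close> form a strongly
  \<open>p\<close>-embedded subgroup, as receptivity would extend any automorphism of
  \<open>V\<close> that conjugates a subgroup of \<open>Aut\<^sub>S(V)\<close> not contained in
  \<open>Inn(V)\<close> into \<open>Aut\<^sub>S(V)\<close>.

  Essential subgroups are radical and different from \<open>S\<close>. Hence, comparing orders,
  \<open>F\<close> has an essential subgroup other than \<open>O\<^sub>p(F)\<close> if and only if
  \<open>F\<^sup>f\<^sup>c\<^sup>r\<close> has a member other than \<open>S\<close> and
  \<open>O\<^sub>p(F)\<close>; and for \<open>Q\<close> in
  \<open>F\<^sup>f\<^sup>c\<^sup>r\<close> with \<open>Q \<noteq> S\<close>, the only essential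
  subgroup of \<open>N\<^sub>F(Q)\<close> is \<open>Q\<close> if and only if
  \<open>N\<^sub>F(Q)\<^sup>f\<^sup>c\<^sup>r\<close> is \<open>{Q, N\<^sub>S(Q)}\<close>.

  For the last equivalence, \<open>exists_essential\<close> is applied to
  \<open>N\<^sub>F(Q)\<close>. As every morphism of \<open>N\<^sub>F(Q)\<close> extends over
  \<open>Q\<close>, the argument uses saturation only for subgroups that contain \<open>Q\<close>.
  For such subgroups it follows directly from the fact that \<open>Q\<close> is centric, fully
  automised and receptive in \<open>F\<close>: an automorphism of a group between \<open>Q\<close>
  and \<open>N\<^sub>S(Q)\<close> is determined by its restriction to \<open>Q\<close>, up to
  conjugation by elements of \<open>Q\<close> (\<open>Aut_fixing_is_conj\<close>).
\<close>

section \<open>Actions of p-groups on cosets and Sylow subgroups\<close>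

context group_action
begin

definition fixed_points where "fixed_points = {x \<in> E. \<forall>g \<in> carrier G. \<phi> g x = x}"

text \<open>
  The length of an orbit divides the order \<open>p ^ n\<close>, so every orbit that is not a
  fixed point has length divisible by \<open>p\<close>.
\<close>
lemma card_moved_points:
  assumes p: "prime (p::nat)" and G: "order G = p ^ n" and E: "finite E"
  shows "p dvd card (E - fixed_points)"
proof -
  \<comment> \<open>Summed over the orbits, \<open>?f\<close> counts the points that are moved.\<close>
  let ?f = "\<lambda>x. if x \<in> fixed_points then 0 else 1 :: nat"
  have "card (E - fixed_points) = (\<Sum>x\<in>E - fixed_points. ?f x)" by simp
  also have "\<dots> = (\<Sum>x\<in>E. ?f x)"
    by (rule sum.mono_neutral_left) (use E in auto)
  also have "\<dots> = (\<Sum>orb\<in>orbits G E \<phi>. \<Sum>x\<in>orb. ?f x)"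
    using disjoint_sum[OF E, of ?f] by simp
  also have "p dvd \<dots>"
  proof (rule dvd_sum)
    fix orb assume "orb \<in> orbits G E \<phi>"
    then obtain x where x: "x \<in> E" and orb: "orb = orbit G \<phi> x" by (auto simp: orbits_def)
    have dvd: "card orb dvd p ^ n"
      using orbit_stabilizer_theorem[OF x] G orb by (metis dvd_triv_left)
    have orbE: "orb \<subseteq> E" using x orb element_image by (auto simp: orbit_def)
    show "p dvd (\<Sum>x\<in>orb. ?f x)"
    proof (cases "card orb = 1")
      case True
      then obtain y where y: "orb = {y}" by (auto simp: card_1_singleton_iff)
      with orbit_refl[OF x] orb have "y = x" by auto
      then have "\<phi> g x = x" if "g \<in> carrier G" for g using that y orb by (auto simp: orbit_def)
      then have "x \<in> fixed_points" using x by (simp add: fixed_points_def)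
      then show ?thesis using y \<open>y = x\<close> by simp
    next
      case False
      have "z \<notin> fixed_points" if z: "z \<in> orb" for z
      proof
        assume "z \<in> fixed_points"
        then have "orbit G \<phi> z = {z}"
          using orbit_refl[of z] by (auto simp: orbit_def fixed_points_def)
        moreover have "x \<in> orbit G \<phi> z" using z orbit_sym x orb orbE by auto
        ultimately have "x = z" by simp
        then show False using \<open>orbit G \<phi> z = {z}\<close> orb False by simp
      qed
      then have "(\<Sum>x\<in>orb. ?f x) = card orb" by simp
      moreover have "p dvd card orb"
        using dvd False p by (metis divides_primepow_nat One_nat_def dvd_power not_gr_zero power_0)
      ultimately show ?thesis by simp
    qed
  qed
  finally show ?thesis .
qed

end

context group
begin

text \<open>
  Inverting the group element turns multiplication from the right into an action from the left.
\<close>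
lemma rcosets_action:
  assumes P: "subgroup P G" and H: "subgroup H G"
  shows "group_action (G\<lparr>carrier := P\<rparr>) (rcosets H) (\<lambda>g. \<lambda>X\<in>rcosets H. X #> inv g)"
proof -
  have Hs: "H \<subseteq> carrier G" and Ps: "P \<subseteq> carrier G" using H P subgroup.subset by auto
  have Xs: "X \<subseteq> carrier G" if "X \<in> rcosets H" for X
    using that rcosets_subset_PowG[OF H] by auto
  have cl: "X #> g \<in> rcosets H" if "X \<in> rcosets H" "g \<in> carrier G" for X g
    using that Hs by (auto simp: RCOSETS_def coset_mult_assoc)
  have bij: "(\<lambda>X\<in>rcosets H. X #> inv g) \<in> Bij (rcosets H)" if g: "g \<in> carrier G" for g
  proof -
    have "bij_betw (\<lambda>X. X #> inv g) (rcosets H) (rcosets H)"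
      by (rule bij_betw_byWitness[where f' = "\<lambda>X. X #> g"])
        (use g Xs cl in \<open>auto simp: coset_mult_assoc\<close>)
    then have "bij_betw (\<lambda>X\<in>rcosets H. X #> inv g) (rcosets H) (rcosets H)"
      by (metis (lifting) bij_betw_cong restrict_apply')
    then show ?thesis by (simp add: Bij_def)
  qed
  show ?thesis
    unfolding group_action_def group_hom_def group_hom_axioms_def
  proof (intro conjI)
    show "group (G\<lparr>carrier := P\<rparr>)" using P by (rule subgroup_imp_group)
    show "group (BijGroup (rcosets H))" by (rule group_BijGroup)
    show "(\<lambda>g. \<lambda>X\<in>rcosets H. X #> inv g) \<in> hom (G\<lparr>carrier := P\<rparr>) (BijGroup (rcosets H))"
    proof (rule homI)
      fix g assume "g \<in> carrier (G\<lparr>carrier := P\<rparr>)"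
      then show "(\<lambda>X\<in>rcosets H. X #> inv g) \<in> carrier (BijGroup (rcosets H))"
        using bij Ps by (auto simp: BijGroup_def)
    next
      fix g h assume "g \<in> carrier (G\<lparr>carrier := P\<rparr>)" "h \<in> carrier (G\<lparr>carrier := P\<rparr>)"
      then have g: "g \<in> carrier G" "h \<in> carrier G" using Ps by auto
      show "(\<lambda>X\<in>rcosets H. X #> inv (g \<otimes>\<^bsub>G\<lparr>carrier := P\<rparr>\<^esub> h)) =
        (\<lambda>X\<in>rcosets H. X #> inv g) \<otimes>\<^bsub>BijGroup (rcosets H)\<^esub> (\<lambda>X\<in>rcosets H. X #> inv h)"
        using bij[OF g(1)] bij[OF g(2)] g cl Xs
        by (simp add: BijGroup_def compose_def inv_mult_group coset_mult_assoc cong: restrict_cong)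
    qed
  qed
qed

lemma card_moved_cosets:
  assumes fin: "finite (carrier G)" and p: "prime (p::nat)"
    and P: "subgroup P G" "card P = p ^ n" and H: "subgroup H G"
  shows "p dvd card (rcosets H - {X \<in> rcosets H. \<forall>g\<in>P. X #> g = X})"
proof -
  interpret act: group_action "G\<lparr>carrier := P\<rparr>" "rcosets H" "\<lambda>g. \<lambda>X\<in>rcosets H. X #> inv g"
    by (rule rcosets_action[OF P(1) H])
  have "act.fixed_points = {X \<in> rcosets H. \<forall>g\<in>P. X #> g = X}" (is "?A = ?B")
  proof -
    have "(\<forall>g\<in>P. X #> inv g = X) \<longleftrightarrow> (\<forall>g\<in>P. X #> g = X)" for X
      using subgroup.m_inv_closed[OF P(1)] subgroup.mem_carrier[OF P(1)] inv_inv by metis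
    then show ?thesis unfolding act.fixed_points_def by auto
  qed
  moreover have "finite (rcosets H)" using fin rcosets_finite H by (simp add: RCOSETS_def)
  ultimately show ?thesis
    using act.card_moved_points[OF p, of n] P(2) by (simp add: order_def)
qed

lemma coset_fixed_iff:
  assumes H: "subgroup H G" and a: "a \<in> carrier G" and g: "g \<in> carrier G"
  shows "H #> a #> g = H #> a \<longleftrightarrow> a \<otimes> g \<otimes> inv a \<in> H"
proof -
  have Hs: "H \<subseteq> carrier G" using H subgroup.subset by auto
  have "H #> a #> g = H #> a \<longleftrightarrow> H #> (a \<otimes> g) = H #> a"
    using a g Hs by (simp add: coset_mult_assoc)
  also have "\<dots> \<longleftrightarrow> H #> (a \<otimes> g \<otimes> inv a) = H"
    using coset_mult_inv1[of H "a \<otimes> g" a] coset_mult_inv2[of H "a \<otimes> g" a] a g Hs by auto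
  also have "\<dots> \<longleftrightarrow> a \<otimes> g \<otimes> inv a \<in> H"
    using coset_join1[OF _ _ H] coset_join2[OF _ H] a g by auto
  finally show ?thesis .
qed

text \<open>
  The number of cosets of \<open>H\<close> is prime to \<open>p\<close>, so \<open>P\<close> fixes
  one of them; that it fixes \<open>H #> a\<close> says that \<open>a\<close> conjugates
  \<open>P\<close> into \<open>H\<close>.
\<close>
lemma sylow_conjugacy:
  assumes fin: "finite (carrier G)" and p: "prime (p::nat)"
    and P: "subgroup P G" "card P = p ^ n" and H: "sylow_subgroup p G H"
  obtains a where "a \<in> carrier G" "\<And>x. x \<in> P \<Longrightarrow> a \<otimes> x \<otimes> inv a \<in> H"
proof -
  have Hs: "subgroup H G" and cH: "card H = p ^ multiplicity p (order G)"
    using H by (simp_all add: sylow_subgroup_def)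
  let ?Fix = "{X \<in> rcosets H. \<forall>g\<in>P. X #> g = X}"
  have o: "order G > 0" using fin order_gt_0_iff_finite by simp
  have "\<not> p dvd card (rcosets H)"
  proof
    assume "p dvd card (rcosets H)"
    then have "p ^ Suc (multiplicity p (order G)) dvd order G"
      using lagrange[OF Hs] cH by (metis mult_dvd_mono dvd_refl power_Suc)
    then show False using o p
      by (metis multiplicity_geI not_less_eq_eq order.refl not_prime_unit not_gr_zero)
  qed
  moreover have "p dvd card (rcosets H - ?Fix)" by (rule card_moved_cosets[OF fin p P Hs])
  ultimately have "?Fix \<noteq> {}" by (metis (no_types, lifting) Diff_empty)
  then obtain X where X: "X \<in> rcosets H" "\<And>g. g \<in> P \<Longrightarrow> X #> g = X" by auto
  then obtain a where a: "a \<in> carrier G" "X = H #> a" by (auto simp: RCOSETS_def)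
  have "a \<otimes> x \<otimes> inv a \<in> H" if "x \<in> P" for x
    using coset_fixed_iff[OF Hs a(1)] X(2)[OF that] a that subgroup.mem_carrier[OF P(1)] by auto
  with a that show thesis by blast
qed

text \<open>
  The subgroup \<open>H\<close> fixes the coset \<open>H\<close>, and the number of cosets that it
  fixes is divisible by \<open>p\<close>. So it fixes another coset \<open>H #> a\<close>.
\<close>
lemma p_group_normalizer_grows:
  assumes G: "p_group p G" and H: "subgroup H G" "H \<noteq> carrier G"
  obtains a where "a \<in> carrier G - H" "\<And>x. x \<in> H \<Longrightarrow> a \<otimes> x \<otimes> inv a \<in> H"
proof -
  obtain n where p: "prime p" and n: "order G = p ^ n" using G by (auto simp: p_group_def)
  then have fin: "finite (carrier G)" using order_gt_0_iff_finite by (simp add: prime_gt_0_nat)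
  have lag: "card (rcosets H) * card H = p ^ n" using lagrange[OF H(1)] n by simp
  then obtain k where k: "card H = p ^ k"
    using p by (metis divides_primepow_nat dvd_triv_right)
  have H1: "H \<in> rcosets H" using subgroup.subgroup_in_rcosets[OF H(1)] is_group by simp
  let ?Fix = "{X \<in> rcosets H. \<forall>g\<in>H. X #> g = X}"
  have frc: "finite (rcosets H)" using fin by (simp add: RCOSETS_def)
  have "card (rcosets H) \<noteq> 1"
  proof
    assume "card (rcosets H) = 1"
    then have "card H = card (carrier G)" using lag n by (simp add: order_def)
    then show False using H fin by (metis card_subset_eq subgroup.subset)
  qed
  then have d1: "p dvd card (rcosets H)"
    using lag p by (metis divides_primepow_nat dvd_triv_left dvd_power not_gr_zero power_0)
  have d2: "p dvd card (rcosets H - ?Fix)" by (rule card_moved_cosets[OF fin p H(1) k H(1)])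
  have "card (rcosets H) = card (rcosets H - ?Fix) + card ?Fix"
    using frc by (subst card_Diff_subset) (auto simp: card_mono intro: finite_subset)
  then have d3: "p dvd card ?Fix" using d1 dvd_add_right_iff[OF d2] by simp
  have HF: "H \<in> ?Fix" using H1 coset_join2[OF _ H(1)] subgroup.mem_carrier[OF H(1)] by auto
  have "?Fix \<noteq> {H}" using d3 p by (auto dest: not_prime_unit)
  with HF obtain X where X: "X \<in> ?Fix" "X \<noteq> H" by blast
  then obtain a where a: "a \<in> carrier G" "X = H #> a" by (auto simp: RCOSETS_def)
  have "a \<notin> H" using X a coset_join2[OF _ H(1)] by auto
  moreover have "a \<otimes> x \<otimes> inv a \<in> H" if "x \<in> H" for x
    using coset_fixed_iff[OF H(1) a(1)] X(1) a that subgroup.mem_carrier[OF H(1)] by auto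
  ultimately show thesis using a that by blast
qed

lemma p_subgroup_normalizer_grows:
  assumes p: "prime (p::nat)" and K: "subgroup K G" "card K = p ^ n"
    and H: "subgroup H G" "H \<subseteq> K" "H \<noteq> K"
  shows "\<exists>a\<in>K - H. \<forall>x\<in>H. a \<otimes> x \<otimes> inv a \<in> H"
proof -
  interpret K: group "G\<lparr>carrier := K\<rparr>" by (rule subgroup_imp_group[OF K(1)])
  have pK: "p_group p (G\<lparr>carrier := K\<rparr>)"
    using p K(2) K.is_group by (auto simp: p_group_def order_def)
  have HK: "subgroup H (G\<lparr>carrier := K\<rparr>)" by (rule subgroup_incl[OF H(1) K(1) H(2)])
  obtain a where "a \<in> carrier (G\<lparr>carrier := K\<rparr>) - H"
      "\<And>x. x \<in> H \<Longrightarrow> a \<otimes>\<^bsub>G\<lparr>carrier := K\<rparr>\<^esub> x \<otimes>\<^bsub>G\<lparr>carrier := K\<rparr>\<^esub> inv\<^bsub>G\<lparr>carrier := K\<rparr>\<^esub> a \<in> H"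
    by (rule K.p_group_normalizer_grows[OF pK HK]) (use H(3) in auto)
  then show ?thesis using m_inv_consistent[OF K(1)] by auto
qed

lemma conj_subgroup:
  assumes a: "a \<in> carrier G" and X: "subgroup X G"
  shows "subgroup ((\<lambda>x. inv a \<otimes> x \<otimes> a) ` X) G" and "card ((\<lambda>x. inv a \<otimes> x \<otimes> a) ` X) = card X"
proof -
  have Xs: "X \<subseteq> carrier G" using X subgroup.subset by auto
  have "inv a <# X #> a = (\<lambda>x. inv a \<otimes> x \<otimes> a) ` X" by (auto simp: l_coset_def r_coset_def)
  then show "subgroup ((\<lambda>x. inv a \<otimes> x \<otimes> a) ` X) G"
    using subgroup_conjugation_is_surj1[OF a X] by simp
  have "inj_on (\<lambda>x. inv a \<otimes> x \<otimes> a) X"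
    using a Xs by (intro inj_onI) (auto simp: subset_iff)
  then show "card ((\<lambda>x. inv a \<otimes> x \<otimes> a) ` X) = card X" by (rule card_image)
qed

text \<open>
  By Sylow, \<open>P\<close> lies in a conjugate of a Sylow subgroup, and this conjugate is no
  larger than \<open>P\<close>.
\<close>
lemma sylow_subgroup_of_maximal:
  assumes fin: "finite (carrier G)" and p: "prime (p::nat)"
    and P: "subgroup P G" "card P = p ^ n"
    and max: "\<And>Y m. subgroup Y G \<Longrightarrow> card Y = p ^ m \<Longrightarrow> P \<subseteq> Y \<Longrightarrow> Y \<subseteq> P"
  shows "sylow_subgroup p G P"
proof -
  let ?m = "multiplicity p (order G)"
  have "p ^ ?m dvd order G" by (rule multiplicity_dvd)
  then obtain k where "order G = p ^ ?m * k" by (auto simp: dvd_def)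
  then obtain H where H: "subgroup H G" "card H = p ^ ?m"
    using sylow_thm[OF p _ _ fin] is_group by blast
  then have syl: "sylow_subgroup p G H" by (simp add: sylow_subgroup_def)
  obtain a where a: "a \<in> carrier G" "\<And>x. x \<in> P \<Longrightarrow> a \<otimes> x \<otimes> inv a \<in> H"
    using sylow_conjugacy[OF fin p P syl] by blast
  let ?Y = "(\<lambda>h. inv a \<otimes> h \<otimes> a) ` H"
  have Y: "subgroup ?Y G" and cY: "card ?Y = p ^ ?m"
    using conj_subgroup[OF a(1) H(1)] H(2) by simp_all
  have "P \<subseteq> ?Y"
  proof
    fix x assume x: "x \<in> P"
    then have "x \<in> carrier G" using P subgroup.mem_carrier by fast
    then have "x = inv a \<otimes> (a \<otimes> x \<otimes> inv a) \<otimes> a"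
      using conjugation_is_surj[of "inv a" x] a by simp
    then show "x \<in> ?Y" using a(2)[OF x] by blast
  qed
  then have "?Y = P" using max[OF Y cY] by blast
  then show ?thesis using P cY by (simp add: sylow_subgroup_def)
qed

lemma card_subgroup_dvd:
  assumes K: "subgroup K G" and H: "subgroup H G" and KH: "K \<subseteq> H"
  shows "card K dvd card H"
proof -
  interpret H: group "G\<lparr>carrier := H\<rparr>" by (rule subgroup_imp_group[OF H])
  have "card (rcosets\<^bsub>G\<lparr>carrier := H\<rparr>\<^esub> K) * card K = card H"
    using H.lagrange[OF subgroup_incl[OF K H KH]] by (simp add: order_def)
  then show ?thesis using dvd_triv_right by metis
qed

lemma p_power_card_subgroup:
  assumes p: "prime (p::nat)" and H: "subgroup H G" "card H = p ^ n" and K: "subgroup K G" "K \<subseteq> H"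
  obtains m where "card K = p ^ m"
proof -
  have "card K dvd p ^ n" using card_subgroup_dvd[OF K(1) H(1) K(2)] H(2) by simp
  then show thesis using that p by (auto simp: divides_primepow_nat)
qed

lemma sylow_subgroup_in_subgroup:
  assumes fin: "finite (carrier G)" and p: "prime (p::nat)" and P: "sylow_subgroup p G P"
    and H: "subgroup H G" "P \<subseteq> H"
  shows "sylow_subgroup p (G\<lparr>carrier := H\<rparr>) P"
proof -
  have sP: "subgroup P G" and cP: "card P = p ^ multiplicity p (order G)"
    using P by (simp_all add: sylow_subgroup_def)
  have o: "order G \<noteq> 0" "card H \<noteq> 0"
    using fin order_gt_0_iff_finite finite_subset[OF subgroup.subset[OF H(1)] fin] subgroup.one_closed[OF H(1)] by auto
  have "p ^ multiplicity p (order G) dvd card H" using card_subgroup_dvd[OF sP H] cP by simp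
  then have "multiplicity p (order G) \<le> multiplicity p (card H)"
    using o p by (intro multiplicity_geI) (auto dest: not_prime_unit)
  moreover have "card H dvd order G" using lagrange[OF H(1)] by (metis dvd_triv_right)
  then have "multiplicity p (card H) \<le> multiplicity p (order G)"
    using o by (intro dvd_imp_multiplicity_le) auto
  ultimately show ?thesis
    using cP subgroup_incl[OF sP H] by (simp add: sylow_subgroup_def order_def)
qed

end

lemma (in group_hom) card_image_dvd_order: "card (h ` carrier G) dvd order G"
proof -
  let ?I = "H\<lparr>carrier := h ` carrier G\<rparr>"
  have "subgroup (h ` carrier G) H" by (rule img_is_subgroup)
  then have I: "group ?I" by (rule H.subgroup_imp_group)
  interpret I: group_hom G ?I h
    unfolding group_hom_def group_hom_axioms_def using I by (auto simp: hom_def)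
  have "(\<lambda>X. the_elem (h ` X)) \<in> iso (G Mod (kernel G ?I h)) ?I"
    by (rule I.FactGroup_iso_set) simp
  then have "card (carrier (G Mod (kernel G ?I h))) = card (h ` carrier G)"
    using iso_same_order by (fastforce simp: order_def)
  moreover have "card (rcosets\<^bsub>G\<^esub> (kernel G ?I h)) * card (kernel G ?I h) = order G"
    by (rule G.lagrange[OF I.subgroup_kernel])
  ultimately have "order G = card (h ` carrier G) * card (kernel G ?I h)" by (simp add: FactGroup_def)
  then show ?thesis by simp
qed

lemma (in group) p_power_card_hom_image:
  assumes p: "prime (p::nat)" and P: "subgroup P G" "card P = p ^ n"
    and K: "group K" and h: "h \<in> hom (G\<lparr>carrier := P\<rparr>) K"
  shows "subgroup (h ` P) K" and "\<exists>m. card (h ` P) = p ^ m"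
proof -
  interpret h: group_hom "G\<lparr>carrier := P\<rparr>" K h
    unfolding group_hom_def group_hom_axioms_def using subgroup_imp_group[OF P(1)] K h by auto
  show "subgroup (h ` P) K" using h.img_is_subgroup by simp
  show "\<exists>m. card (h ` P) = p ^ m"
    using h.card_image_dvd_order p P(2) by (auto simp: order_def divides_primepow_nat)
qed

section \<open>Normal p-subgroups and strongly embedded subgroups of quotients\<close>

context group
begin

text \<open>
  The quotient of the product by \<open>M\<close> is an image of \<open>N\<close>.
\<close>
lemma p_power_card_set_mult:
  assumes p: "prime (p::nat)" and M: "normal M G" "card M = p ^ m" and N: "subgroup N G" "card N = p ^ n"
  shows "subgroup (M <#> N) G" and "\<exists>k. card (M <#> N) = p ^ k"
proof -
  interpret MN: second_isomorphism_grp M G N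
    using M N by (simp add: second_isomorphism_grp_def second_isomorphism_grp_axioms_def)
  show sub: "subgroup (M <#> N) G" by (rule MN.normal_set_mult_subgroup)
  interpret K: group "G\<lparr>carrier := M <#> N\<rparr>" by (rule subgroup_imp_group[OF sub])
  interpret h: group_hom "G\<lparr>carrier := N\<rparr>" "(G\<lparr>carrier := M <#> N\<rparr>) Mod M" "\<lambda>g. M #> g"
    by (rule MN.normal_intersection_hom)
  have "card (carrier ((G\<lparr>carrier := M <#> N\<rparr>) Mod M)) dvd p ^ n"
    using h.card_image_dvd_order N(2) unfolding MN.normal_intersection_hom_surj by (simp add: order_def)
  moreover have "subgroup M (G\<lparr>carrier := M <#> N\<rparr>)"
    by (rule subgroup_incl[OF normal_imp_subgroup[OF M(1)] sub MN.H_contained_in_set_mult])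
  then have "card (carrier ((G\<lparr>carrier := M <#> N\<rparr>) Mod M)) * p ^ m = card (M <#> N)"
    using K.lagrange[of M] M(2) by (simp add: FactGroup_def order_def)
  ultimately have "card (M <#> N) dvd p ^ n * p ^ m"
    using mult_dvd_mono[OF _ dvd_refl[of "p ^ m"]] by metis
  then show "\<exists>k. card (M <#> N) = p ^ k"
    using p by (auto simp: divides_primepow_nat simp flip: power_add)
qed

text \<open>
  The product of two normal \<open>p\<close>-subgroups is another one, so a maximal normal
  \<open>p\<close>-subgroup is the greatest; this is what makes the definition of the core by a
  greatest element meaningful.
\<close>
lemma p_core_upper:
  assumes fin: "finite (carrier G)" and p: "prime (p::nat)" and N: "normal N G" "card N = p ^ n"
  shows "N \<subseteq> p_core p G"
proof -
  let ?A = "{N. normal N G \<and> (\<exists>n. card N = p ^ n)}"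
  have sub: "N \<subseteq> carrier G" if "N \<in> ?A" for N
    using that normal_imp_subgroup subgroup.subset by blast
  have "finite ?A" by (rule finite_subset[of _ "Pow (carrier G)"]) (use sub fin in auto)
  moreover have "?A \<noteq> {}" using N by blast
  ultimately obtain M where M: "M \<in> ?A" and max: "\<And>B. B \<in> ?A \<Longrightarrow> M \<subseteq> B \<Longrightarrow> M = B"
    using finite_has_maximal[of ?A] by blast
  have top: "K \<subseteq> M" if K: "K \<in> ?A" for K
  proof -
    have "M <#> K \<in> ?A"
      using M K p_power_card_set_mult(2)[OF p, of M _ K] normal_subgroup_set_mult_closed[of M K]
      by (auto simp: normal_imp_subgroup)
    moreover have "M \<subseteq> M <#> K" "K \<subseteq> M <#> K"
      using subset_set_mult[of M K] sub[OF M] sub[OF K] M K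
      by (auto intro: subgroup.one_closed normal_imp_subgroup)
    ultimately show ?thesis using max by auto
  qed
  have "p_core p G = M"
    unfolding p_core_def by (rule Greatest_equality) (use M top in auto)
  then show ?thesis using top N by blast
qed

lemma p_core_eq_oneI:
  assumes "\<And>N n. normal N G \<Longrightarrow> card N = p ^ n \<Longrightarrow> N \<subseteq> {\<one>}"
  shows "p_core p G = {\<one>}"
  unfolding p_core_def
proof (rule Greatest_equality)
  show "normal {\<one>} G \<and> (\<exists>n. card {\<one>} = p ^ n)" using one_is_normal by (auto intro: exI[of _ 0])
qed (use assms in blast)

lemma subset_of_p_core_factor_trivial:
  assumes fin: "finite (carrier G)" and p: "prime (p::nat)" and N: "normal N G"
    and core: "p_core p (G Mod N) = {\<one>\<^bsub>G Mod N\<^esub>}" and P: "normal P G" "card P = p ^ n"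
  shows "P \<subseteq> N"
proof -
  interpret N: normal N G by (rule N)
  interpret M: group "G Mod N" by (rule N.factorgroup_is_group)
  have fM: "finite (carrier (G Mod N))" using fin by (simp add: carrier_FactGroup)
  have hom: "group_hom G (G Mod N) (\<lambda>a. N #> a)"
    unfolding group_hom_def group_hom_axioms_def using N.r_coset_hom_Mod is_group M.is_group by auto
  have "normal ((\<lambda>a. N #> a) ` P) (G Mod N)"
    by (rule normal.surj_hom_normal_subgroup[OF P(1) hom]) (simp add: carrier_FactGroup)
  moreover have "\<exists>m. card ((\<lambda>a. N #> a) ` P) = p ^ m"
    by (rule p_power_card_hom_image[OF p normal_imp_subgroup[OF P(1)] P(2) M.is_group])
      (use N.r_coset_hom_Mod subgroup.subset[OF normal_imp_subgroup[OF P(1)]] in \<open>simp add: hom_def Pi_iff subset_iff\<close>)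
  ultimately have "(\<lambda>a. N #> a) ` P \<subseteq> {N}" using M.p_core_upper[OF fM p] core by auto
  moreover have "x \<in> N #> x" if "x \<in> P" for x
    using rcos_self[OF _ N.subgroup_axioms] subgroup.mem_carrier[OF normal_imp_subgroup[OF P(1)] that] by blast
  ultimately show ?thesis by blast
qed

text \<open>
  Let \<open>N\<close> be a normal \<open>p\<close>-subgroup and \<open>P\<close> a Sylow
  \<open>p\<close>-subgroup of \<open>H\<close>. An element that normalises \<open>P\<close> lies
  in \<open>H\<close>, by strong embedding. If the \<open>p\<close>-group \<open>N P\<close> were
  larger than \<open>P\<close>, some element of it outside \<open>P\<close> would normalise
  \<open>P\<close>, thus lie in \<open>H\<close>, against the choice of \<open>P\<close>. So
  \<open>N\<close> lies in \<open>P\<close>, hence in \<open>H\<close> and all its conjugates,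
  which forces it to be trivial.
\<close>
lemma strongly_embedded_imp_p_core_trivial:
  assumes fin: "finite (carrier G)" and p: "prime (p::nat)" and emb: "strongly_embedded p G H"
  shows "p_core p G = {\<one>}"
proof (rule p_core_eq_oneI)
  fix N n assume N: "normal N G" "card N = p ^ n"
  have H: "subgroup H G" "H \<noteq> carrier G" "p dvd card H"
    and se: "\<And>g. g \<in> carrier G - H \<Longrightarrow> \<not> p dvd card (H \<inter> (g <# H #> inv g))"
    using emb by (auto simp: strongly_embedded_def)
  have Hs: "H \<subseteq> carrier G" using H subgroup.subset by auto
  have finH: "finite H" using Hs fin finite_subset by auto
  \<comment> \<open>Otherwise the order of \<open>X\<close> would divide that of the intersection of \<open>H\<close> with its conjugate by \<open>g\<close>.\<close>
  have key: "g \<in> H" if g: "g \<in> carrier G" and X: "subgroup X G" "p dvd card X" "X \<subseteq> H"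
    and XgH: "\<And>x. x \<in> X \<Longrightarrow> inv g \<otimes> x \<otimes> g \<in> H" for g X
  proof (rule ccontr)
    assume "g \<notin> H"
    let ?L = "H \<inter> (g <# H #> inv g)"
    have L: "subgroup ?L G"
      using subgroups_Inter_pair[OF H(1) subgroup_conjugation_is_surj2[OF g H(1)]] .
    have "X \<subseteq> ?L"
    proof
      fix x assume x: "x \<in> X"
      then have xG: "x \<in> carrier G" using X Hs by auto
      have "x = g \<otimes> (inv g \<otimes> x \<otimes> g) \<otimes> inv g" using g xG by (simp add: conjugation_is_surj)
      then show "x \<in> ?L" using XgH[OF x] x X by (auto simp: l_coset_def r_coset_def)
    qed
    then have "card X dvd card ?L"
      by (rule card_subgroup_dvd[OF X(1) L])
    then show False using se g \<open>g \<notin> H\<close> X(2) dvd_trans by blast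
  qed
  interpret H: group "G\<lparr>carrier := H\<rparr>" by (rule subgroup_imp_group[OF H(1)])
  let ?m = "multiplicity p (card H)"
  have "p ^ ?m dvd card H" by (rule multiplicity_dvd)
  then obtain k where "order (G\<lparr>carrier := H\<rparr>) = p ^ ?m * k" by (auto simp: dvd_def order_def)
  then obtain P where P': "subgroup P (G\<lparr>carrier := H\<rparr>)" and cP: "card P = p ^ ?m"
    using sylow_thm[OF p, of "G\<lparr>carrier := H\<rparr>"] finH H.is_group by auto
  have P: "subgroup P G" "P \<subseteq> H" using incl_subgroup[OF H(1) P'] subgroup.subset[OF P'] by auto
  have cH: "card H \<noteq> 0" using finH subgroup.one_closed[OF H(1)] by auto
  then have m: "?m > 0" using H(3) p by (metis multiplicity_eq_zero_iff not_gr_zero not_prime_unit prime_multiplicity_gt_zero_iff prime_elem_multiplicity_eq_zero_iff prime_imp_prime_elem)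
  then have pP: "p dvd card P" using cP by simp
  let ?K = "N <#> P"
  have K: "subgroup ?K G" and "\<exists>k. card ?K = p ^ k" using p_power_card_set_mult[OF p N P(1) cP] by auto
  then obtain k where k: "card ?K = p ^ k" by blast
  have PK: "P \<subseteq> ?K" "N \<subseteq> ?K"
    using subset_set_mult[of N P] P N subgroup.subset normal_imp_subgroup[OF N(1)] subgroup.one_closed by metis+
  have KH: "?K \<inter> H \<subseteq> P"
  proof -
    have sub: "subgroup (?K \<inter> H) G" using subgroups_Inter_pair[OF K H(1)] .
    obtain j where j: "card (?K \<inter> H) = p ^ j"
      using p_power_card_subgroup[OF p K k sub] by blast
    have "p ^ j dvd card H"
      using card_subgroup_dvd[OF sub H(1)] j by simp
    then have "j \<le> ?m" using cH p by (intro multiplicity_geI) (auto dest: not_prime_unit)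
    then have "card (?K \<inter> H) \<le> card P" using j cP power_increasing[of j ?m p] prime_ge_1_nat[OF p] by simp
    moreover have "P \<subseteq> ?K \<inter> H" "finite (?K \<inter> H)" using PK P finH by auto
    ultimately have "P = ?K \<inter> H" by (metis card_seteq)
    then show ?thesis by simp
  qed
  have "?K = P"
  proof (rule ccontr)
    assume "?K \<noteq> P"
    then obtain a where a: "a \<in> ?K - P" "\<And>x. x \<in> P \<Longrightarrow> a \<otimes> x \<otimes> inv a \<in> P"
      using p_subgroup_normalizer_grows[OF p K k P(1) PK(1)] \<open>?K \<noteq> P\<close> by blast
    have aG: "a \<in> carrier G" using a subgroup.mem_carrier[OF K] by blast
    have "inv a \<in> H" by (rule key[OF _ P(1) pP P(2)]) (use a(2) aG P in auto)
    then have "a \<in> H" using H(1) aG subgroup.m_inv_closed by fastforce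
    then show False using a KH by auto
  qed
  then have NH: "N \<subseteq> H" using PK P by auto
  show "N \<subseteq> {\<one>}"
  proof (rule ccontr)
    assume "\<not> N \<subseteq> {\<one>}"
    then have "card N \<noteq> 1" using subgroup.one_closed[OF normal_imp_subgroup[OF N(1)]]
      by (auto simp: card_1_singleton_iff)
    then have "p dvd card N" using N(2) by (cases n) auto
    then have "g \<in> H" if "g \<in> carrier G" for g
      using key[OF that normal_imp_subgroup[OF N(1)] _ NH] NH normal.inv_op_closed1[OF N(1) that] by blast
    then show False using H Hs by auto
  qed
qed

lemma not_strongly_embedded_p':
  assumes fin: "finite (carrier G)" and np: "\<not> p dvd order G"
  shows "\<not> strongly_embedded p G H"
proof
  assume "strongly_embedded p G H"
  then have "subgroup H G" "p dvd card H" by (auto simp: strongly_embedded_def)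
  then have "p dvd order G" using lagrange[of H] by (metis dvd_mult)
  then show False using np by simp
qed

lemma p_core_trivial_p':
  assumes np: "\<not> p dvd order G"
  shows "p_core p G = {\<one>}"
proof (rule p_core_eq_oneI)
  fix N n assume N: "normal N G" "card N = p ^ n"
  then have "\<not> p dvd card N"
    using np lagrange[OF normal_imp_subgroup[OF N(1)]] by (metis dvd_trans dvd_triv_right)
  then have "card N = 1" using N by (cases n) auto
  then show "N \<subseteq> {\<one>}"
    using subgroup.one_closed[OF normal_imp_subgroup[OF N(1)]] by (auto simp: card_1_singleton_iff)
qed

text \<open>
  A criterion for quotients that mentions only subgroups of \<open>G\<close>. If the image of
  \<open>H\<close> met a conjugate in a group of order divisible by \<open>p\<close>, that group
  would contain a subgroup of order \<open>p\<close>, whose preimage \<open>X\<close> is a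
  \<open>p\<close>-group properly containing \<open>N\<close>.
\<close>
lemma strongly_embedded_factorI:
  assumes fin: "finite (carrier G)" and p: "prime (p::nat)" and N: "normal N G" "card N = p ^ n"
    and H: "subgroup H G" "H \<noteq> carrier G" "N \<subseteq> H"
    and P: "subgroup P G" "card P = p ^ k" "P \<subseteq> H" "\<not> P \<subseteq> N"
    and meet: "\<And>a X m. \<lbrakk>a \<in> carrier G - H; subgroup X G; card X = p ^ m; X \<subseteq> H;
      \<And>x. x \<in> X \<Longrightarrow> inv a \<otimes> x \<otimes> a \<in> H\<rbrakk> \<Longrightarrow> X \<subseteq> N"
  shows "strongly_embedded p (G Mod N) ((\<lambda>a. N #> a) ` H)"
proof -
  interpret N: normal N G by (rule N)
  interpret M: group "G Mod N" by (rule N.factorgroup_is_group)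
  let ?q = "\<lambda>a. N #> a" 
  let ?H = "?q ` H"
  have Hs: "H \<subseteq> carrier G" using H subgroup.subset by auto
  have fM: "finite (carrier (G Mod N))" using fin by (simp add: carrier_FactGroup)
  have hom: "group_hom G (G Mod N) ?q"
    unfolding group_hom_def group_hom_axioms_def using N.r_coset_hom_Mod is_group M.is_group by auto
  then interpret q: group_hom G "G Mod N" ?q .
  have sH: "subgroup ?H (G Mod N)" by (rule q.subgroup_img_is_subgroup[OF H(1)])
  have inH: "x \<in> H" if "N #> x \<in> ?H" "x \<in> carrier G" for x
  proof -
    obtain h where h: "h \<in> H" "N #> x = N #> h" using \<open>N #> x \<in> ?H\<close> by auto
    then have "x \<in> N #> h" using rcos_self[OF \<open>x \<in> carrier G\<close> N.subgroup_axioms] by simp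
    then show "x \<in> H" using h H(1,3) subgroup.m_closed by (fastforce simp: r_coset_def)
  qed
  have "?H \<noteq> carrier (G Mod N)"
  proof
    assume eq: "?H = carrier (G Mod N)"
    have "x \<in> H" if x: "x \<in> carrier G" for x
      by (rule inH[OF _ x]) (unfold eq carrier_FactGroup, use x in blast)
    then show False using H(2) Hs by blast
  qed
  moreover have "p dvd card ?H"
  proof -
    have sP: "subgroup (?q ` P) (G Mod N)" and "\<exists>m. card (?q ` P) = p ^ m"
      by (rule p_power_card_hom_image[OF p P(1,2) M.is_group];
          use N.r_coset_hom_Mod subgroup.subset[OF P(1)] in \<open>simp add: hom_def Pi_iff subset_iff\<close>)+
    then obtain m where m: "card (?q ` P) = p ^ m" by blast
    have "m \<noteq> 0"
    proof
      assume "m = 0"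
      then obtain y where y: "?q ` P = {y}" using m by (auto simp: card_1_singleton_iff)
      moreover have "N \<in> ?q ` P" using subgroup.one_closed[OF sP] by simp
      ultimately have "N #> x = N" if "x \<in> P" for x using that by auto
      then show False using P(4) rcos_self[OF _ N.subgroup_axioms] subgroup.mem_carrier[OF P(1)] by blast
    qed
    then have "p dvd card (?q ` P)" using m by simp
    also have "card (?q ` P) dvd card ?H"
      by (rule M.card_subgroup_dvd[OF sP sH]) (use P in auto)
    finally show ?thesis .
  qed
  moreover have "\<not> p dvd card (?H \<inter> (g <#\<^bsub>G Mod N\<^esub> ?H #>\<^bsub>G Mod N\<^esub> inv\<^bsub>G Mod N\<^esub> g))"
    if g: "g \<in> carrier (G Mod N) - ?H" for g
  proof
    let ?L = "?H \<inter> (g <#\<^bsub>G Mod N\<^esub> ?H #>\<^bsub>G Mod N\<^esub> inv\<^bsub>G Mod N\<^esub> g)"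
    assume "p dvd card ?L"
    obtain a where a: "a \<in> carrier G" "g = N #> a" using g by (auto simp: carrier_FactGroup)
    have aH: "a \<notin> H" using a g by auto
    have L: "subgroup ?L (G Mod N)"
      using M.subgroups_Inter_pair[OF sH M.subgroup_conjugation_is_surj2[OF _ sH]] g by auto
    interpret L: group "(G Mod N)\<lparr>carrier := ?L\<rparr>" by (rule M.subgroup_imp_group[OF L])
    have finL: "finite ?L" using fM subgroup.subset[OF L] finite_subset by blast
    obtain k where "order ((G Mod N)\<lparr>carrier := ?L\<rparr>) = p ^ 1 * k"
      using \<open>p dvd card ?L\<close> by (auto simp: order_def dvd_def)
    then obtain X where X': "subgroup X ((G Mod N)\<lparr>carrier := ?L\<rparr>)" and cX: "card X = p"
      using sylow_thm[OF p L.is_group, of 1] finL by auto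
    have X: "subgroup X (G Mod N)" "X \<subseteq> ?L"
      using M.incl_subgroup[OF L X'] subgroup.subset[OF X'] by auto
    let ?X = "\<Union>X"
    have sX: "subgroup ?X G" by (rule N.factgroup_subgroup_union_subgroup[OF X(1)])
    have memX: "x \<in> carrier G" "N #> x \<in> X" if "x \<in> ?X" for x
      using that unfolding N.factgroup_subgroup_union_char[OF X(1)] by blast+
    interpret X: group "G\<lparr>carrier := ?X\<rparr>" by (rule subgroup_imp_group[OF sX])
    have "N \<in> X" using subgroup.one_closed[OF X(1)] by simp
    then have NX: "N \<subseteq> ?X" by auto
    have "card ?X = p ^ Suc n"
      using X.lagrange[OF subgroup_incl[OF N.subgroup_axioms sX NX]] cX N(2)
        N.factgroup_subgroup_union_factor[OF X(1)] by (simp add: order_def)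
    moreover have "?X \<subseteq> H" using X(2) memX inH by blast
    moreover have "inv a \<otimes> x \<otimes> a \<in> H" if "x \<in> ?X" for x
    proof -
      have x: "x \<in> carrier G" "N #> x \<in> ?L" using memX[OF that] X(2) by blast+
      then obtain h where h: "h \<in> H" "N #> x = g \<otimes>\<^bsub>G Mod N\<^esub> (N #> h) \<otimes>\<^bsub>G Mod N\<^esub> inv\<^bsub>G Mod N\<^esub> g"
        by (auto simp: l_coset_def r_coset_def)
      have hG: "h \<in> carrier G" using h Hs by auto
      have "N #> (inv a \<otimes> x \<otimes> a) = inv\<^bsub>G Mod N\<^esub> g \<otimes>\<^bsub>G Mod N\<^esub> (N #> x) \<otimes>\<^bsub>G Mod N\<^esub> g"
        using a x q.hom_mult q.hom_inv by simp
      also have "\<dots> = N #> h"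
        using h(2) M.conjugation_is_surj[of "inv\<^bsub>G Mod N\<^esub> g" "N #> h"] q.hom_closed[OF a(1)] q.hom_closed[OF hG] a(2)
        by (simp del: mult_FactGroup)
      finally have "N #> (inv a \<otimes> x \<otimes> a) \<in> ?H" using h by auto
      then show ?thesis using inH[of "inv a \<otimes> x \<otimes> a"] a x by auto
    qed
    ultimately have "?X \<subseteq> N" using meet[of a ?X] a aH sX by blast
    have "X \<subseteq> {N}"
    proof
      fix Y assume Y: "Y \<in> X"
      then obtain y where y: "y \<in> carrier G" "Y = N #> y"
        using subgroup.subset[OF X(1)] by (auto simp: carrier_FactGroup)
      then have "y \<in> N" using \<open>?X \<subseteq> N\<close> Y rcos_self[OF y(1) N.subgroup_axioms] by blast
      then show "Y \<in> {N}" using y N.subgroup_axioms by (simp add: coset_join2)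
    qed
    then have "card X \<le> 1" using card_mono[of "{N}" X] by simp
    then show False using cX prime_gt_1_nat[OF p] by simp
  qed
  ultimately show ?thesis unfolding strongly_embedded_def using sH by blast
qed

end

section \<open>Conjugation and centralisers\<close>

context group
begin

lemma conj_mult:
  assumes "g \<in> carrier G" "x \<in> carrier G" "y \<in> carrier G"
  shows "g \<otimes> (x \<otimes> y) \<otimes> inv g = (g \<otimes> x \<otimes> inv g) \<otimes> (g \<otimes> y \<otimes> inv g)"
  using assms by (simp add: m_assoc) (simp flip: m_assoc)

lemma conj_conj:
  assumes "g \<in> carrier G" "h \<in> carrier G" "x \<in> carrier G"
  shows "g \<otimes> (h \<otimes> x \<otimes> inv h) \<otimes> inv g = (g \<otimes> h) \<otimes> x \<otimes> inv (g \<otimes> h)"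
  using assms by (simp add: m_assoc inv_mult_group)

lemma inv_conj_cancel [simp]:
  assumes "g \<in> carrier G" "x \<in> carrier G"
  shows "inv g \<otimes> (g \<otimes> x \<otimes> inv g) \<otimes> g = x" and "g \<otimes> (inv g \<otimes> x \<otimes> g) \<otimes> inv g = x"
  using conjugation_is_surj[of "inv g" x] conjugation_is_surj[of g x] assms by simp_all

lemma conj_eq_iff:
  assumes "g \<in> carrier G" "x \<in> carrier G" "y \<in> carrier G"
  shows "g \<otimes> x \<otimes> inv g = y \<longleftrightarrow> g \<otimes> x = y \<otimes> g"
proof -
  have "g \<otimes> x \<otimes> inv g = y \<longleftrightarrow> g \<otimes> x \<otimes> inv g \<otimes> g = y \<otimes> g" using assms by simp
  also have "g \<otimes> x \<otimes> inv g \<otimes> g = g \<otimes> x" using assms by (simp add: m_assoc)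
  finally show ?thesis .
qed

lemma subgroup_conj_closed:
  assumes "subgroup U G" "g \<in> U" "u \<in> U"
  shows "g \<otimes> u \<otimes> inv g \<in> U"
  using assms by (simp add: subgroup.m_closed subgroup.m_inv_closed)

text \<open>
  The element \<open>k a\<^sup>-\<^sup>1 h\<^sup>-\<^sup>1\<close> arises when \<open>h\<close>
  conjugates a \<open>p\<close>-subgroup \<open>X\<close>, and \<open>k\<close> conjugates
  \<open>a\<^sup>-\<^sup>1 X a\<close>, into one and the same Sylow subgroup.
\<close>
lemma conj_of_translate:
  assumes "a \<in> carrier G" "h \<in> carrier G" "k \<in> carrier G"
  shows "inv (inv k \<otimes> (k \<otimes> inv a \<otimes> inv h) \<otimes> h) = a"
    and "x \<in> carrier G \<Longrightarrow> (k \<otimes> inv a \<otimes> inv h) \<otimes> (h \<otimes> x \<otimes> inv h)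
      = (k \<otimes> (inv a \<otimes> x \<otimes> a) \<otimes> inv k) \<otimes> (k \<otimes> inv a \<otimes> inv h)"
proof -
  have c1: "inv u \<otimes> (u \<otimes> v) = v" and c2: "u \<otimes> (inv u \<otimes> v) = v"
    if "u \<in> carrier G" "v \<in> carrier G" for u v
    using that by (simp_all flip: m_assoc)
  show "inv (inv k \<otimes> (k \<otimes> inv a \<otimes> inv h) \<otimes> h) = a"
    using assms by (simp add: m_assoc c1 c2)
  show "x \<in> carrier G \<Longrightarrow> (k \<otimes> inv a \<otimes> inv h) \<otimes> (h \<otimes> x \<otimes> inv h)
      = (k \<otimes> (inv a \<otimes> x \<otimes> a) \<otimes> inv k) \<otimes> (k \<otimes> inv a \<otimes> inv h)"
    using assms by (simp add: m_assoc c1 c2)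
qed

lemma centralizer_iff: "g \<in> centralizer G R \<longleftrightarrow> g \<in> carrier G \<and> (\<forall>x\<in>R. g \<otimes> x = x \<otimes> g)"
  by (simp add: centralizer_def)

lemma conj_eq_imp_centralizer:
  assumes R: "R \<subseteq> carrier G" and g: "g \<in> carrier G" "h \<in> carrier G"
    and eq: "\<And>x. x \<in> R \<Longrightarrow> g \<otimes> x \<otimes> inv g = h \<otimes> x \<otimes> inv h"
  shows "inv h \<otimes> g \<in> centralizer G R"
  unfolding centralizer_iff
proof (intro conjI ballI)
  fix x assume x: "x \<in> R"
  then have xG: "x \<in> carrier G" using R by auto
  have "(inv h \<otimes> g) \<otimes> x \<otimes> inv (inv h \<otimes> g) = inv h \<otimes> (g \<otimes> x \<otimes> inv g) \<otimes> inv (inv h)"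
    using conj_conj[of "inv h" g x] g xG by simp
  also have "\<dots> = x" using eq[OF x] g xG by simp
  finally show "inv h \<otimes> g \<otimes> x = x \<otimes> (inv h \<otimes> g)" using conj_eq_iff[of "inv h \<otimes> g" x x] g xG by simp
qed (use g in simp)

end

section \<open>Morphisms of a fusion system\<close>

text \<open>
  The parameter \<open>G\<close> names the underlying group, so that its operations can be written
  without an index.
\<close>
locale fusion_sys =
  fixes G :: "'a monoid" (structure) and p :: nat and F :: "'a fusion"
  assumes fusion: "fusion_system p F" and G_def: "G = grp F"
begin

lemma grp_F [simp]: "grp F = G"
  by (simp add: G_def)

lemma p_prime: "prime p" and group_G: "group G" and card_G: "\<exists>n. card (carrier G) = p ^ n"
  using fusion by (auto simp: fusion_system_def p_group_def order_def)

sublocale group G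
  by (rule group_G)

lemma prefusion_F: "prefusion F"
  by (rule fusion_system_prefusion[OF fusion])

lemma finite_G: "finite (carrier G)"
  using prefusion_F by (simp add: prefusion_def)

lemma finite_subgroup: "subgroup U G \<Longrightarrow> finite U"
  using finite_G subgroup.subset finite_subset by blast

lemma card_subgroup: "subgroup U G \<Longrightarrow> \<exists>n. card U = p ^ n"
  using p_power_card_subgroup[OF p_prime subgroup_self _ _ subgroup.subset] card_G by metis

lemma subgroup_normalizer: "U \<subseteq> carrier G \<Longrightarrow> subgroup (normalizer G U) G"
  by (rule normalizer_imp_subgroup)

text \<open>
  As \<open>U\<close> is finite, a conjugate of \<open>U\<close> that is contained in
  \<open>U\<close> equals \<open>U\<close>.
\<close>
lemma normalizer_iff:
  assumes U: "subgroup U G"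
  shows "g \<in> normalizer G U \<longleftrightarrow> g \<in> carrier G \<and> (\<forall>u\<in>U. g \<otimes> u \<otimes> inv g \<in> U)"
proof -
  have Us: "U \<subseteq> carrier G" using U subgroup.subset by auto
  have img: "g <# U #> inv g = (\<lambda>u. g \<otimes> u \<otimes> inv g) ` U" for g
    by (auto simp: l_coset_def r_coset_def)
  have "(\<lambda>u. g \<otimes> u \<otimes> inv g) ` U = U" if g: "g \<in> carrier G" "\<forall>u\<in>U. g \<otimes> u \<otimes> inv g \<in> U"
  proof (rule endo_inj_surj[OF finite_subgroup[OF U]])
    show "inj_on (\<lambda>u. g \<otimes> u \<otimes> inv g) U"
      by (intro inj_onI) (use g Us in \<open>auto simp: subset_iff\<close>)
  qed (use g in auto)
  then show ?thesis using Us by (auto simp: normalizer_def stabilizer_def img)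
qed

lemma normalizer_conj:
  assumes "subgroup U G" "g \<in> normalizer G U" "u \<in> U"
  shows "g \<otimes> u \<otimes> inv g \<in> U" and "inv g \<otimes> u \<otimes> g \<in> U"
proof -
  show "g \<otimes> u \<otimes> inv g \<in> U" using assms normalizer_iff by simp
  have "inv g \<in> normalizer G U"
    using assms subgroup.m_inv_closed[OF subgroup_normalizer] subgroup.subset by metis
  moreover have "g \<in> carrier G" using assms normalizer_iff by simp
  ultimately show "inv g \<otimes> u \<otimes> g \<in> U" using normalizer_iff[OF assms(1), of "inv g"] assms by simp
qed

lemma subset_normalizer: "subgroup U G \<Longrightarrow> U \<subseteq> normalizer G U"
  by (rule subsetI) (simp add: normalizer_iff subgroup_conj_closed subgroup.mem_carrier)

lemma normalizer_grows:
  assumes U: "subgroup U G" and N: "normalizer G U \<subseteq> U"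
  shows "U = carrier G"
proof (rule ccontr)
  assume "U \<noteq> carrier G"
  moreover obtain n where "card (carrier G) = p ^ n" using card_G by blast
  ultimately obtain a where "a \<in> carrier G - U" "\<forall>x\<in>U. a \<otimes> x \<otimes> inv a \<in> U"
    using p_subgroup_normalizer_grows[OF p_prime subgroup_self _ U subgroup.subset[OF U]] by blast
  then show False using N normalizer_iff[OF U] by blast
qed

lemma conj_map_apply [simp]: "x \<in> U \<Longrightarrow> conj_map G g U x = g \<otimes> x \<otimes> inv g"
  by (simp add: conj_map_def)

lemma Mor_subgroup:
  assumes "\<phi> \<in> Mor F U V"
  shows "subgroup U G" and "subgroup V G"
  using fusion assms unfolding fusion_system_def by auto

lemma Mor_sub:
  assumes "\<phi> \<in> Mor F U V"
  shows "U \<subseteq> carrier G" and "V \<subseteq> carrier G"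
  using Mor_subgroup[OF assms] subgroup.subset by blast+

lemma Mor_props:
  assumes \<phi>: "\<phi> \<in> Mor F U V"
  shows "\<phi> \<in> extensional U" and "\<phi> \<in> hom (G\<lparr>carrier := U\<rparr>) (G\<lparr>carrier := V\<rparr>)" and "inj_on \<phi> U"
proof -
  have UV: "subgroup U (grp F)" "subgroup V (grp F)" using Mor_subgroup[OF \<phi>] by simp_all
  then have "Mor F U V \<subseteq> {\<phi> \<in> extensional U.
      \<phi> \<in> hom ((grp F)\<lparr>carrier := U\<rparr>) ((grp F)\<lparr>carrier := V\<rparr>) \<and> inj_on \<phi> U}"
    using fusion unfolding fusion_system_def by blast
  then show "\<phi> \<in> extensional U" "\<phi> \<in> hom (G\<lparr>carrier := U\<rparr>) (G\<lparr>carrier := V\<rparr>)" "inj_on \<phi> U"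
    using \<phi> by auto
qed

lemma Mor_mem: "\<phi> \<in> Mor F U V \<Longrightarrow> x \<in> U \<Longrightarrow> \<phi> x \<in> V"
  using hom_in_carrier[OF Mor_props(2), of \<phi> U V x] by simp

lemma Mor_carrier: "\<phi> \<in> Mor F U V \<Longrightarrow> x \<in> U \<Longrightarrow> \<phi> x \<in> carrier G"
  using Mor_mem Mor_sub by blast

lemma Mor_mult:
  "\<phi> \<in> Mor F U V \<Longrightarrow> x \<in> U \<Longrightarrow> y \<in> U \<Longrightarrow> \<phi> (x \<otimes> y) = \<phi> x \<otimes> \<phi> y"
  using hom_mult[OF Mor_props(2), of \<phi> U V x y] by simp

lemma Mor_group_hom:
  assumes "\<phi> \<in> Mor F U V"
  shows "group_hom (G\<lparr>carrier := U\<rparr>) G \<phi>"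
  unfolding group_hom_def group_hom_axioms_def
  using Mor_props(2)[OF assms] Mor_sub(2)[OF assms] subgroup_imp_group[OF Mor_subgroup(1)[OF assms]] is_group
  by (auto simp: hom_def)

lemma Mor_inv_elem:
  assumes \<phi>: "\<phi> \<in> Mor F U V" and x: "x \<in> U"
  shows "\<phi> (inv x) = inv (\<phi> x)"
proof -
  interpret h: group_hom "G\<lparr>carrier := U\<rparr>" G \<phi> by (rule Mor_group_hom[OF \<phi>])
  show ?thesis using h.hom_inv[of x] x m_inv_consistent[OF Mor_subgroup(1)[OF \<phi>] x] by simp
qed

lemma Mor_conj:
  assumes \<phi>: "\<phi> \<in> Mor F U V" and "g \<in> U" "x \<in> U"
  shows "\<phi> (g \<otimes> x \<otimes> inv g) = \<phi> g \<otimes> \<phi> x \<otimes> inv (\<phi> g)"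
  using assms Mor_subgroup(1)[OF \<phi>]
  by (simp add: Mor_mult Mor_inv_elem subgroup.m_closed subgroup.m_inv_closed)

lemma Mor_image_subgroup:
  assumes \<phi>: "\<phi> \<in> Mor F U V" and W: "subgroup W G" "W \<subseteq> U"
  shows "subgroup (\<phi> ` W) G"
proof -
  interpret h: group_hom "G\<lparr>carrier := U\<rparr>" G \<phi> by (rule Mor_group_hom[OF \<phi>])
  show ?thesis
    by (rule h.subgroup_img_is_subgroup[OF subgroup_incl[OF W(1) Mor_subgroup(1)[OF \<phi>] W(2)]])
qed

lemma Mor_image_sub: "\<phi> \<in> Mor F U V \<Longrightarrow> \<phi> ` U \<subseteq> V"
  using Mor_mem by blast

lemma Mor_card:
  assumes "\<phi> \<in> Mor F U V" "W \<subseteq> U"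
  shows "card (\<phi> ` W) = card W"
  using card_image[OF inj_on_subset[OF Mor_props(3)[OF assms(1)] assms(2)]] .

lemma Mor_inj: "\<phi> \<in> Mor F U V \<Longrightarrow> x \<in> U \<Longrightarrow> y \<in> U \<Longrightarrow> \<phi> x = \<phi> y \<Longrightarrow> x = y"
  by (rule inj_onD[OF Mor_props(3)])

lemma Mor_endo_onto: "\<phi> \<in> Mor F U U \<Longrightarrow> \<phi> ` U = U"
  using endo_inj_surj[OF finite_subgroup[OF Mor_subgroup(1)] Mor_image_sub Mor_props(3)] .

lemma Mor_eqI:
  assumes "\<phi> \<in> Mor F U V" "\<psi> \<in> Mor F U W" "\<And>x. x \<in> U \<Longrightarrow> \<phi> x = \<psi> x"
  shows "\<phi> = \<psi>"
  using extensionalityI[OF Mor_props(1)[OF assms(1)] Mor_props(1)[OF assms(2)] assms(3)] .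

lemma Mor_conj_map:
  assumes U: "subgroup U G" and V: "subgroup V G" and g: "g \<in> carrier G"
    and "\<And>u. u \<in> U \<Longrightarrow> g \<otimes> u \<otimes> inv g \<in> V"
  shows "conj_map G g U \<in> Mor F U V"
proof -
  have "conj_map G g U \<in> conj_hom (grp F) U V"
    using assms by (auto simp: conj_hom_def)
  moreover have "conj_hom (grp F) U V \<subseteq> Mor F U V"
    using fusion U V unfolding fusion_system_def grp_F by blast
  ultimately show ?thesis by blast
qed

lemma Mor_comp:
  assumes "\<phi> \<in> Mor F U V" "\<psi> \<in> Mor F V W"
  shows "(\<lambda>x\<in>U. \<psi> (\<phi> x)) \<in> Mor F U W"
  using fusion assms unfolding fusion_system_def compose_def by blast

lemma Mor_incl:
  assumes U: "subgroup U G" and V: "subgroup V G" and "U \<subseteq> V"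
  shows "(\<lambda>x\<in>U. x) \<in> Mor F U V"
proof -
  have "conj_map G \<one> U = (\<lambda>x\<in>U. x)"
    using subgroup.mem_carrier[OF U] by (auto simp: conj_map_def intro!: restrict_ext)
  moreover have "conj_map G \<one> U \<in> Mor F U V"
    by (rule Mor_conj_map[OF U V]) (use \<open>U \<subseteq> V\<close> subgroup.mem_carrier[OF U] in auto)
  ultimately show ?thesis by simp
qed

lemma Mor_image: "\<phi> \<in> Mor F U V \<Longrightarrow> \<phi> \<in> Mor F U (\<phi> ` U)"
  using fusion unfolding fusion_system_def by blast

lemma Mor_inv_into:
  assumes "\<phi> \<in> Mor F U V"
  shows "restrict (inv_into U \<phi>) (\<phi> ` U) \<in> Mor F (\<phi> ` U) U"
  using fusion assms unfolding fusion_system_def by blast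

lemma Mor_restrict:
  assumes \<phi>: "\<phi> \<in> Mor F U V" and W: "subgroup W G" "W \<subseteq> U" and X: "subgroup X G" "\<phi> ` W \<subseteq> X"
  shows "restrict \<phi> W \<in> Mor F W X"
proof -
  have "(\<lambda>x\<in>W. \<phi> ((\<lambda>x\<in>W. x) x)) \<in> Mor F W V"
    by (rule Mor_comp[OF Mor_incl[OF W(1) Mor_subgroup(1)[OF \<phi>] W(2)] \<phi>])
  then have "restrict \<phi> W \<in> Mor F W V" by (simp add: restrict_def cong: if_cong)
  then have 1: "restrict \<phi> W \<in> Mor F W (\<phi> ` W)" using Mor_image by fastforce
  have "(\<lambda>x\<in>W. (\<lambda>x\<in>\<phi> ` W. x) (restrict \<phi> W x)) \<in> Mor F W X"
    by (rule Mor_comp[OF 1 Mor_incl[OF Mor_subgroup(2)[OF 1] X]])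
  then show ?thesis by (simp add: restrict_def cong: if_cong)
qed

lemma Mor_codomain:
  assumes \<phi>: "\<phi> \<in> Mor F U V" and X: "subgroup X G" "\<phi> ` U \<subseteq> X"
  shows "\<phi> \<in> Mor F U X"
  using Mor_restrict[OF \<phi> Mor_subgroup(1)[OF \<phi>] order_refl X] Mor_props(1)[OF \<phi>]
  by (simp add: extensional_restrict)

lemma Mor_inverse:
  assumes \<phi>: "\<phi> \<in> Mor F U V" and onto: "\<phi> ` U = V"
  obtains \<chi> where "\<chi> \<in> Mor F V U" "\<And>x. x \<in> U \<Longrightarrow> \<chi> (\<phi> x) = x" "\<And>y. y \<in> V \<Longrightarrow> \<phi> (\<chi> y) = y"
    "\<chi> ` V = U"
proof
  let ?\<chi> = "restrict (inv_into U \<phi>) V"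
  show m: "?\<chi> \<in> Mor F V U"
    using Mor_inv_into[OF \<phi>] onto by simp
  show "?\<chi> (\<phi> x) = x" if "x \<in> U" for x
    using that Mor_props(3)[OF \<phi>] onto Mor_mem[OF \<phi>] by (simp add: inv_into_f_f)
  then show "?\<chi> ` V = U" using onto by force
  show "\<phi> (?\<chi> y) = y" if "y \<in> V" for y
    using that onto by (simp add: f_inv_into_f)
qed

section \<open>Automorphism groups\<close>

lemma Aut_carrier [simp]: "carrier (Aut_fus F U) = Mor F U U"
  by (simp add: Aut_fus_def)

lemma Mor_Bij: "\<alpha> \<in> Mor F U U \<Longrightarrow> \<alpha> \<in> Bij U"
  using Mor_props Mor_endo_onto by (auto simp: Bij_def bij_betw_def)

lemma Aut_mult:
  assumes "\<alpha> \<in> Mor F U U" "\<beta> \<in> Mor F U U"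
  shows "\<alpha> \<otimes>\<^bsub>Aut_fus F U\<^esub> \<beta> = (\<lambda>x\<in>U. \<alpha> (\<beta> x))"
  using Mor_Bij[OF assms(1)] Mor_Bij[OF assms(2)] by (simp add: Aut_fus_def BijGroup_def compose_def)

lemma Aut_mult_apply [simp]:
  assumes "\<alpha> \<in> Mor F U U" "\<beta> \<in> Mor F U U" "x \<in> U"
  shows "(\<alpha> \<otimes>\<^bsub>Aut_fus F U\<^esub> \<beta>) x = \<alpha> (\<beta> x)"
  using Aut_mult[OF assms(1,2)] assms(3) by simp

lemma Aut_one [simp]: "\<one>\<^bsub>Aut_fus F U\<^esub> = (\<lambda>x\<in>U. x)"
  by (simp add: Aut_fus_def BijGroup_def)

lemma group_Aut:
  assumes U: "subgroup U G"
  shows "group (Aut_fus F U)"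
proof -
  interpret B: group "BijGroup U" by (rule group_BijGroup)
  have "subgroup (Mor F U U) (BijGroup U)"
  proof (rule B.subgroupI)
    show "Mor F U U \<subseteq> carrier (BijGroup U)" using Mor_Bij by (auto simp: BijGroup_def)
    show "Mor F U U \<noteq> {}" using Mor_incl[OF U U] by auto
    show "inv\<^bsub>BijGroup U\<^esub> \<alpha> \<in> Mor F U U" if \<alpha>: "\<alpha> \<in> Mor F U U" for \<alpha>
    proof -
      have "restrict (inv_into U \<alpha>) U \<in> Mor F U U"
        using Mor_inv_into[OF \<alpha>] Mor_endo_onto[OF \<alpha>] by simp
      then show ?thesis using inv_BijGroup[OF Mor_Bij[OF \<alpha>]] by simp
    qed
    show "\<alpha> \<otimes>\<^bsub>BijGroup U\<^esub> \<beta> \<in> Mor F U U" if "\<alpha> \<in> Mor F U U" "\<beta> \<in> Mor F U U" for \<alpha> \<beta>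
      using Mor_Bij[OF that(1)] Mor_Bij[OF that(2)] Mor_comp[OF that(2,1)]
      by (simp add: BijGroup_def compose_def)
  qed
  then show ?thesis unfolding Aut_fus_def by (rule B.subgroup_imp_group)
qed

lemma finite_Aut:
  assumes "subgroup U G"
  shows "finite (Mor F U U)"
proof (rule finite_subset)
  show "Mor F U U \<subseteq> U \<rightarrow>\<^sub>E U"
  proof
    fix \<alpha> assume "\<alpha> \<in> Mor F U U"
    then show "\<alpha> \<in> U \<rightarrow>\<^sub>E U" using Mor_props(1) Mor_mem by (simp add: PiE_def Pi_iff)
  qed
  show "finite (U \<rightarrow>\<^sub>E U)" by (intro finite_PiE finite_subgroup[OF assms])
qed

lemma Aut_inv_apply [simp]:
  assumes \<alpha>: "\<alpha> \<in> Mor F U U" and x: "x \<in> U"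
  shows "(inv\<^bsub>Aut_fus F U\<^esub> \<alpha>) (\<alpha> x) = x" and "\<alpha> ((inv\<^bsub>Aut_fus F U\<^esub> \<alpha>) x) = x"
proof -
  interpret A: group "Aut_fus F U" by (rule group_Aut[OF Mor_subgroup(1)[OF \<alpha>]])
  have i: "inv\<^bsub>Aut_fus F U\<^esub> \<alpha> \<in> Mor F U U" using A.inv_closed \<alpha> by simp
  show "(inv\<^bsub>Aut_fus F U\<^esub> \<alpha>) (\<alpha> x) = x"
    using Aut_mult_apply[OF i \<alpha> x] A.l_inv[of \<alpha>] \<alpha> x by simp
  show "\<alpha> ((inv\<^bsub>Aut_fus F U\<^esub> \<alpha>) x) = x"
    using Aut_mult_apply[OF \<alpha> i x] A.r_inv[of \<alpha>] \<alpha> x by simp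
qed

lemma Aut_inv_closed: "\<alpha> \<in> Mor F U U \<Longrightarrow> inv\<^bsub>Aut_fus F U\<^esub> \<alpha> \<in> Mor F U U"
  using group.inv_closed[OF group_Aut[OF Mor_subgroup(1)]] by simp

lemma conj_aut_Mor: "subgroup U G \<Longrightarrow> conj_aut G U \<subseteq> Mor F U U"
  using Mor_conj_map normalizer_conj normalizer_iff by (fastforce simp: conj_aut_def)

lemma conj_aut_iff:
  assumes "\<alpha> \<in> Mor F U U"
  shows "\<alpha> \<in> conj_aut G U \<longleftrightarrow> (\<exists>g\<in>normalizer G U. \<forall>u\<in>U. \<alpha> u = g \<otimes> u \<otimes> inv g)"
proof
  show "\<alpha> \<in> conj_aut G U \<Longrightarrow> \<exists>g\<in>normalizer G U. \<forall>u\<in>U. \<alpha> u = g \<otimes> u \<otimes> inv g"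
    by (auto simp: conj_aut_def)
next
  assume "\<exists>g\<in>normalizer G U. \<forall>u\<in>U. \<alpha> u = g \<otimes> u \<otimes> inv g"
  then obtain g where "g \<in> normalizer G U" "\<forall>u\<in>U. \<alpha> u = g \<otimes> u \<otimes> inv g" by blast
  moreover from this have "\<alpha> = conj_map G g U"
    using Mor_props(1)[OF assms] by (intro extensionalityI[of _ U]) (auto simp: conj_map_def)
  ultimately show "\<alpha> \<in> conj_aut G U" by (auto simp: conj_aut_def)
qed

text \<open>
  The group \<open>P\<close> consists of the maps \<open>\<phi> c\<^sub>m
  \<phi>\<^sup>-\<^sup>1\<close>, where \<open>c\<^sub>m\<close> is conjugation by \<open>m \<in>
  M\<close>. It is a \<open>p\<close>-group, being an image of \<open>M\<close>. The last two
  clauses describe it without an inverse of \<open>\<phi>\<close>.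
\<close>
lemma conj_transport:
  assumes \<phi>: "\<phi> \<in> Mor F U V" "\<phi> ` U = V" and M: "subgroup M G" "M \<subseteq> normalizer G U"
  obtains P n where "subgroup P (Aut_fus F V)" "card P = p ^ n"
    "\<And>m. m \<in> M \<Longrightarrow> \<exists>\<pi>\<in>P. \<forall>u\<in>U. \<pi> (\<phi> u) = \<phi> (m \<otimes> u \<otimes> inv m)"
    "\<And>\<pi>. \<pi> \<in> P \<Longrightarrow> \<exists>m\<in>M. \<forall>u\<in>U. \<pi> (\<phi> u) = \<phi> (m \<otimes> u \<otimes> inv m)"
proof -
  obtain \<chi> where \<chi>: "\<chi> \<in> Mor F V U" "\<And>x. x \<in> U \<Longrightarrow> \<chi> (\<phi> x) = x" "\<And>y. y \<in> V \<Longrightarrow> \<phi> (\<chi> y) = y"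
    using Mor_inverse[OF \<phi>] by metis
  note U = Mor_subgroup(1)[OF \<phi>(1)] and V = Mor_subgroup(2)[OF \<phi>(1)]
  let ?h = "\<lambda>m. \<lambda>x\<in>V. \<phi> (m \<otimes> \<chi> x \<otimes> inv m)"
  have Ms: "M \<subseteq> carrier G" and Us: "U \<subseteq> carrier G"
    using M U subgroup.subset by auto
  have mor: "?h m \<in> Mor F V V" if m: "m \<in> M" for m
  proof -
    have "conj_map G m U \<in> Mor F U U"
      by (rule Mor_conj_map[OF U U]) (use m Ms M normalizer_iff[OF U] in auto)
    from Mor_comp[OF Mor_comp[OF \<chi>(1) this] \<phi>(1)]
    show ?thesis using Mor_mem[OF \<chi>(1)] by (simp cong: restrict_cong)
  qed
  have hom: "?h \<in> hom (G\<lparr>carrier := M\<rparr>) (Aut_fus F V)"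
  proof (rule homI)
    fix m n assume "m \<in> carrier (G\<lparr>carrier := M\<rparr>)" "n \<in> carrier (G\<lparr>carrier := M\<rparr>)"
    then have m: "m \<in> M" "n \<in> M" by auto
    then have mn: "m \<otimes> n \<in> M" using subgroup.m_closed[OF M(1)] by blast
    have "?h (m \<otimes> n) = ?h m \<otimes>\<^bsub>Aut_fus F V\<^esub> ?h n"
    proof (rule Mor_eqI[OF mor[OF mn]])
      show "?h m \<otimes>\<^bsub>Aut_fus F V\<^esub> ?h n \<in> Mor F V V"
        unfolding Aut_mult[OF mor[OF m(1)] mor[OF m(2)]] by (rule Mor_comp[OF mor[OF m(2)] mor[OF m(1)]])
      fix x assume x: "x \<in> V"
      have cx: "\<chi> x \<in> U" using Mor_mem[OF \<chi>(1) x] .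
      have nx: "n \<otimes> \<chi> x \<otimes> inv n \<in> U" using normalizer_conj[OF U _ cx] m M by blast
      show "?h (m \<otimes> n) x = (?h m \<otimes>\<^bsub>Aut_fus F V\<^esub> ?h n) x"
        using x mor[OF m(1)] mor[OF m(2)] nx cx m Ms Us
        by (simp add: Mor_mem[OF \<phi>(1)] \<chi>(2) conj_conj subset_iff)
    qed
    then show "?h (m \<otimes>\<^bsub>G\<lparr>carrier := M\<rparr>\<^esub> n) = ?h m \<otimes>\<^bsub>Aut_fus F V\<^esub> ?h n" by simp
  qed (use mor in simp)
  obtain k where k: "card M = p ^ k" using card_subgroup[OF M(1)] by blast
  note im = p_power_card_hom_image[OF p_prime M(1) k group_Aut[OF V] hom]
  obtain n where n: "card (?h ` M) = p ^ n" using im(2) by blast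
  have app: "?h m (\<phi> u) = \<phi> (m \<otimes> u \<otimes> inv m)" if "u \<in> U" for m u
    using that by (simp add: Mor_mem[OF \<phi>(1)] \<chi>(2))
  show thesis
    by (rule that[OF im(1) n]) (use app in blast)+
qed

lemma conj_group_p_subgroup:
  assumes U: "subgroup U G" and M: "subgroup M G" "M \<subseteq> normalizer G U"
  shows "subgroup ((\<lambda>g. conj_map G g U) ` M) (Aut_fus F U)"
    and "\<exists>n. card ((\<lambda>g. conj_map G g U) ` M) = p ^ n"
proof -
  have id: "(\<lambda>x\<in>U. x) \<in> Mor F U U" "(\<lambda>x\<in>U. x) ` U = U" using Mor_incl[OF U U] by auto
  obtain P n where P: "subgroup P (Aut_fus F U)" "card P = p ^ n"
    "\<And>m. m \<in> M \<Longrightarrow> \<exists>\<pi>\<in>P. \<forall>u\<in>U. \<pi> ((\<lambda>x\<in>U. x) u) = (\<lambda>x\<in>U. x) (m \<otimes> u \<otimes> inv m)"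
    "\<And>\<pi>. \<pi> \<in> P \<Longrightarrow> \<exists>m\<in>M. \<forall>u\<in>U. \<pi> ((\<lambda>x\<in>U. x) u) = (\<lambda>x\<in>U. x) (m \<otimes> u \<otimes> inv m)"
    using conj_transport[OF id M] by metis
  have Pm: "P \<subseteq> Mor F U U" using subgroup.subset[OF P(1)] by simp
  have eq: "\<pi> = conj_map G m U" if "\<pi> \<in> P" "m \<in> M"
    "\<forall>u\<in>U. \<pi> ((\<lambda>x\<in>U. x) u) = (\<lambda>x\<in>U. x) (m \<otimes> u \<otimes> inv m)" for \<pi> m
  proof (rule extensionalityI[of _ U])
    show "\<pi> \<in> extensional U" using that Pm Mor_props(1) by blast
    show "conj_map G m U \<in> extensional U" by (simp add: conj_map_def)
    show "\<pi> x = conj_map G m U x" if "x \<in> U" for x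
      using \<open>\<forall>u\<in>U. _\<close> that normalizer_conj[OF U, of m] \<open>m \<in> M\<close> M(2) by auto
  qed
  have "(\<lambda>g. conj_map G g U) ` M = P"
  proof
    show "(\<lambda>g. conj_map G g U) ` M \<subseteq> P" using P(3) eq by fastforce
    show "P \<subseteq> (\<lambda>g. conj_map G g U) ` M" using P(4) eq by blast
  qed
  then show "subgroup ((\<lambda>g. conj_map G g U) ` M) (Aut_fus F U)"
    "\<exists>n. card ((\<lambda>g. conj_map G g U) ` M) = p ^ n" using P by auto
qed

lemma conj_aut_image: "conj_aut G U = (\<lambda>g. conj_map G g U) ` normalizer G U"
  unfolding conj_aut_def by (rule Setcompr_eq_image)

lemma inner_aut_image: "inner_aut G U = (\<lambda>g. conj_map G g U) ` U"
  unfolding inner_aut_def by (rule Setcompr_eq_image)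

lemma normal_inner_aut:
  assumes U: "subgroup U G"
  shows "normal (inner_aut G U) (Aut_fus F U)" and "\<exists>n. card (inner_aut G U) = p ^ n"
proof -
  let ?A = "Aut_fus F U"
  interpret A: group "?A" by (rule group_Aut[OF U])
  note im = conj_group_p_subgroup[OF U U subset_normalizer[OF U]]
  show "\<exists>n. card (inner_aut G U) = p ^ n" using im(2) by (simp add: inner_aut_image)
  show "normal (inner_aut G U) (?A)"
  proof (rule A.normal_invI)
    show "subgroup (inner_aut G U) (?A)" using im(1) by (simp add: inner_aut_image)
    fix \<alpha> \<beta> assume a: "\<alpha> \<in> carrier (?A)" and b: "\<beta> \<in> inner_aut G U"
    then have \<alpha>: "\<alpha> \<in> Mor F U U" by simp
    obtain g where g: "g \<in> U" "\<beta> = conj_map G g U" using b by (auto simp: inner_aut_def)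
    have \<beta>: "\<beta> \<in> Mor F U U" unfolding g
      by (rule Mor_conj_map[OF U U]) (use g subgroup.mem_carrier[OF U] subgroup_conj_closed[OF U] in auto)
    note \<alpha>i = Aut_inv_closed[OF \<alpha>]
    have "\<alpha> \<otimes>\<^bsub>?A\<^esub> \<beta> \<otimes>\<^bsub>?A\<^esub> inv\<^bsub>?A\<^esub> \<alpha> = conj_map G (\<alpha> g) U"
    proof (rule Mor_eqI)
      show "\<alpha> \<otimes>\<^bsub>?A\<^esub> \<beta> \<otimes>\<^bsub>?A\<^esub> inv\<^bsub>?A\<^esub> \<alpha> \<in> Mor F U U"
        using A.m_closed A.inv_closed \<alpha> \<beta> by (simp del: Aut_mult_apply)
      show "conj_map G (\<alpha> g) U \<in> Mor F U U"
        by (rule Mor_conj_map[OF U U])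
          (use g Mor_mem[OF \<alpha>] subgroup.mem_carrier[OF U] subgroup_conj_closed[OF U] in auto)
      fix x assume x: "x \<in> U"
      have ix: "(inv\<^bsub>?A\<^esub> \<alpha>) x \<in> U" using Mor_mem[OF \<alpha>i x] .
      have ab: "\<alpha> \<otimes>\<^bsub>?A\<^esub> \<beta> \<in> Mor F U U" using A.m_closed \<alpha> \<beta> by simp
      show "(\<alpha> \<otimes>\<^bsub>?A\<^esub> \<beta> \<otimes>\<^bsub>?A\<^esub> inv\<^bsub>?A\<^esub> \<alpha>) x = conj_map G (\<alpha> g) U x"
        using x ix \<alpha>i ab \<alpha> \<beta> by (simp add: g Mor_conj[OF \<alpha>])
    qed
    then show "\<alpha> \<otimes>\<^bsub>?A\<^esub> \<beta> \<otimes>\<^bsub>?A\<^esub> inv\<^bsub>?A\<^esub> \<alpha> \<in> inner_aut G U"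
      using Mor_mem[OF \<alpha> g(1)] by (auto simp: inner_aut_def)
  qed
qed

lemma p_group_conj_aut:
  assumes U: "subgroup U G"
  shows "subgroup (conj_aut G U) (Aut_fus F U)" and "\<exists>n. card (conj_aut G U) = p ^ n"
proof -
  have N: "subgroup (normalizer G U) G" by (rule subgroup_normalizer[OF subgroup.subset[OF U]])
  show "subgroup (conj_aut G U) (Aut_fus F U)" and "\<exists>n. card (conj_aut G U) = p ^ n"
    unfolding conj_aut_image
    using conj_group_p_subgroup(1)[OF U N order_refl] conj_group_p_subgroup(2)[OF U N order_refl] by blast+
qed

section \<open>Extension of morphisms to normalisers\<close>

lemma centralizer_subset_normalizer:
  assumes R: "subgroup R G"
  shows "centralizer G R \<subseteq> normalizer G R"
proof
  fix c assume c: "c \<in> centralizer G R"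
  then have "c \<otimes> x \<otimes> inv c = x" if "x \<in> R" for x
    using conj_eq_iff[of c x x] that subgroup.mem_carrier[OF R] by (simp add: centralizer_iff)
  then show "c \<in> normalizer G R" using c by (simp add: normalizer_iff[OF R] centralizer_iff)
qed

lemma fusion_iso_iff: "fusion_iso F U V \<longleftrightarrow> (\<exists>\<phi>\<in>Mor F U V. \<phi> ` U = V)"
  by (simp add: fusion_iso_def)

lemma fusion_iso_refl: "subgroup U G \<Longrightarrow> fusion_iso F U U"
  unfolding fusion_iso_iff using Mor_incl[of U U] by (intro bexI[of _ "\<lambda>x\<in>U. x"]) auto

lemma fusion_iso_sym:
  assumes "fusion_iso F U V" shows "fusion_iso F V U"
proof -
  obtain \<phi> where \<phi>: "\<phi> \<in> Mor F U V" "\<phi> ` U = V" using assms by (auto simp: fusion_iso_iff)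
  obtain \<chi> where "\<chi> \<in> Mor F V U" "\<chi> ` V = U" by (rule Mor_inverse[OF \<phi>])
  then show ?thesis by (auto simp: fusion_iso_iff)
qed

lemma Mor_comp_onto:
  assumes "\<phi> ` U = V" "\<psi> ` V = W"
  shows "(\<lambda>x\<in>U. \<psi> (\<phi> x)) ` U = W"
  using assms by force

lemma fusion_iso_trans:
  assumes "fusion_iso F U V" "fusion_iso F V W" shows "fusion_iso F U W"
proof -
  obtain \<phi> where \<phi>: "\<phi> \<in> Mor F U V" "\<phi> ` U = V" using assms by (auto simp: fusion_iso_iff)
  obtain \<psi> where \<psi>: "\<psi> \<in> Mor F V W" "\<psi> ` V = W" using assms by (auto simp: fusion_iso_iff)
  show ?thesis unfolding fusion_iso_iff
    using Mor_comp_onto[OF \<phi>(2) \<psi>(2)] Mor_comp[OF \<phi>(1) \<psi>(1)] by blast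
qed

lemma centric_centralizer:
  assumes "centric F R"
  shows "centralizer G R \<subseteq> R"
proof -
  have R: "subgroup R G" using assms by (simp add: centric_def)
  then have "centralizer G R = center (G\<lparr>carrier := R\<rparr>)"
    using assms fusion_iso_refl[OF R] by (simp add: centric_def)
  then show ?thesis by (auto simp: center_def centralizer_def)
qed

lemma centricI:
  assumes R: "subgroup R G" and C: "\<And>W. fusion_iso F R W \<Longrightarrow> centralizer G W \<subseteq> W"
  shows "centric F R"
proof -
  have "centralizer G W = center (G\<lparr>carrier := W\<rparr>)" if W: "fusion_iso F R W" for W
  proof -
    have "subgroup W G" using W Mor_subgroup(2) by (auto simp: fusion_iso_iff)
    then show ?thesis using C[OF W] subgroup.mem_carrier[of W G]
      by (auto simp: center_def centralizer_def)
  qed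
  then show ?thesis using R by (simp add: centric_def)
qed

lemma centric_iso: "centric F R \<Longrightarrow> fusion_iso F R W \<Longrightarrow> centric F W"
  unfolding centric_def grp_F by (meson fusion_iso_trans Mor_subgroup(2) fusion_iso_iff)

lemma ext_control_iff:
  assumes \<phi>: "\<phi> \<in> Mor F U V" "\<phi> ` U = V"
  shows "g \<in> ext_control F U V \<phi> \<longleftrightarrow> g \<in> normalizer G U \<and>
    (\<exists>h\<in>normalizer G V. \<forall>u\<in>U. \<phi> (g \<otimes> u \<otimes> inv g) = h \<otimes> \<phi> u \<otimes> inv h)"
proof -
  let ?f = "compose V \<phi> (compose V (conj_map G g U) (inv_into U \<phi>))"
  have f: "?f (\<phi> u) = \<phi> (g \<otimes> u \<otimes> inv g)" if "u \<in> U" for u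
    using that Mor_mem[OF \<phi>(1)] Mor_props(3)[OF \<phi>(1)] by (simp add: compose_def inv_into_f_f)
  have "?f = conj_map G h V \<longleftrightarrow> (\<forall>u\<in>U. \<phi> (g \<otimes> u \<otimes> inv g) = h \<otimes> \<phi> u \<otimes> inv h)" (is "?L \<longleftrightarrow> ?R") for h
  proof
    assume l: ?L
    show ?R using f Mor_mem[OF \<phi>(1)] unfolding l by simp
  next
    assume r: ?R
    show ?L
    proof (rule extensionalityI[of _ V])
      show "?f \<in> extensional V" by (simp add: compose_def)
      show "conj_map G h V \<in> extensional V" by (simp add: conj_map_def)
      fix x assume "x \<in> V"
      then obtain u where "u \<in> U" "x = \<phi> u" using \<phi>(2) by auto
      then show "?f x = conj_map G h V x" using f r Mor_mem[OF \<phi>(1)] by simp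
    qed
  qed
  then show ?thesis by (auto simp: ext_control_def conj_aut_def)
qed

lemma subset_ext_control:
  assumes \<phi>: "\<phi> \<in> Mor F U V" "\<phi> ` U = V"
  shows "U \<subseteq> ext_control F U V \<phi>" "ext_control F U V \<phi> \<subseteq> normalizer G U"
proof -
  note U = Mor_subgroup(1)[OF \<phi>(1)] and V = Mor_subgroup(2)[OF \<phi>(1)]
  show "ext_control F U V \<phi> \<subseteq> normalizer G U" using ext_control_iff[OF \<phi>] by blast
  show "U \<subseteq> ext_control F U V \<phi>"
  proof
    fix g assume g: "g \<in> U"
    then have "\<phi> g \<in> normalizer G V" using subset_normalizer[OF V] Mor_mem[OF \<phi>(1)] by blast
    then show "g \<in> ext_control F U V \<phi>"
      unfolding ext_control_iff[OF \<phi>] using Mor_conj[OF \<phi>(1)] g subset_normalizer[OF U] by blast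
  qed
qed

lemma subgroup_ext_control:
  assumes \<phi>: "\<phi> \<in> Mor F U V" "\<phi> ` U = V"
  shows "subgroup (ext_control F U V \<phi>) G"
proof -
  note U = Mor_subgroup(1)[OF \<phi>(1)] and V = Mor_subgroup(2)[OF \<phi>(1)]
  note NU = subgroup_normalizer[OF Mor_sub(1)[OF \<phi>(1)]]
  note NV = subgroup_normalizer[OF Mor_sub(2)[OF \<phi>(1)]]
  note e = ext_control_iff[OF \<phi>]
  have NUc: "g \<in> carrier G" if "g \<in> normalizer G U" for g using subgroup.mem_carrier[OF NU that] .
  have NVc: "g \<in> carrier G" if "g \<in> normalizer G V" for g using subgroup.mem_carrier[OF NV that] .
  have Uc: "u \<in> carrier G" if "u \<in> U" for u using subgroup.mem_carrier[OF U that] .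
  show ?thesis
  proof (rule subgroupI)
    show "ext_control F U V \<phi> \<subseteq> carrier G" using subset_ext_control(2)[OF \<phi>] NUc by blast
    show "ext_control F U V \<phi> \<noteq> {}" using subset_ext_control(1)[OF \<phi>] subgroup.one_closed[OF U] by blast
  next
    fix g assume "g \<in> ext_control F U V \<phi>"
    then obtain h where g: "g \<in> normalizer G U" and h: "h \<in> normalizer G V"
      and gh: "\<forall>u\<in>U. \<phi> (g \<otimes> u \<otimes> inv g) = h \<otimes> \<phi> u \<otimes> inv h" using e by blast
    have "\<phi> (inv g \<otimes> u \<otimes> inv (inv g)) = inv h \<otimes> \<phi> u \<otimes> inv (inv h)" if u: "u \<in> U" for u
    proof -
      have i: "inv g \<otimes> u \<otimes> g \<in> U" using normalizer_conj(2)[OF U g u] .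
      then have "\<phi> u = h \<otimes> \<phi> (inv g \<otimes> u \<otimes> g) \<otimes> inv h"
        using gh[rule_format, OF i] NUc[OF g] Uc[OF u] by simp
      then show ?thesis using NVc[OF h] NUc[OF g] Mor_carrier[OF \<phi>(1) i] by simp
    qed
    then show "inv g \<in> ext_control F U V \<phi>" unfolding e
      using subgroup.m_inv_closed[OF NU g] subgroup.m_inv_closed[OF NV h] by blast
  next
    fix g g' assume "g \<in> ext_control F U V \<phi>" "g' \<in> ext_control F U V \<phi>"
    then obtain h h' where g: "g \<in> normalizer G U" "g' \<in> normalizer G U"
      and h: "h \<in> normalizer G V" "h' \<in> normalizer G V"
      and gh: "\<forall>u\<in>U. \<phi> (g \<otimes> u \<otimes> inv g) = h \<otimes> \<phi> u \<otimes> inv h"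
      and gh': "\<forall>u\<in>U. \<phi> (g' \<otimes> u \<otimes> inv g') = h' \<otimes> \<phi> u \<otimes> inv h'" using e by blast
    have "\<phi> ((g \<otimes> g') \<otimes> u \<otimes> inv (g \<otimes> g')) = (h \<otimes> h') \<otimes> \<phi> u \<otimes> inv (h \<otimes> h')" if u: "u \<in> U" for u
      using gh gh' u normalizer_conj(1)[OF U g(2) u] Uc NUc NVc g h Mor_carrier[OF \<phi>(1) u]
      by (simp flip: conj_conj)
    then show "g \<otimes> g' \<in> ext_control F U V \<phi>" unfolding e
      using subgroup.m_closed[OF NU g] subgroup.m_closed[OF NV h] by blast
  qed
qed

lemma receptive_extends:
  assumes rec: "receptive F V" and \<phi>: "\<phi> \<in> Mor F U V" "\<phi> ` U = V"
    and M: "subgroup M G" "U \<subseteq> M" "M \<subseteq> normalizer G U"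
    and M': "\<And>m. m \<in> M \<Longrightarrow> \<exists>h\<in>normalizer G V. \<forall>u\<in>U. \<phi> (m \<otimes> u \<otimes> inv m) = h \<otimes> \<phi> u \<otimes> inv h"
  obtains \<psi> where "\<psi> \<in> Mor F M (carrier G)" "\<And>u. u \<in> U \<Longrightarrow> \<psi> u = \<phi> u"
proof -
  obtain \<psi> where \<psi>: "\<psi> \<in> Mor F (ext_control F U V \<phi>) (carrier G)" "restrict \<psi> U = \<phi>"
    using rec \<phi> unfolding receptive_def grp_F by blast
  have M_le: "M \<subseteq> ext_control F U V \<phi>" using ext_control_iff[OF \<phi>] M' M(3) by blast
  have "restrict \<psi> M \<in> Mor F M (carrier G)"
    by (rule Mor_restrict[OF \<psi>(1) M(1) M_le]) (use \<psi>(1) M_le Mor_mem subgroup_self in auto)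
  moreover have "restrict \<psi> M u = \<phi> u" if "u \<in> U" for u
    using that M(2) unfolding \<psi>(2)[symmetric] by auto
  ultimately show thesis using that by blast
qed

lemma Mor_image_normalizer:
  assumes \<psi>: "\<psi> \<in> Mor F M W" and U: "subgroup U G" "U \<subseteq> M" and V: "\<psi> ` U = V"
    and m: "m \<in> M" "m \<in> normalizer G U"
  shows "\<psi> m \<in> normalizer G V"
proof -
  have sV: "subgroup V G" using Mor_image_subgroup[OF \<psi> U] V by simp
  have "\<psi> m \<otimes> v \<otimes> inv (\<psi> m) \<in> V" if "v \<in> V" for v
  proof -
    obtain u where u: "u \<in> U" "v = \<psi> u" using \<open>v \<in> V\<close> V by auto
    then show ?thesis using Mor_conj[OF \<psi> m(1), of u] U(2) V normalizer_conj(1)[OF U(1) m(2) u(1)]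
      by (metis imageI subsetD)
  qed
  then show ?thesis using normalizer_iff[OF sV] Mor_carrier[OF \<psi> m(1)] by blast
qed

lemma fully_automised_sylow: "fully_automised p F V \<longleftrightarrow> sylow_subgroup p (Aut_fus F V) (conj_aut G V)"
  by (simp add: fully_automised_def)

text \<open>
  An isomorphism \<open>\<phi>\<close> from \<open>U\<close> to \<open>V\<close> turns the
  automorphisms induced by \<open>N\<^sub>S(U)\<close> into a \<open>p\<close>-subgroup of
  \<open>Aut\<^sub>F(V)\<close>. An automorphism of \<open>V\<close> conjugates it into the Sylow
  subgroup \<open>Aut\<^sub>S(V)\<close>. After composing \<open>\<phi>\<close> with this
  automorphism, its control subgroup is all of \<open>N\<^sub>S(U)\<close>, and receptivity
  extends it.
\<close>
lemma extends_to_normalizer: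
  assumes V: "fully_automised p F V" "receptive F V" and iso: "fusion_iso F U V"
  obtains \<psi> where "\<psi> \<in> Mor F (normalizer G U) (carrier G)" "\<psi> ` U = V"
proof -
  let ?A = "Aut_fus F V"
  obtain \<phi> where \<phi>: "\<phi> \<in> Mor F U V" "\<phi> ` U = V" using iso by (auto simp: fusion_iso_iff)
  note U = Mor_subgroup(1)[OF \<phi>(1)] and sV = Mor_subgroup(2)[OF \<phi>(1)]
  note NU = subgroup_normalizer[OF Mor_sub(1)[OF \<phi>(1)]]
  interpret A: group "?A" by (rule group_Aut[OF sV])
  obtain P n where P: "subgroup P (?A)" "card P = p ^ n"
    and mP: "\<And>m. m \<in> normalizer G U \<Longrightarrow> \<exists>\<pi>\<in>P. \<forall>u\<in>U. \<pi> (\<phi> u) = \<phi> (m \<otimes> u \<otimes> inv m)"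
    using conj_transport[OF \<phi> NU order_refl] by metis
  obtain \<alpha> where \<alpha>: "\<alpha> \<in> Mor F V V"
    and \<alpha>P: "\<And>\<pi>. \<pi> \<in> P \<Longrightarrow> \<alpha> \<otimes>\<^bsub>?A\<^esub> \<pi> \<otimes>\<^bsub>?A\<^esub> inv\<^bsub>?A\<^esub> \<alpha> \<in> conj_aut G V"
    using A.sylow_conjugacy[OF _ p_prime P] V(1) finite_Aut[OF sV] by (auto simp: fully_automised_sylow)
  let ?\<psi> = "\<lambda>x\<in>U. \<alpha> (\<phi> x)"
  have \<psi>: "?\<psi> \<in> Mor F U V" "?\<psi> ` U = V"
    using Mor_comp[OF \<phi>(1) \<alpha>] Mor_comp_onto[OF \<phi>(2) Mor_endo_onto[OF \<alpha>]] by auto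
  have "\<exists>h\<in>normalizer G V. \<forall>u\<in>U. ?\<psi> (m \<otimes> u \<otimes> inv m) = h \<otimes> ?\<psi> u \<otimes> inv h"
    if m: "m \<in> normalizer G U" for m
  proof -
    obtain \<pi> where \<pi>: "\<pi> \<in> P" "\<forall>u\<in>U. \<pi> (\<phi> u) = \<phi> (m \<otimes> u \<otimes> inv m)" using mP[OF m] by blast
    have \<pi>m: "\<pi> \<in> Mor F V V" using subgroup.mem_carrier[OF P(1) \<pi>(1)] by simp
    let ?c = "\<alpha> \<otimes>\<^bsub>?A\<^esub> \<pi> \<otimes>\<^bsub>?A\<^esub> inv\<^bsub>?A\<^esub> \<alpha>"
    have ap: "\<alpha> \<otimes>\<^bsub>?A\<^esub> \<pi> \<in> Mor F V V" using A.m_closed \<alpha> \<pi>m by simp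
    obtain h where h: "h \<in> normalizer G V" "?c = conj_map G h V"
      using \<alpha>P[OF \<pi>(1)] by (auto simp: conj_aut_def)
    have "?\<psi> (m \<otimes> u \<otimes> inv m) = h \<otimes> ?\<psi> u \<otimes> inv h" if u: "u \<in> U" for u
    proof -
      have v: "\<phi> u \<in> V" "\<alpha> (\<phi> u) \<in> V" using Mor_mem[OF \<phi>(1) u] Mor_mem[OF \<alpha>] by auto
      have "?c (\<alpha> (\<phi> u)) = \<alpha> (\<pi> (\<phi> u))"
        using v ap \<alpha> \<pi>m Aut_inv_closed[OF \<alpha>] by simp
      then show ?thesis using \<pi>(2) u v normalizer_conj(1)[OF U m u] by (simp add: h(2))
    qed
    then show ?thesis using h(1) by blast
  qed
  then obtain \<chi> where \<chi>: "\<chi> \<in> Mor F (normalizer G U) (carrier G)" "\<And>u. u \<in> U \<Longrightarrow> \<chi> u = ?\<psi> u"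
    using receptive_extends[OF V(2) \<psi> NU subset_normalizer[OF U] order_refl] by metis
  have "\<chi> ` U = ?\<psi> ` U" by (rule image_cong[OF refl \<chi>(2)])
  then have "\<chi> ` U = V" using \<psi>(2) by (rule trans)
  then show thesis using \<chi>(1) that by blast
qed

lemma extends_to_normalizer_image:
  assumes \<psi>: "\<psi> \<in> Mor F (normalizer G U) (carrier G)" "\<psi> ` U = V" and U: "subgroup U G"
  shows "\<psi> ` normalizer G U \<subseteq> normalizer G V"
  using Mor_image_normalizer[OF \<psi>(1) U subset_normalizer[OF U] \<psi>(2)] by blast

text \<open>
  An isomorphism onto \<open>V\<close> extends to the normaliser of its domain, and embeds it in
  the normaliser of \<open>V\<close>.
\<close>
lemma fully_normalisedI:
  assumes V: "subgroup V G" "fully_automised p F V" "receptive F V"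
  shows "fully_normalised F V"
  unfolding fully_normalised_def grp_F
proof (intro conjI allI impI)
  fix U assume iso: "fusion_iso F V U"
  then have U: "subgroup U G" using Mor_subgroup(2) by (auto simp: fusion_iso_iff)
  obtain \<psi> where \<psi>: "\<psi> \<in> Mor F (normalizer G U) (carrier G)" "\<psi> ` U = V"
    by (rule extends_to_normalizer[OF V(2,3) fusion_iso_sym[OF iso]])
  have "card (normalizer G U) = card (\<psi> ` normalizer G U)" using Mor_card[OF \<psi>(1)] by simp
  also have "\<dots> \<le> card (normalizer G V)"
    using extends_to_normalizer_image[OF \<psi> U] finite_subgroup[OF subgroup_normalizer[OF subgroup.subset[OF V(1)]]]
    by (simp add: card_mono)
  finally show "card (normalizer G U) \<le> card (normalizer G V)" .
qed (use V in simp)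

section \<open>Radical subgroups and normal subgroups of the fusion system\<close>

text \<open>
  The automorphisms of \<open>R\<close> that are induced by \<open>M\<close> form a normal
  \<open>p\<close>-subgroup of \<open>Aut\<^sub>F(R)\<close>. Its image in
  \<open>Out\<^sub>F(R)\<close> is trivial, so each \<open>m \<in> M\<close> acts on
  \<open>R\<close> as some \<open>r \<in> R\<close>, and \<open>r\<^sup>-\<^sup>1 m\<close>
  centralises \<open>R\<close>.
\<close>
lemma radical_absorbs:
  assumes rad: "radical p F R" and C: "centralizer G R \<subseteq> R"
    and M: "subgroup M G" "M \<subseteq> normalizer G R"
    and inv: "\<And>\<alpha> m. \<alpha> \<in> Mor F R R \<Longrightarrow> m \<in> M \<Longrightarrow> \<exists>m'\<in>M. \<forall>x\<in>R. \<alpha> (m \<otimes> x \<otimes> inv m) = m' \<otimes> \<alpha> x \<otimes> inv m'"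
  shows "M \<subseteq> R"
proof -
  let ?A = "Aut_fus F R"
  have R: "subgroup R G" and core: "p_core p (Out_fus F R) = {\<one>\<^bsub>Out_fus F R\<^esub>}"
    using rad by (simp_all add: radical_def)
  interpret A: group "?A" by (rule group_Aut[OF R])
  let ?P = "(\<lambda>g. conj_map G g R) ` M"
  have mM: "conj_map G m R \<in> Mor F R R" if "m \<in> M" for m
    by (rule Mor_conj_map[OF R R]) (use that M normalizer_iff[OF R] in auto)
  have P: "subgroup ?P (?A)" "\<exists>n. card ?P = p ^ n" by (rule conj_group_p_subgroup[OF R M])+
  then obtain n where n: "card ?P = p ^ n" by blast
  have "normal ?P (?A)"
  proof (rule A.normal_invI[OF P(1)])
    fix \<alpha> \<beta> assume "\<alpha> \<in> carrier (?A)" and b: "\<beta> \<in> ?P"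
    then have \<alpha>: "\<alpha> \<in> Mor F R R" by simp
    obtain m where m: "m \<in> M" "\<beta> = conj_map G m R" using b by blast
    obtain m' where m': "m' \<in> M" "\<forall>x\<in>R. \<alpha> (m \<otimes> x \<otimes> inv m) = m' \<otimes> \<alpha> x \<otimes> inv m'" using inv[OF \<alpha> m(1)] by blast
    have \<beta>: "\<beta> \<in> Mor F R R" using mM m by simp
    have ab: "\<alpha> \<otimes>\<^bsub>?A\<^esub> \<beta> \<in> Mor F R R" using A.m_closed \<alpha> \<beta> by simp
    note \<alpha>i = Aut_inv_closed[OF \<alpha>]
    have "\<alpha> \<otimes>\<^bsub>?A\<^esub> \<beta> \<otimes>\<^bsub>?A\<^esub> inv\<^bsub>?A\<^esub> \<alpha> = conj_map G m' R"
    proof (rule Mor_eqI[OF _ mM[OF m'(1)]])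
      show "\<alpha> \<otimes>\<^bsub>?A\<^esub> \<beta> \<otimes>\<^bsub>?A\<^esub> inv\<^bsub>?A\<^esub> \<alpha> \<in> Mor F R R"
        using A.m_closed ab \<alpha>i by simp
      fix x assume x: "x \<in> R"
      then show "(\<alpha> \<otimes>\<^bsub>?A\<^esub> \<beta> \<otimes>\<^bsub>?A\<^esub> inv\<^bsub>?A\<^esub> \<alpha>) x = conj_map G m' R x"
        using Mor_mem[OF \<alpha>i x] \<alpha>i ab \<alpha> \<beta> m'(2) by (simp add: m(2))
    qed
    then show "\<alpha> \<otimes>\<^bsub>?A\<^esub> \<beta> \<otimes>\<^bsub>?A\<^esub> inv\<^bsub>?A\<^esub> \<alpha> \<in> ?P" using m' by simp
  qed
  then have P_le: "?P \<subseteq> inner_aut G R"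
    using A.subset_of_p_core_factor_trivial[OF _ p_prime normal_inner_aut(1)[OF R] _ _ n] finite_Aut[OF R] core
    by (simp add: Out_fus_def)
  show "M \<subseteq> R"
  proof
    fix m assume m: "m \<in> M"
    then obtain r where r: "r \<in> R" "conj_map G m R = conj_map G r R" using P_le by (auto simp: inner_aut_def)
    have c: "m \<in> carrier G" "r \<in> carrier G"
      using subgroup.mem_carrier[OF M(1) m] subgroup.mem_carrier[OF R r(1)] by auto
    have "m \<otimes> x \<otimes> inv m = r \<otimes> x \<otimes> inv r" if "x \<in> R" for x using fun_cong[OF r(2), of x] that by simp
    then have "inv r \<otimes> m \<in> R"
      using conj_eq_imp_centralizer[OF subgroup.subset[OF R] c] C by blast
    then have "r \<otimes> (inv r \<otimes> m) \<in> R" using subgroup.m_closed[OF R r(1)] by blast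
    then show "m \<in> R" using c by (simp flip: m_assoc)
  qed
qed

lemma subgroup_set_mult:
  assumes U: "subgroup U G" and Q: "subgroup Q G" and UQ: "U \<subseteq> normalizer G Q"
  shows "subgroup (U <#> Q) G"
proof (rule subgroupI)
  have cU: "u \<in> carrier G" if "u \<in> U" for u using subgroup.mem_carrier[OF U that] .
  have cQ: "u \<in> carrier G" if "u \<in> Q" for u using subgroup.mem_carrier[OF Q that] .
  show "U <#> Q \<subseteq> carrier G" using cU cQ by (auto simp: set_mult_def)
  show "U <#> Q \<noteq> {}" using subgroup.one_closed[OF U] subgroup.one_closed[OF Q] by (auto simp: set_mult_def)
  fix a assume "a \<in> U <#> Q"
  then obtain u q where u: "u \<in> U" "q \<in> Q" "a = u \<otimes> q" by (auto simp: set_mult_def)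
  have "inv a = inv u \<otimes> (u \<otimes> inv q \<otimes> inv u)" using u cU cQ by (simp add: inv_mult_group flip: m_assoc)
  moreover have "u \<otimes> inv q \<otimes> inv u \<in> Q" using normalizer_conj(1)[OF Q] u UQ subgroup.m_inv_closed[OF Q] by blast
  ultimately show "inv a \<in> U <#> Q" using subgroup.m_inv_closed[OF U u(1)] by (auto simp: set_mult_def)
  fix b assume "b \<in> U <#> Q"
  then obtain v r where v: "v \<in> U" "r \<in> Q" "b = v \<otimes> r" by (auto simp: set_mult_def)
  have "a \<otimes> b = (u \<otimes> v) \<otimes> ((inv v \<otimes> q \<otimes> v) \<otimes> r)" 
    using u v cU cQ by (simp add: m_assoc) (simp flip: m_assoc)
  moreover have "inv v \<otimes> q \<otimes> v \<in> Q" using normalizer_conj(2)[OF Q] u v UQ by blast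
  ultimately show "a \<otimes> b \<in> U <#> Q"
    using subgroup.m_closed[OF U u(1) v(1)] subgroup.m_closed[OF Q _ v(2)] by (auto simp: set_mult_def)
qed

lemma set_mult_absorb:
  assumes U: "subgroup U G" and Q: "subgroup Q G" "Q \<subseteq> U"
  shows "U <#> Q = U"
proof
  show "U <#> Q \<subseteq> U" using subgroup.m_closed[OF U] Q by (auto simp: set_mult_def)
  show "U \<subseteq> U <#> Q" using subset_set_mult(1)[of U Q] subgroup.subset[OF U] subgroup.subset[OF Q(1)] subgroup.one_closed[OF Q(1)] by simp
qed

lemma subset_set_mult_subgroups:
  assumes "subgroup U G" "subgroup Q G"
  shows "U \<subseteq> U <#> Q" "Q \<subseteq> U <#> Q"
  using subset_set_mult[of U Q] subgroup.subset[OF assms(1)] subgroup.subset[OF assms(2)]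
    subgroup.one_closed[OF assms(1)] subgroup.one_closed[OF assms(2)] by simp_all

lemma Mor_image_set_mult:
  assumes \<psi>: "\<psi> \<in> Mor F (U <#> Q) W" and U: "subgroup U G" "subgroup Q G" and Q: "\<psi> ` Q = Q"
  shows "\<psi> ` (U <#> Q) = \<psi> ` U <#> Q"
proof -
  note s = subset_set_mult_subgroups[OF U]
  have m: "\<psi> (u \<otimes> q) = \<psi> u \<otimes> \<psi> q" if "u \<in> U" "q \<in> Q" for u q
    using Mor_mult[OF \<psi>, of u q] that s by blast
  have "\<psi> ` (U <#> Q) = \<psi> ` U <#> \<psi> ` Q" by (simp add: set_mult_def image_UN m)
  then show ?thesis using Q by simp
qed

lemma normalizer_Mor_iff:
  "\<phi> \<in> Mor (normalizer_fus F Q) U V \<longleftrightarrow> \<phi> \<in> Mor F U V \<and> U \<subseteq> normalizer G Q \<and> V \<subseteq> normalizer G Q \<and>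
    (\<exists>\<psi>\<in>Mor F (U <#> Q) (V <#> Q). (\<forall>x\<in>U. \<psi> x = \<phi> x) \<and> \<psi> ` Q = Q)"
proof -
  have "restrict \<psi> U = \<phi> \<longleftrightarrow> (\<forall>x\<in>U. \<psi> x = \<phi> x)" if "\<phi> \<in> Mor F U V" for \<psi>
    using Mor_props(1)[OF that] by (auto simp: restrict_def extensional_def)
  then show ?thesis by (auto simp: normalizer_fus_def)
qed

lemma grp_normalizer_fus: "grp (normalizer_fus F Q) = G\<lparr>carrier := normalizer G Q\<rparr>"
  by (simp add: normalizer_fus_def)

text \<open>
  The extensions to \<open>U Q\<close> and \<open>V Q\<close> that define the morphisms of the
  normaliser are composed and inverted together with them; conjugation by an element of
  \<open>N\<^sub>S(Q)\<close> is its own extension.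
\<close>
lemma fusion_system_normalizer:
  assumes Q: "subgroup Q G"
  shows "fusion_system p (normalizer_fus F Q)"
proof -
  let ?N = "normalizer G Q"
  let ?E = "normalizer_fus F Q"
  let ?H = "G\<lparr>carrier := ?N\<rparr>"
  have N: "subgroup ?N G" by (rule subgroup_normalizer[OF subgroup.subset[OF Q]])
  note QN = subset_normalizer[OF Q]
  have sub: "subgroup U ?H \<longleftrightarrow> subgroup U G \<and> U \<subseteq> ?N" for U
    using subgroup_incl[of U ?N] incl_subgroup[of ?N U] subgroup.subset[of U ?H] N by auto
  have mulN: "U <#> Q \<subseteq> ?N" if "U \<subseteq> ?N" for U
    using that QN subgroup.m_closed[OF N] by (auto simp: set_mult_def)
  have pE: "p_group p ?H"
    using p_prime subgroup_imp_group[OF N] card_subgroup[OF N] by (auto simp: p_group_def order_def)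
  have one: "subgroup U ?H \<and> subgroup V ?H" if "Mor ?E U V \<noteq> {}" for U V
    using that Mor_subgroup unfolding sub by (auto simp: normalizer_Mor_iff)
  have two: "conj_hom ?H U V \<subseteq> Mor ?E U V" if U: "subgroup U ?H" and V: "subgroup V ?H" for U V
  proof
    fix \<phi> assume "\<phi> \<in> conj_hom ?H U V"
    then obtain g where g: "g \<in> ?N" and \<phi>: "\<phi> = conj_map ?H g U" "\<phi> ` U \<subseteq> V" by (auto simp: conj_hom_def)
    have gG: "g \<in> carrier G" using subgroup.mem_carrier[OF N g] .
    have U': "subgroup U G" "U \<subseteq> ?N" and V': "subgroup V G" "V \<subseteq> ?N" using U V sub by auto
    have \<phi>': "\<phi> = conj_map G g U" using \<phi>(1) m_inv_consistent[OF N g] by (simp add: conj_map_def)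
    have gU: "g \<otimes> u \<otimes> inv g \<in> V" if "u \<in> U" for u using \<phi>(2) that unfolding \<phi>' by auto
    have m: "\<phi> \<in> Mor F U V" unfolding \<phi>' by (rule Mor_conj_map[OF U'(1) V'(1) gG gU])
    let ?\<psi> = "conj_map G g (U <#> Q)"
    note sUQ = subset_set_mult_subgroups[OF U'(1) Q]
    have gQ: "g \<otimes> q \<otimes> inv g \<in> Q" if "q \<in> Q" for q using normalizer_conj(1)[OF Q g that] .
    have \<psi>: "?\<psi> \<in> Mor F (U <#> Q) (V <#> Q)"
    proof (rule Mor_conj_map[OF subgroup_set_mult[OF U'(1) Q U'(2)] subgroup_set_mult[OF V'(1) Q V'(2)] gG])
      fix a assume "a \<in> U <#> Q"
      then obtain u q where u: "u \<in> U" "q \<in> Q" "a = u \<otimes> q" by (auto simp: set_mult_def)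
      have "g \<otimes> a \<otimes> inv g = (g \<otimes> u \<otimes> inv g) \<otimes> (g \<otimes> q \<otimes> inv g)"
        using conj_mult[OF gG] u subgroup.mem_carrier[OF U'(1)] subgroup.mem_carrier[OF Q] by simp
      then show "g \<otimes> a \<otimes> inv g \<in> V <#> Q" using gU[OF u(1)] gQ[OF u(2)] by (auto simp: set_mult_def)
    qed
    have "?\<psi> ` Q \<subseteq> Q" using gQ sUQ by auto
    then have "?\<psi> ` Q = Q"
      using endo_inj_surj[OF finite_subgroup[OF Q]] inj_on_subset[OF Mor_props(3)[OF \<psi>] sUQ(2)] by blast
    moreover have "\<forall>x\<in>U. ?\<psi> x = \<phi> x" using sUQ(1) by (auto simp: \<phi>')
    ultimately show "\<phi> \<in> Mor ?E U V" unfolding normalizer_Mor_iff using m \<psi> U' V' by blast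
  qed
  have three: "\<phi> \<in> extensional U \<and> \<phi> \<in> hom (?H\<lparr>carrier := U\<rparr>) (?H\<lparr>carrier := V\<rparr>) \<and> inj_on \<phi> U"
    if "\<phi> \<in> Mor ?E U V" for \<phi> U V
    using that Mor_props[of \<phi> U V] by (simp add: normalizer_Mor_iff)
  have four: "\<phi> \<in> Mor ?E U (\<phi> ` U) \<and> restrict (inv_into U \<phi>) (\<phi> ` U) \<in> Mor ?E (\<phi> ` U) U"
    if \<phi>E: "\<phi> \<in> Mor ?E U V" for \<phi> U V
  proof -
    obtain \<psi> where \<phi>: "\<phi> \<in> Mor F U V" and UV: "U \<subseteq> ?N" "V \<subseteq> ?N"
      and \<psi>: "\<psi> \<in> Mor F (U <#> Q) (V <#> Q)" "\<forall>x\<in>U. \<psi> x = \<phi> x" "\<psi> ` Q = Q"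
      using \<phi>E unfolding normalizer_Mor_iff by blast
    note U = Mor_subgroup(1)[OF \<phi>]
    note sUQ = subset_set_mult_subgroups[OF U Q]
    have im: "\<psi> ` U = \<phi> ` U" using \<psi>(2) by auto
    have imN: "\<phi> ` U \<subseteq> ?N" using Mor_image_sub[OF \<phi>] UV(2) by blast
    have onto: "\<psi> ` (U <#> Q) = \<phi> ` U <#> Q" using Mor_image_set_mult[OF \<psi>(1) U Q \<psi>(3)] im by simp
    have \<psi>': "\<psi> \<in> Mor F (U <#> Q) (\<phi> ` U <#> Q)" using Mor_image[OF \<psi>(1)] onto by simp
    have 1: "\<phi> \<in> Mor ?E U (\<phi> ` U)"
      unfolding normalizer_Mor_iff using Mor_image[OF \<phi>] UV imN \<psi>' \<psi>(2,3) by blast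
    obtain \<chi> where \<chi>: "\<chi> \<in> Mor F (\<phi> ` U <#> Q) (U <#> Q)" "\<And>x. x \<in> U <#> Q \<Longrightarrow> \<chi> (\<psi> x) = x"
      using Mor_inverse[OF \<psi>' onto] by metis
    have "restrict (inv_into U \<phi>) (\<phi> ` U) \<in> Mor ?E (\<phi> ` U) U"
      unfolding normalizer_Mor_iff
    proof (intro conjI bexI[OF _ \<chi>(1)] ballI)
      show "restrict (inv_into U \<phi>) (\<phi> ` U) \<in> Mor F (\<phi> ` U) U" by (rule Mor_inv_into[OF \<phi>])
      fix y assume y: "y \<in> \<phi> ` U"
      then obtain x where x: "x \<in> U" "y = \<phi> x" by blast
      then have "\<chi> y = x" using \<chi>(2)[of x] \<psi>(2) sUQ(1) by auto
      then show "\<chi> y = restrict (inv_into U \<phi>) (\<phi> ` U) y"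
        using x Mor_props(3)[OF \<phi>] by simp
    next
      have "\<chi> ` (\<psi> ` Q) = Q" using \<chi>(2) sUQ(2) by (force simp: image_image)
      then show "\<chi> ` Q = Q" using \<psi>(3) by simp
    qed (use imN UV in auto)
    then show ?thesis using 1 by blast
  qed
  have five: "compose U \<psi> \<phi> \<in> Mor ?E U W" if \<phi>: "\<phi> \<in> Mor ?E U V" and \<psi>: "\<psi> \<in> Mor ?E V W" for \<phi> \<psi> U V W
  proof -
    obtain \<phi>' where \<phi>': "\<phi>' \<in> Mor F (U <#> Q) (V <#> Q)" "\<forall>x\<in>U. \<phi>' x = \<phi> x" "\<phi>' ` Q = Q"
      using \<phi> unfolding normalizer_Mor_iff by blast
    obtain \<psi>' where \<psi>': "\<psi>' \<in> Mor F (V <#> Q) (W <#> Q)" "\<forall>x\<in>V. \<psi>' x = \<psi> x" "\<psi>' ` Q = Q"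
      using \<psi> unfolding normalizer_Mor_iff by blast
    have \<phi>m: "\<phi> \<in> Mor F U V" and \<psi>m: "\<psi> \<in> Mor F V W" using \<phi> \<psi> by (auto simp: normalizer_Mor_iff)
    note sUQ = subset_set_mult_subgroups[OF Mor_subgroup(1)[OF \<phi>m] Q]
    let ?\<chi> = "\<lambda>x\<in>U <#> Q. \<psi>' (\<phi>' x)"
    have \<chi>: "?\<chi> \<in> Mor F (U <#> Q) (W <#> Q)" by (rule Mor_comp[OF \<phi>'(1) \<psi>'(1)])
    have "\<forall>x\<in>U. ?\<chi> x = compose U \<psi> \<phi> x"
      using sUQ(1) \<phi>'(2) \<psi>'(2) Mor_mem[OF \<phi>m] by (auto simp: compose_def)
    moreover have "?\<chi> ` Q = \<psi>' ` (\<phi>' ` Q)" using sUQ(2) by (force simp: image_image)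
    then have "?\<chi> ` Q = Q" unfolding \<phi>'(3) \<psi>'(3) .
    moreover have "compose U \<psi> \<phi> \<in> Mor F U W" using Mor_comp[OF \<phi>m \<psi>m] by (simp add: compose_def)
    moreover have "U \<subseteq> ?N" "W \<subseteq> ?N" using \<phi> \<psi> by (simp_all add: normalizer_Mor_iff)
    ultimately show ?thesis unfolding normalizer_Mor_iff[of "compose U \<psi> \<phi>"] using \<chi> by blast
  qed
  show ?thesis
    unfolding fusion_system_def grp_normalizer_fus
  proof (intro conjI allI impI ballI)
    fix U V assume "subgroup U ?H" "subgroup V ?H"
    show "Mor ?E U V \<subseteq> {\<phi> \<in> extensional U. \<phi> \<in> hom (?H\<lparr>carrier := U\<rparr>) (?H\<lparr>carrier := V\<rparr>) \<and> inj_on \<phi> U}"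
      using three by blast
  qed (use pE one two four five in blast)+
qed

lemma fusion_sys_normalizer:
  assumes "subgroup Q G"
  shows "fusion_sys (G\<lparr>carrier := normalizer G Q\<rparr>) p (normalizer_fus F Q)"
  using fusion_system_normalizer[OF assms] by unfold_locales (simp_all add: grp_normalizer_fus)

text \<open>
  If \<open>U\<close> contains \<open>Q\<close>, then \<open>U Q = U\<close>, and likewise for
  \<open>V\<close>.
\<close>
lemma normalizer_Mor_above_iff:
  assumes Q: "subgroup Q G" and QU: "Q \<subseteq> U"
  shows "\<phi> \<in> Mor (normalizer_fus F Q) U V \<longleftrightarrow>
    \<phi> \<in> Mor F U V \<and> U \<subseteq> normalizer G Q \<and> V \<subseteq> normalizer G Q \<and> \<phi> ` Q = Q" (is "?L \<longleftrightarrow> ?R")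
proof
  assume l: ?L
  then obtain \<psi> where "\<forall>x\<in>U. \<psi> x = \<phi> x" "\<psi> ` Q = Q" unfolding normalizer_Mor_iff by blast
  moreover from this have "\<psi> ` Q = \<phi> ` Q" by (intro image_cong) (use QU in auto)
  ultimately have "\<phi> ` Q = Q" by simp
  then show ?R using l by (simp add: normalizer_Mor_iff)
next
  assume r: ?R
  then have \<phi>: "\<phi> \<in> Mor F U V" and \<phi>Q: "\<phi> ` Q = Q" by blast+
  have "\<phi> ` Q \<subseteq> V" using image_mono[OF QU] Mor_image_sub[OF \<phi>] by (rule order_trans)
  then have "Q \<subseteq> V" unfolding \<phi>Q .
  then have "U <#> Q = U" "V <#> Q = V"
    using set_mult_absorb[OF _ Q] QU Mor_subgroup[OF \<phi>] by simp_all
  then show ?L unfolding normalizer_Mor_iff using r by auto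
qed

lemma normal_in_fus_extends:
  assumes Q: "normal_in_fus Q F" and \<phi>: "\<phi> \<in> Mor F U V"
  obtains \<psi> where "\<psi> \<in> Mor F (U <#> Q) (V <#> Q)" "\<And>x. x \<in> U \<Longrightarrow> \<psi> x = \<phi> x" "\<psi> ` Q = Q"
proof -
  have "\<phi> \<in> Mor (normalizer_fus F Q) U V" using Q \<phi> by (simp add: normal_in_fus_def)
  then show thesis using that by (auto simp: normalizer_Mor_iff)
qed

lemma normal_in_fus_normalizer: "normal_in_fus Q F \<Longrightarrow> subgroup Q G \<and> normalizer G Q = carrier G"
  using normal_in_fus_iff[OF prefusion_F, of Q] by simp

text \<open>
  An automorphism of \<open>R\<close> extends to \<open>R K\<close> and maps \<open>K\<close> to
  itself, hence also \<open>N\<^sub>K(R)\<close>, so that \<open>N\<^sub>K(R) \<le> R\<close>.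
  Then \<open>R\<close> is its own normaliser in the \<open>p\<close>-group \<open>R K\<close>,
  which is only possible if \<open>R K = R\<close>.
\<close>
lemma normal_in_fus_subset_radical:
  assumes K: "normal_in_fus K F" and R: "radical p F R" "centralizer G R \<subseteq> R"
  shows "K \<subseteq> R"
proof -
  have sK: "subgroup K G" and NK: "normalizer G K = carrier G" using normal_in_fus_normalizer[OF K] by auto
  have sR: "subgroup R G" using R by (simp add: radical_def)
  have NR: "subgroup (normalizer G R) G" by (rule subgroup_normalizer[OF subgroup.subset[OF sR]])
  have RK: "subgroup (R <#> K) G"
    by (rule subgroup_set_mult[OF sR sK]) (use NK subgroup.subset[OF sR] in simp)
  note s = subset_set_mult_subgroups[OF sR sK]
  let ?M = "K \<inter> normalizer G R"
  have M: "subgroup ?M G" by (rule subgroups_Inter_pair[OF sK NR])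
  have "?M \<subseteq> R"
  proof (rule radical_absorbs[OF R M])
    fix \<alpha> m assume \<alpha>: "\<alpha> \<in> Mor F R R" and m: "m \<in> ?M"
    obtain \<psi> where \<psi>: "\<psi> \<in> Mor F (R <#> K) (R <#> K)" "\<And>x. x \<in> R \<Longrightarrow> \<psi> x = \<alpha> x" "\<psi> ` K = K"
      using normal_in_fus_extends[OF K \<alpha>] by blast
    have "\<psi> ` R = \<alpha> ` R" by (rule image_cong[OF refl \<psi>(2)])
    then have \<psi>R: "\<psi> ` R = R" using Mor_endo_onto[OF \<alpha>] by (rule trans)
    have mRK: "m \<in> R <#> K" using m s by blast
    have "\<psi> m \<in> normalizer G R" by (rule Mor_image_normalizer[OF \<psi>(1) sR s(1) \<psi>R mRK]) (use m in simp)
    then have "\<psi> m \<in> ?M" using \<psi>(3) m by auto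
    moreover have "\<alpha> (m \<otimes> x \<otimes> inv m) = \<psi> m \<otimes> \<alpha> x \<otimes> inv (\<psi> m)" if x: "x \<in> R" for x
      using Mor_conj[OF \<psi>(1) mRK, of x] \<psi>(2) normalizer_conj(1)[OF sR, of m x] m x s(1) by auto
    ultimately show "\<exists>m'\<in>?M. \<forall>x\<in>R. \<alpha> (m \<otimes> x \<otimes> inv m) = m' \<otimes> \<alpha> x \<otimes> inv m'" by blast
  qed simp
  have "R = R <#> K"
  proof (rule ccontr)
    assume neq: "R \<noteq> R <#> K"
    obtain n where n: "card (R <#> K) = p ^ n" using card_subgroup[OF RK] by blast
    obtain a where a: "a \<in> (R <#> K) - R" "\<forall>x\<in>R. a \<otimes> x \<otimes> inv a \<in> R"
      using p_subgroup_normalizer_grows[OF p_prime RK n sR s(1) neq] by blast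
    obtain r k where r: "r \<in> R" "k \<in> K" "a = r \<otimes> k" using a by (auto simp: set_mult_def)
    have c: "r \<in> carrier G" "k \<in> carrier G" "a \<in> carrier G"
      using r subgroup.mem_carrier[OF sR] subgroup.mem_carrier[OF sK] by auto
    have aN: "a \<in> normalizer G R" using a(2) normalizer_iff[OF sR] c by blast
    have rN: "r \<in> normalizer G R" using subset_normalizer[OF sR] r(1) by blast
    have "inv r \<otimes> a \<in> normalizer G R"
      by (rule subgroup.m_closed[OF NR subgroup.m_inv_closed[OF NR rN] aN])
    moreover have "inv r \<otimes> a = k" using r c by (simp flip: m_assoc)
    ultimately have "k \<in> normalizer G R" by simp
    then have "k \<in> R" using r \<open>?M \<subseteq> R\<close> by blast
    then show False using a r subgroup.m_closed[OF sR] by auto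
  qed
  then show ?thesis using s(2) by simp
qed

lemma fus_core_subset_radical:
  assumes "radical p F R" "centralizer G R \<subseteq> R"
  shows "fus_core F \<subseteq> R"
  by (rule normal_in_fus_subset_radical[OF fus_core_greatest(1)[OF prefusion_F] assms])

text \<open>
  Each automorphism of \<open>R\<close> extends to the core \<open>K\<close> of the normaliser of
  \<open>R\<close>, and normalises the automorphisms that \<open>K\<close> induces.
\<close>
lemma fus_core_normalizer:
  assumes R: "radical p F R" "centralizer G R \<subseteq> R"
  shows "fus_core (normalizer_fus F R) = R"
proof
  have sR: "subgroup R G" using R by (simp add: radical_def)
  let ?E = "normalizer_fus F R"
  interpret E: fusion_sys "G\<lparr>carrier := normalizer G R\<rparr>" p ?E by (rule fusion_sys_normalizer[OF sR])
  show "R \<subseteq> fus_core ?E"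
    by (rule fus_core_greatest(2)[OF E.prefusion_F]) (use normal_in_normalizer_fus[OF prefusion_F] sR in simp)
  let ?K = "fus_core ?E"
  have K: "normal_in_fus ?K ?E" by (rule fus_core_greatest(1)[OF E.prefusion_F])
  then have sK: "subgroup ?K (G\<lparr>carrier := normalizer G R\<rparr>)" using E.normal_in_fus_normalizer by blast
  have NR: "subgroup (normalizer G R) G" by (rule subgroup_normalizer[OF subgroup.subset[OF sR]])
  have KN: "?K \<subseteq> normalizer G R" using subgroup.subset[OF sK] by simp
  have sKG: "subgroup ?K G" by (rule incl_subgroup[OF NR sK])
  show "?K \<subseteq> R"
  proof (rule radical_absorbs[OF R sKG KN])
    fix \<alpha> m assume \<alpha>: "\<alpha> \<in> Mor F R R" and m: "m \<in> ?K"
    have "\<alpha> \<in> Mor ?E R R"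
      using \<alpha> Mor_endo_onto[OF \<alpha>] subset_normalizer[OF sR] by (simp add: normalizer_Mor_above_iff[OF sR])
    then obtain \<psi> where \<psi>: "\<psi> \<in> Mor ?E (R <#> ?K) (R <#> ?K)" "\<And>x. x \<in> R \<Longrightarrow> \<psi> x = \<alpha> x" "\<psi> ` ?K = ?K"
      using E.normal_in_fus_extends[OF K] by (metis set_mult_consistent)
    have \<psi>F: "\<psi> \<in> Mor F (R <#> ?K) (R <#> ?K)" using \<psi>(1) by (simp add: normalizer_Mor_iff)
    note s = subset_set_mult_subgroups[OF sR sKG]
    have "\<psi> m \<in> ?K" using \<psi>(3) m by blast
    moreover have "\<alpha> (m \<otimes> x \<otimes> inv m) = \<psi> m \<otimes> \<alpha> x \<otimes> inv (\<psi> m)" if x: "x \<in> R" for x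
      using Mor_conj[OF \<psi>F, of m x] \<psi>(2) normalizer_conj(1)[OF sR, of m x] m KN x s by (metis subsetD)
    ultimately show "\<exists>m'\<in>?K. \<forall>x\<in>R. \<alpha> (m \<otimes> x \<otimes> inv m) = m' \<otimes> \<alpha> x \<otimes> inv m'" by blast
  qed
qed

text \<open>
  Let \<open>P\<close> be a fully automised and receptive subgroup isomorphic to \<open>Q\<close>.
  As \<open>Q\<close> is fully normalised, the extension \<open>\<psi>\<close> of an isomorphism
  to a map from \<open>N\<^sub>S(Q)\<close> to \<open>N\<^sub>S(P)\<close> is bijective. Both
  properties of \<open>P\<close> are transported to \<open>Q\<close> by the inverse
  \<open>\<omega>\<close> of \<open>\<psi>\<close>.
\<close>
lemma fully_normalised_imp:
  assumes sat: "saturated p F" and Q: "fully_normalised F Q"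
  shows "fully_automised p F Q" and "receptive F Q"
proof -
  have sQ: "subgroup Q G" using Q by (simp add: fully_normalised_def)
  obtain P where iso: "fusion_iso F Q P" and fP: "fully_automised p F P" and rP: "receptive F P"
    using sat sQ unfolding saturated_def grp_F by blast
  obtain \<psi> where \<psi>: "\<psi> \<in> Mor F (normalizer G Q) (carrier G)" "\<psi> ` Q = P"
    by (rule extends_to_normalizer[OF fP rP iso])
  have sP: "subgroup P G" using iso Mor_subgroup(2) by (auto simp: fusion_iso_iff)
  have NQ: "subgroup (normalizer G Q) G" by (rule subgroup_normalizer[OF subgroup.subset[OF sQ]])
  have NP: "subgroup (normalizer G P) G" by (rule subgroup_normalizer[OF subgroup.subset[OF sP]])
  note QN = subset_normalizer[OF sQ]
  have im: "\<psi> ` normalizer G Q = normalizer G P"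
  proof (rule card_seteq)
    show "finite (normalizer G P)" by (rule finite_subgroup[OF NP])
    show "\<psi> ` normalizer G Q \<subseteq> normalizer G P" by (rule extends_to_normalizer_image[OF \<psi> sQ])
    have "card (normalizer G P) \<le> card (normalizer G Q)"
      using Q iso by (simp add: fully_normalised_def)
    then show "card (normalizer G P) \<le> card (\<psi> ` normalizer G Q)"
      using Mor_card[OF \<psi>(1) order_refl] by simp
  qed
  have \<psi>N: "\<psi> \<in> Mor F (normalizer G Q) (normalizer G P)" using Mor_image[OF \<psi>(1)] im by simp
  obtain \<omega> where \<omega>: "\<omega> \<in> Mor F (normalizer G P) (normalizer G Q)"
    "\<And>x. x \<in> normalizer G Q \<Longrightarrow> \<omega> (\<psi> x) = x" "\<And>y. y \<in> normalizer G P \<Longrightarrow> \<psi> (\<omega> y) = y"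
    using Mor_inverse[OF \<psi>N im] by metis
  note PN = subset_normalizer[OF sP]
  have \<omega>P: "\<omega> ` P = Q"
  proof -
    have "\<omega> ` (\<psi> ` Q) = Q" using \<omega>(2) QN by (force simp: image_image)
    then show ?thesis using \<psi>(2) by simp
  qed
  have \<psi>Q: "\<psi> x \<in> P" if "x \<in> Q" for x using that \<psi>(2) by blast
  have \<omega>P': "\<omega> x \<in> Q" if "x \<in> P" for x using that \<omega>P by blast
  have \<psi>r: "restrict \<psi> Q \<in> Mor F Q P" by (rule Mor_restrict[OF \<psi>(1) sQ QN sP]) (simp add: \<psi>(2))
  have \<omega>r: "restrict \<omega> P \<in> Mor F P Q" by (rule Mor_restrict[OF \<omega>(1) sP PN sQ]) (simp add: \<omega>P)
  define T where "T = (\<lambda>\<alpha>. \<lambda>x\<in>Q. \<omega> (\<alpha> (\<psi> x)))"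
  \<comment> \<open>As \<open>T\<close> is a bijection of the automorphism groups that takes \<open>Aut\<^sub>S(P)\<close> onto \<open>Aut\<^sub>S(Q)\<close>, the latter has the order of a Sylow subgroup.\<close>
  have T: "T \<alpha> \<in> Mor F Q Q" if \<alpha>: "\<alpha> \<in> Mor F P P" for \<alpha>
    using Mor_comp[OF Mor_comp[OF \<psi>r \<alpha>] \<omega>r] \<psi>Q Mor_mem[OF \<alpha>] by (simp add: T_def cong: restrict_cong)
  define T' where "T' = (\<lambda>\<alpha>. \<lambda>x\<in>P. \<psi> (\<alpha> (\<omega> x)))"
  have T': "T' \<alpha> \<in> Mor F P P" if \<alpha>: "\<alpha> \<in> Mor F Q Q" for \<alpha>
    using Mor_comp[OF Mor_comp[OF \<omega>r \<alpha>] \<psi>r] \<omega>P' Mor_mem[OF \<alpha>] by (simp add: T'_def cong: restrict_cong)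
  have TT': "T (T' \<alpha>) = \<alpha>" if \<alpha>: "\<alpha> \<in> Mor F Q Q" for \<alpha>
  proof (rule Mor_eqI[OF T[OF T'[OF \<alpha>]] \<alpha>])
    show "T (T' \<alpha>) x = \<alpha> x" if "x \<in> Q" for x
      using that \<psi>Q \<omega>(2) QN Mor_mem[OF \<alpha>] by (simp add: T_def T'_def subset_iff)
  qed
  have T'T: "T' (T \<alpha>) = \<alpha>" if \<alpha>: "\<alpha> \<in> Mor F P P" for \<alpha>
  proof (rule Mor_eqI[OF T'[OF T[OF \<alpha>]] \<alpha>])
    show "T' (T \<alpha>) x = \<alpha> x" if "x \<in> P" for x
      using that \<omega>P' \<omega>(3) PN Mor_mem[OF \<alpha>] by (simp add: T_def T'_def subset_iff)
  qed
  have bij: "bij_betw T (Mor F P P) (Mor F Q Q)"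
    by (rule bij_betw_byWitness[where f' = T']) (use T T' TT' T'T in blast)+
  have T_conj: "T (conj_map G (\<psi> m) P) = conj_map G m Q" if m: "m \<in> normalizer G Q" for m
  proof (rule extensionalityI[of _ Q])
    show "T (conj_map G (\<psi> m) P) \<in> extensional Q" by (simp add: T_def)
    show "conj_map G m Q \<in> extensional Q" by (simp add: conj_map_def)
    fix x assume x: "x \<in> Q"
    have "T (conj_map G (\<psi> m) P) x = \<omega> (\<psi> m \<otimes> \<psi> x \<otimes> inv (\<psi> m))" using x \<psi>Q by (simp add: T_def)
    also have "\<psi> m \<otimes> \<psi> x \<otimes> inv (\<psi> m) = \<psi> (m \<otimes> x \<otimes> inv m)"
      using Mor_conj[OF \<psi>(1) m] x QN by auto
    also have "\<omega> \<dots> = m \<otimes> x \<otimes> inv m" using \<omega>(2) normalizer_conj(1)[OF sQ m x] QN by blast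
    finally show "T (conj_map G (\<psi> m) P) x = conj_map G m Q x" using x by simp
  qed
  have "conj_aut G P = (\<lambda>m. conj_map G (\<psi> m) P) ` normalizer G Q"
    unfolding conj_aut_image im[symmetric] by (simp add: image_image)
  then have "T ` conj_aut G P = (\<lambda>m. T (conj_map G (\<psi> m) P)) ` normalizer G Q" by (simp add: image_image)
  also have "\<dots> = conj_aut G Q" unfolding conj_aut_image by (rule image_cong[OF refl T_conj])
  finally have "T ` conj_aut G P = conj_aut G Q" .
  moreover have "inj_on T (conj_aut G P)"
    by (rule inj_on_subset[OF bij_betw_imp_inj_on[OF bij] conj_aut_Mor[OF sP]])
  ultimately have "card (conj_aut G Q) = card (conj_aut G P)" using card_image by metis
  moreover have "order (Aut_fus F P) = order (Aut_fus F Q)"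
    using bij_betw_same_card[OF bij] by (simp add: order_def)
  ultimately show "fully_automised p F Q"
    using fP p_group_conj_aut(1)[OF sQ] unfolding fully_automised_sylow sylow_subgroup_def by simp
  show "receptive F Q"
    unfolding receptive_def grp_F
  proof (intro allI ballI impI)
    fix W \<phi> assume \<phi>: "\<phi> \<in> Mor F W Q" "\<phi> ` W = Q"
    let ?D = "ext_control F W Q \<phi>"
    have D: "subgroup ?D G" by (rule subgroup_ext_control[OF \<phi>])
    note WD = subset_ext_control[OF \<phi>]
    note W = Mor_subgroup(1)[OF \<phi>(1)]
    have \<phi>Q: "\<phi> w \<in> Q" if "w \<in> W" for w using Mor_mem[OF \<phi>(1) that] .
    \<comment> \<open>The morphism \<open>\<psi> \<phi>\<close> onto \<open>P\<close> extends to the control subgroup of \<open>\<phi>\<close>; the extension is brought back by \<open>\<omega>\<close>.\<close>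
    let ?\<theta> = "\<lambda>x\<in>W. \<psi> (\<phi> x)"
    have \<theta>: "?\<theta> \<in> Mor F W P" "?\<theta> ` W = P"
      using Mor_comp[OF \<phi>(1) \<psi>r] \<phi>Q Mor_comp_onto[OF \<phi>(2) \<psi>(2)] by (simp_all cong: restrict_cong)
    have "\<exists>h\<in>normalizer G P. \<forall>u\<in>W. ?\<theta> (m \<otimes> u \<otimes> inv m) = h \<otimes> ?\<theta> u \<otimes> inv h" if m: "m \<in> ?D" for m
    proof -
      obtain h where h: "h \<in> normalizer G Q" "\<forall>u\<in>W. \<phi> (m \<otimes> u \<otimes> inv m) = h \<otimes> \<phi> u \<otimes> inv h"
        using m unfolding ext_control_iff[OF \<phi>] by blast
      have mN: "m \<in> normalizer G W" using m WD(2) by blast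
      have "?\<theta> (m \<otimes> u \<otimes> inv m) = \<psi> h \<otimes> ?\<theta> u \<otimes> inv (\<psi> h)" if u: "u \<in> W" for u
        using h(2) u normalizer_conj(1)[OF W mN u] Mor_conj[OF \<psi>(1) h(1), of "\<phi> u"] \<phi>Q[OF u] QN by auto
      then show ?thesis using Mor_mem[OF \<psi>N h(1)] by blast
    qed
    then obtain \<chi> where \<chi>: "\<chi> \<in> Mor F ?D (carrier G)" "\<And>u. u \<in> W \<Longrightarrow> \<chi> u = ?\<theta> u"
      using receptive_extends[OF rP \<theta> D WD(1) WD(2)] by blast
    have "\<chi> ` W = ?\<theta> ` W" by (rule image_cong[OF refl \<chi>(2)])
    then have \<chi>W: "\<chi> ` W = P" using \<theta>(2) by (rule trans)
    have "\<chi> m \<in> normalizer G P" if "m \<in> ?D" for m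
      by (rule Mor_image_normalizer[OF \<chi>(1) W WD(1) \<chi>W that]) (use that WD(2) in blast)
    then have \<chi>N: "\<chi> \<in> Mor F ?D (normalizer G P)" by (intro Mor_codomain[OF \<chi>(1) NP]) blast
    let ?\<xi> = "\<lambda>x\<in>?D. \<omega> (\<chi> x)"
    have "?\<xi> \<in> Mor F ?D (normalizer G Q)" by (rule Mor_comp[OF \<chi>N \<omega>(1)])
    then have "?\<xi> \<in> Mor F ?D (carrier G)"
      by (rule Mor_codomain[OF _ subgroup_self]) (use Mor_carrier[OF \<open>?\<xi> \<in> _\<close>] in blast)
    moreover have "restrict ?\<xi> W = \<phi>"
    proof (rule extensionalityI[of _ W])
      show "\<phi> \<in> extensional W" by (rule Mor_props(1)[OF \<phi>(1)])
      fix x assume x: "x \<in> W"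
      then have "\<chi> x = \<psi> (\<phi> x)" using \<chi>(2) by simp
      then show "restrict ?\<xi> W x = \<phi> x" using x WD(1) \<omega>(2) \<phi>Q[OF x] QN by auto
    qed (simp add: extensional_def)
    ultimately show "\<exists>\<psi>\<in>Mor F ?D (carrier G). restrict \<psi> W = \<phi>" by blast
  qed
qed

section \<open>Essential subgroups from morphisms that do not extend\<close>

definition extends_to_group :: "'a set \<Rightarrow> ('a \<Rightarrow> 'a) \<Rightarrow> bool" where
  "extends_to_group U \<phi> \<longleftrightarrow> (\<exists>\<tau>\<in>Mor F (carrier G) (carrier G). \<forall>u\<in>U. \<tau> u = \<phi> u)"

lemma extends_to_groupI:
  "\<tau> \<in> Mor F (carrier G) (carrier G) \<Longrightarrow> (\<And>u. u \<in> U \<Longrightarrow> \<tau> u = \<phi> u) \<Longrightarrow> extends_to_group U \<phi>"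
  by (auto simp: extends_to_group_def)

lemma extends_to_groupE:
  assumes "extends_to_group U \<phi>"
  obtains \<tau> where "\<tau> \<in> Mor F (carrier G) (carrier G)" "\<And>u. u \<in> U \<Longrightarrow> \<tau> u = \<phi> u"
  using assms by (auto simp: extends_to_group_def)

text \<open>
  If every automorphism of \<open>R\<close> extended to the whole group, then
  \<open>Aut\<^sub>F(R)\<close> would normalise the automorphisms induced by the normaliser of
  \<open>R\<close>, and \<open>R\<close> would be its own normaliser.
\<close>
lemma exists_nonextending_automorphism:
  assumes R: "radical p F R" "centralizer G R \<subseteq> R" "R \<noteq> carrier G"
  shows "\<exists>\<alpha>\<in>Mor F R R. \<not> extends_to_group R \<alpha>"
proof (rule ccontr)
  assume "\<not> ?thesis"
  then have ext: "extends_to_group R \<alpha>" if "\<alpha> \<in> Mor F R R" for \<alpha> using that by blast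
  have sR: "subgroup R G" using R by (simp add: radical_def)
  note Rs = subgroup.subset[OF sR]
  have NR: "subgroup (normalizer G R) G" by (rule subgroup_normalizer[OF Rs])
  have "normalizer G R \<subseteq> R"
  proof (rule radical_absorbs[OF R(1,2) NR order_refl])
    fix \<alpha> m assume \<alpha>: "\<alpha> \<in> Mor F R R" and m: "m \<in> normalizer G R"
    obtain \<tau> where \<tau>: "\<tau> \<in> Mor F (carrier G) (carrier G)" "\<And>u. u \<in> R \<Longrightarrow> \<tau> u = \<alpha> u"
      using extends_to_groupE[OF ext[OF \<alpha>]] by blast
    have mG: "m \<in> carrier G" using subgroup.mem_carrier[OF NR m] .
    have "\<tau> ` R = \<alpha> ` R" by (rule image_cong[OF refl \<tau>(2)])
    then have \<tau>R: "\<tau> ` R = R" using Mor_endo_onto[OF \<alpha>] by (rule trans)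
    have "\<tau> m \<in> normalizer G R" by (rule Mor_image_normalizer[OF \<tau>(1) sR Rs \<tau>R mG m])
    moreover have "\<alpha> (m \<otimes> x \<otimes> inv m) = \<tau> m \<otimes> \<alpha> x \<otimes> inv (\<tau> m)" if x: "x \<in> R" for x
      using Mor_conj[OF \<tau>(1) mG, of x] \<tau>(2) normalizer_conj(1)[OF sR m x] x Rs by auto
    ultimately show "\<exists>m'\<in>normalizer G R. \<forall>x\<in>R. \<alpha> (m \<otimes> x \<otimes> inv m) = m' \<otimes> \<alpha> x \<otimes> inv m'" by blast
  qed
  then show False using normalizer_grows[OF sR] R(3) by blast
qed

end

text \<open>
  The subgroup \<open>V\<close> is where a morphism ends up that does not extend to the whole
  group and has a domain of maximal order, once its domain and image are moved to a fully
  automised and receptive subgroup.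
\<close>
locale maximal_nonextending = fusion_sys +
  fixes V :: "'a set" and \<beta> :: "'a \<Rightarrow> 'a"
  assumes V: "fully_automised p F V" "receptive F V" "V \<noteq> carrier G"
    and \<beta>: "\<beta> \<in> Mor F V V" "\<not> extends_to_group V \<beta>"
    and larger: "\<And>D W \<psi>. \<psi> \<in> Mor F D W \<Longrightarrow> card V < card D \<Longrightarrow> extends_to_group D \<psi>"
begin

abbreviation "A_V \<equiv> Aut_fus F V"

lemma subgroup_V: "subgroup V G"
  by (rule Mor_subgroup(1)[OF \<beta>(1)])

definition Ext where "Ext = {\<alpha> \<in> Mor F V V. extends_to_group V \<alpha>}"

sublocale A: group "A_V"
  by (rule group_Aut[OF subgroup_V])

text \<open>
  Receptivity extends \<open>\<alpha>\<close> to its control subgroup; from this larger subgroup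
  it extends further by maximality.
\<close>
lemma extends_if_control_larger:
  assumes \<alpha>: "\<alpha> \<in> Mor F V V" and D: "\<not> ext_control F V V \<alpha> \<subseteq> V"
  shows "\<alpha> \<in> Ext"
proof -
  note onto = Mor_endo_onto[OF \<alpha>]
  let ?D = "ext_control F V V \<alpha>"
  obtain \<psi> where \<psi>: "\<psi> \<in> Mor F ?D (carrier G)" "restrict \<psi> V = \<alpha>"
    using V(2) \<alpha> onto unfolding receptive_def grp_F by blast
  have VD: "V \<subset> ?D" using subset_ext_control(1)[OF \<alpha> onto] D by blast
  have "card V < card ?D"
    by (rule psubset_card_mono[OF finite_subgroup[OF subgroup_ext_control[OF \<alpha> onto]] VD])
  then obtain \<tau> where \<tau>: "\<tau> \<in> Mor F (carrier G) (carrier G)" "\<And>u. u \<in> ?D \<Longrightarrow> \<tau> u = \<psi> u"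
    using extends_to_groupE[OF larger[OF \<psi>(1)]] by blast
  have "\<tau> u = \<alpha> u" if "u \<in> V" for u using that VD \<tau>(2) unfolding \<psi>(2)[symmetric] by auto
  then show ?thesis using \<alpha> extends_to_groupI[OF \<tau>(1)] by (simp add: Ext_def)
qed

text \<open>
  Elements of the centraliser belong to the control subgroup of every automorphism, in particular
  of \<open>\<beta>\<close>, which does not extend.
\<close>
lemma centralizer_V: "centralizer G V \<subseteq> V"
proof
  fix c assume c: "c \<in> centralizer G V"
  show "c \<in> V"
  proof (rule ccontr)
    assume cV: "c \<notin> V"
    note onto = Mor_endo_onto[OF \<beta>(1)]
    have cN: "c \<in> normalizer G V" using centralizer_subset_normalizer[OF subgroup_V] c by blast
    have "\<beta> (c \<otimes> u \<otimes> inv c) = \<one> \<otimes> \<beta> u \<otimes> inv \<one>" if u: "u \<in> V" for u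
    proof -
      have "c \<otimes> u \<otimes> inv c = u"
        using c u conj_eq_iff[of c u u] subgroup.mem_carrier[OF subgroup_V] by (simp add: centralizer_iff)
      then show ?thesis using Mor_carrier[OF \<beta>(1) u] by simp
    qed
    moreover have "\<one> \<in> normalizer G V" using subset_normalizer[OF subgroup_V] subgroup.one_closed[OF subgroup_V] by blast
    ultimately have "c \<in> ext_control F V V \<beta>"
      using cN unfolding ext_control_iff[OF \<beta>(1) onto] by blast
    then have "\<beta> \<in> Ext" using extends_if_control_larger[OF \<beta>(1)] cV by blast
    then show False using \<beta>(2) by (simp add: Ext_def)
  qed
qed

text \<open>
  The inclusion \<open>C\<^sub>S(V) \<le> V\<close> is carried back to \<open>W\<close> by an
  extension to \<open>N\<^sub>S(W)\<close> of an isomorphism from \<open>W\<close> to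
  \<open>V\<close>.
\<close>
lemma centric_V: "centric F V"
proof (rule centricI[OF subgroup_V])
  fix W assume "fusion_iso F V W"
  then have iso: "fusion_iso F W V" by (rule fusion_iso_sym)
  then have W: "subgroup W G" using Mor_subgroup(1) by (auto simp: fusion_iso_iff)
  obtain \<psi> where \<psi>: "\<psi> \<in> Mor F (normalizer G W) (carrier G)" "\<psi> ` W = V"
    by (rule extends_to_normalizer[OF V(1,2) iso])
  show "centralizer G W \<subseteq> W"
  proof
    fix c assume c: "c \<in> centralizer G W"
    then have cN: "c \<in> normalizer G W" using centralizer_subset_normalizer[OF W] by blast
    note WN = subset_normalizer[OF W]
    have "\<psi> c \<in> centralizer G V"
      unfolding centralizer_iff
    proof (intro conjI ballI)
      show "\<psi> c \<in> carrier G" by (rule Mor_carrier[OF \<psi>(1) cN])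
      fix v assume "v \<in> V"
      then obtain w where w: "w \<in> W" "v = \<psi> w" using \<psi>(2) by blast
      then have "c \<otimes> w = w \<otimes> c" using c by (simp add: centralizer_iff)
      then show "\<psi> c \<otimes> v = v \<otimes> \<psi> c"
        using Mor_mult[OF \<psi>(1) cN, of w] Mor_mult[OF \<psi>(1), of w c] w WN cN by auto
    qed
    then have "\<psi> c \<in> \<psi> ` W" using centralizer_V \<psi>(2) by blast
    then obtain w where "w \<in> W" "\<psi> c = \<psi> w" by blast
    then show "c \<in> W" using Mor_inj[OF \<psi>(1) cN, of w] WN by blast
  qed
qed

lemma subgroup_Ext: "subgroup Ext (A_V)"
proof (rule A.subgroupI)
  show "Ext \<subseteq> carrier (A_V)" by (auto simp: Ext_def)
  have "(\<lambda>x\<in>V. x) \<in> Ext"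
    unfolding Ext_def using Mor_incl[OF subgroup_V subgroup_V order_refl] subgroup.subset[OF subgroup_V]
    by (auto intro!: extends_to_groupI[OF Mor_incl[OF subgroup_self subgroup_self order_refl]])
  then show "Ext \<noteq> {}" by blast
next
  fix \<alpha> assume "\<alpha> \<in> Ext"
  then have \<alpha>: "\<alpha> \<in> Mor F V V" "extends_to_group V \<alpha>" by (auto simp: Ext_def)
  then obtain \<tau> where \<tau>: "\<tau> \<in> Mor F (carrier G) (carrier G)" "\<And>u. u \<in> V \<Longrightarrow> \<tau> u = \<alpha> u"
    using extends_to_groupE[OF \<alpha>(2)] by blast
  let ?i = "inv\<^bsub>Aut_fus F (carrier G)\<^esub> \<tau>"
  have "?i u = (inv\<^bsub>A_V\<^esub> \<alpha>) u" if u: "u \<in> V" for u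
  proof -
    have iV: "(inv\<^bsub>A_V\<^esub> \<alpha>) u \<in> V" using Mor_mem[OF Aut_inv_closed[OF \<alpha>(1)] u] .
    then have "\<tau> ((inv\<^bsub>A_V\<^esub> \<alpha>) u) = u" using \<tau>(2) \<alpha>(1) u by simp
    then show ?thesis using Aut_inv_apply(1)[OF \<tau>(1)] iV subgroup.mem_carrier[OF subgroup_V] by metis
  qed
  then show "inv\<^bsub>A_V\<^esub> \<alpha> \<in> Ext"
    unfolding Ext_def using Aut_inv_closed[OF \<alpha>(1)] extends_to_groupI[OF Aut_inv_closed[OF \<tau>(1)]] by blast
next
  fix \<alpha> \<alpha>' assume "\<alpha> \<in> Ext" "\<alpha>' \<in> Ext"
  then have \<alpha>: "\<alpha> \<in> Mor F V V" "extends_to_group V \<alpha>" and \<alpha>': "\<alpha>' \<in> Mor F V V" "extends_to_group V \<alpha>'"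
    by (auto simp: Ext_def)
  obtain \<tau> where \<tau>: "\<tau> \<in> Mor F (carrier G) (carrier G)" "\<And>u. u \<in> V \<Longrightarrow> \<tau> u = \<alpha> u"
    using extends_to_groupE[OF \<alpha>(2)] by blast
  obtain \<tau>' where \<tau>': "\<tau>' \<in> Mor F (carrier G) (carrier G)" "\<And>u. u \<in> V \<Longrightarrow> \<tau>' u = \<alpha>' u"
    using extends_to_groupE[OF \<alpha>'(2)] by blast
  have "extends_to_group V (\<alpha> \<otimes>\<^bsub>A_V\<^esub> \<alpha>')"
    by (rule extends_to_groupI[OF Mor_comp[OF \<tau>'(1) \<tau>(1)]])
      (use \<alpha> \<alpha>' \<tau>(2) \<tau>'(2) Mor_mem[OF \<alpha>'(1)] subgroup.mem_carrier[OF subgroup_V] in simp)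
  moreover have "\<alpha> \<otimes>\<^bsub>A_V\<^esub> \<alpha>' \<in> Mor F V V" using A.m_closed \<alpha> \<alpha>' by simp
  ultimately show "\<alpha> \<otimes>\<^bsub>A_V\<^esub> \<alpha>' \<in> Ext" by (simp add: Ext_def)
qed

lemma conj_aut_le_Ext: "conj_aut G V \<subseteq> Ext"
proof
  fix \<alpha> assume a: "\<alpha> \<in> conj_aut G V"
  then obtain g where g: "g \<in> normalizer G V" "\<alpha> = conj_map G g V" by (auto simp: conj_aut_def)
  have gG: "g \<in> carrier G" using g normalizer_iff[OF subgroup_V] by blast
  have "conj_map G g (carrier G) \<in> Mor F (carrier G) (carrier G)"
    by (rule Mor_conj_map[OF subgroup_self subgroup_self gG]) (use gG in simp)
  then have "extends_to_group V \<alpha>"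
    by (rule extends_to_groupI) (use g subgroup.mem_carrier[OF subgroup_V] in simp)
  then show "\<alpha> \<in> Ext" using a conj_aut_Mor[OF subgroup_V] by (auto simp: Ext_def)
qed

lemma inner_aut_le_conj_aut: "inner_aut G V \<subseteq> conj_aut G V"
  unfolding inner_aut_image conj_aut_image by (rule image_mono[OF subset_normalizer[OF subgroup_V]])

lemma inner_imp_mem:
  assumes g: "g \<in> normalizer G V" "conj_map G g V \<in> inner_aut G V"
  shows "g \<in> V"
proof -
  obtain v where v: "v \<in> V" "conj_map G g V = conj_map G v V" using g(2) by (auto simp: inner_aut_def)
  have c: "g \<in> carrier G" "v \<in> carrier G" using g normalizer_iff[OF subgroup_V] subgroup.mem_carrier[OF subgroup_V] v by auto
  have "g \<otimes> x \<otimes> inv g = v \<otimes> x \<otimes> inv v" if "x \<in> V" for x using fun_cong[OF v(2), of x] that by simp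
  then have "inv v \<otimes> g \<in> V"
    using conj_eq_imp_centralizer[OF subgroup.subset[OF subgroup_V] c] centralizer_V by blast
  then have "v \<otimes> (inv v \<otimes> g) \<in> V" using subgroup.m_closed[OF subgroup_V v(1)] by blast
  then show "g \<in> V" using c by (simp flip: m_assoc)
qed

text \<open>
  The automorphisms that extend to the whole group form a strongly embedded subgroup modulo
  \<open>Inn(V)\<close>. Suppose that \<open>\<alpha>\<close> does not extend and that
  \<open>X\<close> and \<open>\<alpha>\<^sup>-\<^sup>1 X \<alpha>\<close> are
  \<open>p\<close>-groups of automorphisms that do. Sylow conjugates both into
  \<open>Aut\<^sub>S(V)\<close> by extending automorphisms \<open>h\<close> and \<open>k\<close>.
  Then \<open>\<gamma> = k \<alpha>\<^sup>-\<^sup>1 h\<^sup>-\<^sup>1\<close> does not extend, so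
  its control subgroup is \<open>V\<close>. But this subgroup contains all \<open>g\<close> that
  induce elements of \<open>h X h\<^sup>-\<^sup>1\<close>, since \<open>\<gamma>\<close>
  conjugates these into \<open>Aut\<^sub>S(V)\<close>. So \<open>X\<close> consists of inner
  automorphisms.
\<close>
lemma essential_V: "V \<in> essentials p F"
proof -
  note N = normal_inner_aut(1)[OF subgroup_V]
  obtain n where n: "card (inner_aut G V) = p ^ n" using normal_inner_aut(2)[OF subgroup_V] by blast
  obtain k where k: "card (conj_aut G V) = p ^ k" using p_group_conj_aut(2)[OF subgroup_V] by blast
  have finA: "finite (carrier (A_V))" using finite_Aut[OF subgroup_V] by simp
  have HM: "Ext \<subseteq> Mor F V V" by (auto simp: Ext_def)
  have syl: "sylow_subgroup p ((A_V)\<lparr>carrier := Ext\<rparr>) (conj_aut G V)"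
    using A.sylow_subgroup_in_subgroup[OF finA p_prime _ subgroup_Ext conj_aut_le_Ext] V(1)
    by (simp add: fully_automised_sylow)
  interpret AH: group "(A_V)\<lparr>carrier := Ext\<rparr>" by (rule A.subgroup_imp_group[OF subgroup_Ext])
  have finH: "finite (carrier ((A_V)\<lparr>carrier := Ext\<rparr>))" using finite_subset[OF HM finite_Aut[OF subgroup_V]] by simp
  have sylow: "\<exists>h\<in>Ext. \<forall>x\<in>X. h \<otimes>\<^bsub>A_V\<^esub> x \<otimes>\<^bsub>A_V\<^esub> inv\<^bsub>A_V\<^esub> h \<in> conj_aut G V"
    if X: "subgroup X (A_V)" "card X = p ^ m" "X \<subseteq> Ext" for X m
  proof -
    obtain h where "h \<in> carrier ((A_V)\<lparr>carrier := Ext\<rparr>)"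
      "\<And>x. x \<in> X \<Longrightarrow> h \<otimes>\<^bsub>(A_V)\<lparr>carrier := Ext\<rparr>\<^esub> x \<otimes>\<^bsub>(A_V)\<lparr>carrier := Ext\<rparr>\<^esub>
         inv\<^bsub>(A_V)\<lparr>carrier := Ext\<rparr>\<^esub> h \<in> conj_aut G V"
      using AH.sylow_conjugacy[OF finH p_prime A.subgroup_incl[OF X(1) subgroup_Ext X(3)] X(2) syl] by blast
    then show ?thesis using A.m_inv_consistent[OF subgroup_Ext] by auto
  qed
  have "strongly_embedded p (A_V Mod inner_aut G V) ((\<lambda>a. inner_aut G V #>\<^bsub>A_V\<^esub> a) ` Ext)"
  proof (rule A.strongly_embedded_factorI[OF finA p_prime N n subgroup_Ext])
    show "Ext \<noteq> carrier (A_V)" using \<beta> by (auto simp: Ext_def)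
    show "inner_aut G V \<subseteq> Ext" using inner_aut_le_conj_aut conj_aut_le_Ext by blast
    show "subgroup (conj_aut G V) (A_V)" by (rule p_group_conj_aut(1)[OF subgroup_V])
    show "card (conj_aut G V) = p ^ k" by (rule k)
    show "conj_aut G V \<subseteq> Ext" by (rule conj_aut_le_Ext)
    show "\<not> conj_aut G V \<subseteq> inner_aut G V"
    proof
      assume le: "conj_aut G V \<subseteq> inner_aut G V"
      have "normalizer G V \<subseteq> V"
      proof
        fix g assume g: "g \<in> normalizer G V"
        then have "conj_map G g V \<in> inner_aut G V" using le by (auto simp: conj_aut_def)
        then show "g \<in> V" by (rule inner_imp_mem[OF g])
      qed
      then show False using normalizer_grows[OF subgroup_V] V(3) by blast
    qed
    fix \<alpha> X m
    assume a: "\<alpha> \<in> carrier (A_V) - Ext" and X: "subgroup X (A_V)" "card X = p ^ m" "X \<subseteq> Ext"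
      and XH: "\<And>x. x \<in> X \<Longrightarrow> inv\<^bsub>A_V\<^esub> \<alpha> \<otimes>\<^bsub>A_V\<^esub> x \<otimes>\<^bsub>A_V\<^esub> \<alpha> \<in> Ext"
    have \<alpha>: "\<alpha> \<in> carrier (A_V)" using a by blast
    let ?Y = "(\<lambda>x. inv\<^bsub>A_V\<^esub> \<alpha> \<otimes>\<^bsub>A_V\<^esub> x \<otimes>\<^bsub>A_V\<^esub> \<alpha>) ` X"
    obtain h where h: "h \<in> Ext" "\<forall>x\<in>X. h \<otimes>\<^bsub>A_V\<^esub> x \<otimes>\<^bsub>A_V\<^esub> inv\<^bsub>A_V\<^esub> h \<in> conj_aut G V"
      using sylow[OF X] by blast
    have Y: "subgroup ?Y (A_V)" "card ?Y = p ^ m" "?Y \<subseteq> Ext"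
      using A.conj_subgroup[OF \<alpha> X(1)] X(2) XH by auto
    obtain k where k: "k \<in> Ext" "\<forall>y\<in>?Y. k \<otimes>\<^bsub>A_V\<^esub> y \<otimes>\<^bsub>A_V\<^esub> inv\<^bsub>A_V\<^esub> k \<in> conj_aut G V"
      using sylow[OF Y] by blast
    have c: "h \<in> carrier (A_V)" "k \<in> carrier (A_V)" using h k HM by auto
    define \<gamma> where "\<gamma> = k \<otimes>\<^bsub>A_V\<^esub> inv\<^bsub>A_V\<^esub> \<alpha> \<otimes>\<^bsub>A_V\<^esub> inv\<^bsub>A_V\<^esub> h"
    have \<gamma>: "\<gamma> \<in> Mor F V V" unfolding \<gamma>_def Aut_carrier[symmetric] by (intro A.m_closed A.inv_closed c \<alpha>)
    have "\<gamma> \<notin> Ext"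
    proof
      assume "\<gamma> \<in> Ext"
      then have "inv\<^bsub>A_V\<^esub> (inv\<^bsub>A_V\<^esub> k \<otimes>\<^bsub>A_V\<^esub> \<gamma> \<otimes>\<^bsub>A_V\<^esub> h) \<in> Ext"
        by (intro subgroup.m_inv_closed[OF subgroup_Ext] subgroup.m_closed[OF subgroup_Ext] h k)
      moreover have "inv\<^bsub>A_V\<^esub> (inv\<^bsub>A_V\<^esub> k \<otimes>\<^bsub>A_V\<^esub> \<gamma> \<otimes>\<^bsub>A_V\<^esub> h) = \<alpha>"
        unfolding \<gamma>_def by (rule A.conj_of_translate(1)[OF \<alpha> c])
      ultimately show False using a by simp
    qed
    then have D: "ext_control F V V \<gamma> \<subseteq> V" using extends_if_control_larger[OF \<gamma>] by blast
    have "h \<otimes>\<^bsub>A_V\<^esub> x \<otimes>\<^bsub>A_V\<^esub> inv\<^bsub>A_V\<^esub> h \<in> inner_aut G V" if x: "x \<in> X" for x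
    proof -
      let ?s = "h \<otimes>\<^bsub>A_V\<^esub> x \<otimes>\<^bsub>A_V\<^esub> inv\<^bsub>A_V\<^esub> h"
      let ?t = "k \<otimes>\<^bsub>A_V\<^esub> (inv\<^bsub>A_V\<^esub> \<alpha> \<otimes>\<^bsub>A_V\<^esub> x \<otimes>\<^bsub>A_V\<^esub> \<alpha>) \<otimes>\<^bsub>A_V\<^esub> inv\<^bsub>A_V\<^esub> k"
      have xc: "x \<in> carrier (A_V)" using subgroup.mem_carrier[OF X(1) x] .
      obtain g where g: "g \<in> normalizer G V" "?s = conj_map G g V" using h(2) x by (auto simp: conj_aut_def)
      obtain g' where g': "g' \<in> normalizer G V" "?t = conj_map G g' V" using k(2) x by (auto simp: conj_aut_def)
      have sM: "?s \<in> Mor F V V" and tM: "?t \<in> Mor F V V"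
        unfolding Aut_carrier[symmetric] by (intro A.m_closed A.inv_closed c \<alpha> xc)+
      have "\<gamma> \<otimes>\<^bsub>A_V\<^esub> ?s = ?t \<otimes>\<^bsub>A_V\<^esub> \<gamma>"
        unfolding \<gamma>_def by (rule A.conj_of_translate(2)[OF \<alpha> c xc])
      then have "\<gamma> (?s u) = ?t (\<gamma> u)" if "u \<in> V" for u
        using Aut_mult_apply[OF \<gamma> sM that] Aut_mult_apply[OF tM \<gamma> that] by simp
      then have "\<forall>u\<in>V. \<gamma> (g \<otimes> u \<otimes> inv g) = g' \<otimes> \<gamma> u \<otimes> inv g'"
        unfolding g(2) g'(2) using Mor_mem[OF \<gamma>] by simp
      then have "g \<in> ext_control F V V \<gamma>"
        using g g' unfolding ext_control_iff[OF \<gamma> Mor_endo_onto[OF \<gamma>]] by blast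
      then have "g \<in> V" using D by blast
      then show ?thesis unfolding g(2) by (auto simp: inner_aut_def)
    qed
    note inner = this
    show "X \<subseteq> inner_aut G V"
    proof
      fix x assume x: "x \<in> X"
      have xc: "x \<in> carrier (A_V)" using subgroup.mem_carrier[OF X(1) x] .
      have "inv\<^bsub>A_V\<^esub> h \<otimes>\<^bsub>A_V\<^esub> (h \<otimes>\<^bsub>A_V\<^esub> x \<otimes>\<^bsub>A_V\<^esub> inv\<^bsub>A_V\<^esub> h) \<otimes>\<^bsub>A_V\<^esub> h \<in> inner_aut G V"
        using normal.inv_op_closed1[OF N c(1) inner[OF x]] .
      then show "x \<in> inner_aut G V"
        using A.conjugation_is_surj[of "inv\<^bsub>A_V\<^esub> h" x] c xc by (simp del: Aut_carrier)
    qed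
  qed
  then show ?thesis
    using fully_normalisedI[OF subgroup_V V(1,2)] centric_V by (auto simp: essentials_def Out_fus_def)
qed

end

text \<open>
  Of all morphisms that do not extend to the whole group, choose one, \<open>\<phi>\<close> on
  \<open>U\<close>, with \<open>U\<close> of maximal order. As \<open>\<phi>\<close> extends over
  \<open>Q\<close>, the subgroup \<open>U\<close> contains \<open>Q\<close>, and saturation is
  needed only above \<open>Q\<close>. The domain and the image of \<open>\<phi>\<close> are both
  isomorphic to a fully automised and receptive \<open>V\<close>, by isomorphisms that extend to
  their normalisers and thus, by maximality, to the whole group. They turn \<open>\<phi>\<close>
  into an automorphism \<open>\<beta>\<close> of \<open>V\<close> that does not extend.
\<close>
lemma (in fusion_sys) exists_essential:
  assumes Q: "normal_in_fus Q F"
    and sat: "\<And>U. subgroup U G \<Longrightarrow> Q \<subseteq> U \<Longrightarrow> \<exists>V. fusion_iso F U V \<and> fully_automised p F V \<and> receptive F V"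
    and R: "radical p F R" "centralizer G R \<subseteq> R" "R \<noteq> carrier G"
  shows "\<exists>V\<in>essentials p F. card R \<le> card V"
proof -
  have sQ: "subgroup Q G" and NQ: "normalizer G Q = carrier G" using normal_in_fus_normalizer[OF Q] by auto
  obtain \<rho> where \<rho>: "\<rho> \<in> Mor F R R" "\<not> extends_to_group R \<rho>"
    using exists_nonextending_automorphism[OF R] by blast
  \<comment> \<open>The predicate is on triples, so that the order of the domain can be maximised over all morphisms at once.\<close>
  let ?P = "\<lambda>(U, W, \<phi>). \<phi> \<in> Mor F U W \<and> \<not> extends_to_group U \<phi>"
  have "\<exists>x. ?P x \<and> (\<forall>y. ?P y \<longrightarrow> card (fst y) \<le> card (fst x))"
  proof (rule Lattices_Big.ex_has_greatest_nat[of ?P "(R, R, \<rho>)"])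
    show "?P (R, R, \<rho>)" using \<rho> by simp
    show "\<forall>y. ?P y \<longrightarrow> card (fst y) < Suc (card (carrier G))"
      using Mor_sub(1) card_mono[OF finite_G] by (auto simp: less_Suc_eq_le)
  qed
  then obtain x where x: "?P x" "\<forall>y. ?P y \<longrightarrow> card (fst y) \<le> card (fst x)" by blast
  obtain U W \<phi> where "x = (U, W, \<phi>)" by (cases x)
  then have \<phi>: "\<phi> \<in> Mor F U W" "\<not> extends_to_group U \<phi>"
    and max: "\<And>U' W' \<phi>'. \<phi>' \<in> Mor F U' W' \<Longrightarrow> \<not> extends_to_group U' \<phi>' \<Longrightarrow> card U' \<le> card U"
    using x by auto
  have RU: "card R \<le> card U" by (rule max[OF \<rho>])
  have larger: "extends_to_group D \<psi>" if "\<psi> \<in> Mor F D X" "card U < card D" for D X \<psi>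
    using max[OF that(1)] that(2) by (meson not_le)
  note U = Mor_subgroup(1)[OF \<phi>(1)]
  have QU: "Q \<subseteq> U"
  proof (rule ccontr)
    assume "\<not> Q \<subseteq> U"
    obtain \<psi> where \<psi>: "\<psi> \<in> Mor F (U <#> Q) (W <#> Q)" "\<And>x. x \<in> U \<Longrightarrow> \<psi> x = \<phi> x"
      using normal_in_fus_extends[OF Q \<phi>(1)] by metis
    note s = subset_set_mult_subgroups[OF U sQ]
    have "U \<subset> U <#> Q" using s \<open>\<not> Q \<subseteq> U\<close> by blast
    then have "card U < card (U <#> Q)"
      by (rule psubset_card_mono[OF finite_subgroup[OF Mor_subgroup(1)[OF \<psi>(1)]]])
    then obtain \<tau> where \<tau>: "\<tau> \<in> Mor F (carrier G) (carrier G)" "\<And>u. u \<in> U <#> Q \<Longrightarrow> \<tau> u = \<psi> u"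
      using extends_to_groupE[OF larger[OF \<psi>(1)]] by blast
    have "extends_to_group U \<phi>" by (rule extends_to_groupI[OF \<tau>(1)]) (use \<tau>(2) \<psi>(2) s in auto)
    then show False using \<phi>(2) by simp
  qed
  obtain V where iso: "fusion_iso F U V" and fV: "fully_automised p F V" and rV: "receptive F V"
    using sat[OF U QU] by blast
  have card_iso: "card X = card Y" if XY: "fusion_iso F X Y" for X Y
  proof -
    obtain \<theta> where "\<theta> \<in> Mor F X Y" "\<theta> ` X = Y" using XY by (auto simp: fusion_iso_iff)
    then show ?thesis using Mor_card[of \<theta> X Y X] by simp
  qed
  have UG: "U \<noteq> carrier G"
  proof
    assume UG: "U = carrier G"
    have "\<phi> \<in> Mor F (carrier G) (carrier G)"
      using Mor_codomain[OF \<phi>(1) subgroup_self] Mor_carrier[OF \<phi>(1)] UG by auto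
    then have "extends_to_group U \<phi>" by (rule extends_to_groupI) simp
    then show False using \<phi>(2) by simp
  qed
  then have cU: "card U < card (carrier G)"
    using psubset_card_mono[OF finite_G, of U] subgroup.subset[OF U] by blast
  have conj: "\<exists>\<tau>\<in>Mor F (carrier G) (carrier G). \<tau> ` X = V" if X: "fusion_iso F X V" "card X = card U" for X
  proof -
    have sX: "subgroup X G" using X(1) Mor_subgroup(1) by (auto simp: fusion_iso_iff)
    have NX: "subgroup (normalizer G X) G" by (rule subgroup_normalizer[OF subgroup.subset[OF sX]])
    obtain \<chi> where \<chi>: "\<chi> \<in> Mor F (normalizer G X) (carrier G)" "\<chi> ` X = V"
      by (rule extends_to_normalizer[OF fV rV X(1)])
    have XN: "X \<subset> normalizer G X"
      using subset_normalizer[OF sX] normalizer_grows[OF sX] cU X(2) by force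
    have "card U < card (normalizer G X)"
      using psubset_card_mono[OF finite_subgroup[OF NX] XN] X(2) by simp
    then obtain \<tau> where \<tau>: "\<tau> \<in> Mor F (carrier G) (carrier G)" "\<And>u. u \<in> normalizer G X \<Longrightarrow> \<tau> u = \<chi> u"
      using extends_to_groupE[OF larger[OF \<chi>(1)]] by blast
    have "\<tau> ` X = \<chi> ` X" by (rule image_cong) (use \<tau>(2) XN in auto)
    then show ?thesis using \<tau>(1) \<chi>(2) by auto
  qed
  obtain \<tau>1 where \<tau>1: "\<tau>1 \<in> Mor F (carrier G) (carrier G)" "\<tau>1 ` U = V" using conj[OF iso] by blast
  have iso': "fusion_iso F U (\<phi> ` U)" using Mor_image[OF \<phi>(1)] by (auto simp: fusion_iso_iff)
  obtain \<tau>2 where \<tau>2: "\<tau>2 \<in> Mor F (carrier G) (carrier G)" "\<tau>2 ` \<phi> ` U = V"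
    using conj[OF fusion_iso_trans[OF fusion_iso_sym[OF iso'] iso]] card_iso[OF iso'] by metis
  have sV: "subgroup V G" using Mor_image_subgroup[OF \<tau>1(1) U subgroup.subset[OF U]] \<tau>1(2) by simp
  note Uc = subgroup.mem_carrier[OF U] and Vc = subgroup.mem_carrier[OF sV]
  define \<tau>i where "\<tau>i = inv\<^bsub>Aut_fus F (carrier G)\<^esub> \<tau>1"
  have \<tau>i: "\<tau>i \<in> Mor F (carrier G) (carrier G)" unfolding \<tau>i_def by (rule Aut_inv_closed[OF \<tau>1(1)])
  have \<tau>i1: "\<tau>i (\<tau>1 x) = x" "\<tau>1 (\<tau>i x) = x" if "x \<in> carrier G" for x
    using Aut_inv_apply[OF \<tau>1(1) that] by (simp_all add: \<tau>i_def)
  have \<tau>iV: "\<tau>i ` V = U" 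
  proof -
    have "\<tau>i ` (\<tau>1 ` U) = U" using \<tau>i1(1) Uc by (force simp: image_image)
    then show ?thesis using \<tau>1(2) by simp
  qed
  have \<tau>iVU: "\<tau>i x \<in> U" if "x \<in> V" for x using that \<tau>iV by blast
  let ?r1 = "restrict \<tau>i V" and ?r2 = "restrict \<tau>2 (\<phi> ` U)"
  have r1: "?r1 \<in> Mor F V U"
    by (rule Mor_restrict[OF \<tau>i sV subgroup.subset[OF sV] U]) (simp add: \<tau>iV)
  have s\<phi>: "subgroup (\<phi> ` U) G" by (rule Mor_image_subgroup[OF \<phi>(1) U order_refl])
  have r2: "?r2 \<in> Mor F (\<phi> ` U) V"
    by (rule Mor_restrict[OF \<tau>2(1) s\<phi> subgroup.subset[OF s\<phi>] sV]) (simp add: \<tau>2(2))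
  define \<beta> where "\<beta> = (\<lambda>x\<in>V. \<tau>2 (\<phi> (\<tau>i x)))"
  have \<beta>: "\<beta> \<in> Mor F V V"
    using Mor_comp[OF Mor_comp[OF r1 Mor_image[OF \<phi>(1)]] r2] \<tau>iVU unfolding \<beta>_def by (simp cong: restrict_cong)
  have "\<not> extends_to_group V \<beta>"
  proof
    assume "extends_to_group V \<beta>"
    then obtain \<sigma> where \<sigma>: "\<sigma> \<in> Mor F (carrier G) (carrier G)" "\<And>u. u \<in> V \<Longrightarrow> \<sigma> u = \<beta> u"
      using extends_to_groupE by blast
    let ?i2 = "inv\<^bsub>Aut_fus F (carrier G)\<^esub> \<tau>2"
    let ?\<tau> = "\<lambda>x\<in>carrier G. ?i2 ((\<lambda>x\<in>carrier G. \<sigma> (\<tau>1 x)) x)"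
    have "extends_to_group U \<phi>"
    proof (rule extends_to_groupI)
      show "?\<tau> \<in> Mor F (carrier G) (carrier G)"
        by (rule Mor_comp[OF Mor_comp[OF \<tau>1(1) \<sigma>(1)] Aut_inv_closed[OF \<tau>2(1)]])
      fix u assume u: "u \<in> U"
      have "\<tau>1 u \<in> V" using u \<tau>1(2) by blast
      then have "\<sigma> (\<tau>1 u) = \<tau>2 (\<phi> u)" using \<sigma>(2) \<tau>i1(1)[OF Uc[OF u]] by (simp add: \<beta>_def)
      then show "?\<tau> u = \<phi> u" using Uc[OF u] Aut_inv_apply(1)[OF \<tau>2(1) Mor_carrier[OF \<phi>(1) u]] by simp
    qed
    then show False using \<phi>(2) by simp
  qed
  moreover have cV: "card V = card U" using card_iso[OF iso] by simp
  moreover have "V \<noteq> carrier G" using cV cU by auto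
  ultimately interpret maximal_nonextending G p F V \<beta>
    using fV rV \<beta> larger by unfold_locales auto
  show ?thesis by (rule bexI[OF _ essential_V]) (simp add: RU cV)
qed

section \<open>Saturation of the normaliser of a centric subgroup above that subgroup\<close>

context fusion_sys
begin

text \<open>
  The elements \<open>u\<close> and \<open>\<alpha> u\<close> induce the same automorphism of
  \<open>Q\<close>.
\<close>
lemma Aut_fixing_normal:
  assumes Q: "subgroup Q G" "centralizer G Q \<subseteq> Q" and U: "Q \<subseteq> U" "U \<subseteq> normalizer G Q"
    and \<alpha>: "\<alpha> \<in> Mor F U U" "\<And>q. q \<in> Q \<Longrightarrow> \<alpha> q = q" and u: "u \<in> U"
  shows "inv u \<otimes> \<alpha> u \<in> Q"
proof -
  have sU: "subgroup U G" by (rule Mor_subgroup(1)[OF \<alpha>(1)])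
  have c: "u \<in> carrier G" "\<alpha> u \<in> carrier G"
    using subgroup.mem_carrier[OF sU u] Mor_carrier[OF \<alpha>(1) u] by auto
  have "\<alpha> u \<otimes> q \<otimes> inv (\<alpha> u) = u \<otimes> q \<otimes> inv u" if q: "q \<in> Q" for q
  proof -
    have "u \<otimes> q \<otimes> inv u \<in> Q" using normalizer_conj(1)[OF Q(1) _ q] u U(2) by blast
    then have "u \<otimes> q \<otimes> inv u = \<alpha> (u \<otimes> q \<otimes> inv u)" using \<alpha>(2) by simp
    also have "\<dots> = \<alpha> u \<otimes> \<alpha> q \<otimes> inv (\<alpha> u)" using Mor_conj[OF \<alpha>(1) u, of q] q U(1) by blast
    finally show ?thesis using \<alpha>(2)[OF q] by simp
  qed
  then show ?thesis using conj_eq_imp_centralizer[OF subgroup.subset[OF Q(1)] c(2) c(1)] Q(2) by blast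
qed

text \<open>
  Since \<open>\<alpha>\<close> fixes \<open>z = u\<^sup>-\<^sup>1 \<alpha>(u) \<in> Q\<close>,
  induction gives \<open>\<alpha>\<^sup>n(u) = u z\<^sup>n\<close>. So the order of
  \<open>\<alpha>\<close> divides that of \<open>G\<close> and is a power of \<open>p\<close>.
\<close>
lemma p_subgroup_of_Aut_fixing:
  assumes Q: "subgroup Q G" "centralizer G Q \<subseteq> Q" and U: "Q \<subseteq> U" "U \<subseteq> normalizer G Q"
    and \<alpha>: "\<alpha> \<in> Mor F U U" "\<And>q. q \<in> Q \<Longrightarrow> \<alpha> q = q"
  shows "\<exists>P n. subgroup P (Aut_fus F U) \<and> card P = p ^ n \<and> \<alpha> \<in> P"
proof -
  let ?A = "Aut_fus F U"
  have sU: "subgroup U G" by (rule Mor_subgroup(1)[OF \<alpha>(1)])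
  interpret A: group "?A" by (rule group_Aut[OF sU])
  have \<alpha>A: "\<alpha> \<in> carrier (?A)" using \<alpha> by simp
  have pw: "(\<alpha> [^]\<^bsub>?A\<^esub> n) u = u \<otimes> (inv u \<otimes> \<alpha> u) [^] n" if u: "u \<in> U" for u and n :: nat
  proof (induction n)
    case 0
    then show ?case using u subgroup.mem_carrier[OF sU u] by simp
  next
    case (Suc n)
    define z where "z = inv u \<otimes> \<alpha> u"
    have z: "z \<in> Q" unfolding z_def by (rule Aut_fixing_normal[OF Q U \<alpha> u])
    have uc: "u \<in> carrier G" "\<alpha> u \<in> carrier G" "z \<in> carrier G"
      using subgroup.mem_carrier[OF sU u] Mor_carrier[OF \<alpha>(1) u] by (auto simp: z_def)
    have zn: "z [^] n \<in> Q" 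
    proof (induction n)
      case 0 then show ?case using subgroup.one_closed[OF Q(1)] by simp
    next
      case (Suc n) then show ?case using subgroup.m_closed[OF Q(1) _ z] by simp
    qed
    have \<alpha>n: "\<alpha> [^]\<^bsub>?A\<^esub> n \<in> Mor F U U" using A.nat_pow_closed[OF \<alpha>A] by simp
    have "(\<alpha> [^]\<^bsub>?A\<^esub> Suc n) u = \<alpha> ((\<alpha> [^]\<^bsub>?A\<^esub> n) u)"
      using A.nat_pow_Suc2[OF \<alpha>A] Aut_mult_apply[OF \<alpha>(1) \<alpha>n u] by simp
    also have "\<dots> = \<alpha> u \<otimes> z [^] n"
      unfolding Suc.IH z_def[symmetric] using Mor_mult[OF \<alpha>(1) u, of "z [^] n"] zn U(1) \<alpha>(2) by auto
    also have "\<alpha> u = u \<otimes> z" using uc by (simp add: z_def flip: m_assoc)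
    also have "u \<otimes> z \<otimes> z [^] n = u \<otimes> z [^] Suc n"
      using uc nat_pow_Suc2[OF uc(3)] by (simp add: m_assoc)
    finally show ?case unfolding z_def .
  qed
  obtain n where n: "card (carrier G) = p ^ n" using card_G by blast
  have "\<alpha> [^]\<^bsub>?A\<^esub> (p ^ n) = \<one>\<^bsub>?A\<^esub>"
  proof (rule Mor_eqI)
    show "\<alpha> [^]\<^bsub>?A\<^esub> (p ^ n) \<in> Mor F U U" using A.nat_pow_closed[OF \<alpha>A] by simp
    show "\<one>\<^bsub>?A\<^esub> \<in> Mor F U U" using A.one_closed by (simp del: Aut_one)
    fix u assume u: "u \<in> U"
    then have uc: "u \<in> carrier G" "\<alpha> u \<in> carrier G"
      using subgroup.mem_carrier[OF sU u] Mor_carrier[OF \<alpha>(1) u] by auto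
    have "(inv u \<otimes> \<alpha> u) [^] (p ^ n) = \<one>"
      using pow_order_eq_1[of "inv u \<otimes> \<alpha> u"] uc n by (simp add: order_def)
    then show "(\<alpha> [^]\<^bsub>?A\<^esub> (p ^ n)) u = \<one>\<^bsub>?A\<^esub> u" using pw[OF u] u uc by simp
  qed
  then have "A.ord \<alpha> dvd p ^ n" using A.pow_eq_id[OF \<alpha>A] by blast
  then obtain m where m: "A.ord \<alpha> = p ^ m" using p_prime by (auto simp: divides_primepow_nat)
  have "card (generate (?A) {\<alpha>}) = p ^ m" using A.generate_pow_card[OF \<alpha>A] m by simp
  moreover have "subgroup (generate (?A) {\<alpha>}) (?A)"
    by (rule A.generate_is_subgroup) (use \<alpha> in simp)
  moreover have "\<alpha> \<in> generate (?A) {\<alpha>}" by (simp add: generate.incl)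
  ultimately show ?thesis by blast
qed

end

locale centric_normaliser = fusion_sys +
  fixes Q :: "'a set"
  assumes sat: "saturated p F" and Q_fn: "fully_normalised F Q" and Q_centric: "centric F Q"
begin

abbreviation "N \<equiv> normalizer G Q"
abbreviation "GN \<equiv> G\<lparr>carrier := N\<rparr>"
abbreviation "E \<equiv> normalizer_fus F Q"

lemma subgroup_Q: "subgroup Q G" using Q_fn by (simp add: fully_normalised_def)
lemma subgroup_N: "subgroup N G" by (rule subgroup_normalizer[OF subgroup.subset[OF subgroup_Q]])
lemma Q_subset_N: "Q \<subseteq> N" by (rule subset_normalizer[OF subgroup_Q])
lemma centralizer_Q: "centralizer G Q \<subseteq> Q" by (rule centric_centralizer[OF Q_centric])
lemma fully_automised_Q: "fully_automised p F Q" and receptive_Q: "receptive F Q" by (rule fully_normalised_imp[OF sat Q_fn])+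

sublocale E: fusion_sys GN p E
  by (rule fusion_sys_normalizer[OF subgroup_Q])

lemma subgroup_GN: "subgroup U GN \<longleftrightarrow> subgroup U G \<and> U \<subseteq> N"
  using subgroup_incl[of U N] incl_subgroup[of N U] subgroup.subset[of U GN] subgroup_N by auto

lemma inv_GN: "g \<in> N \<Longrightarrow> inv\<^bsub>GN\<^esub> g = inv g"
  by (rule m_inv_consistent[OF subgroup_N])

lemma normalizer_GN:
  assumes U: "subgroup U G" "U \<subseteq> N"
  shows "normalizer GN U = N \<inter> normalizer G U"
proof (rule Set.set_eqI)
  fix g
  have "subgroup U GN" using U subgroup_GN by simp
  then have "g \<in> normalizer GN U \<longleftrightarrow> g \<in> N \<and> (\<forall>u\<in>U. g \<otimes> u \<otimes> inv\<^bsub>GN\<^esub> g \<in> U)"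
    using E.normalizer_iff by simp
  also have "\<dots> \<longleftrightarrow> g \<in> N \<inter> normalizer G U"
    using inv_GN subgroup.mem_carrier[OF subgroup_N] unfolding Int_iff normalizer_iff[OF U(1)] by auto
  finally show "g \<in> normalizer GN U \<longleftrightarrow> g \<in> N \<inter> normalizer G U" .
qed

lemma E_Mor_iff:
  "Q \<subseteq> U \<Longrightarrow> \<phi> \<in> Mor E U V \<longleftrightarrow> \<phi> \<in> Mor F U V \<and> U \<subseteq> N \<and> V \<subseteq> N \<and> \<phi> ` Q = Q"
  by (rule normalizer_Mor_above_iff[OF subgroup_Q])

lemma E_Mor: "\<phi> \<in> Mor E U V \<Longrightarrow> \<phi> \<in> Mor F U V" "\<phi> \<in> Mor E U V \<Longrightarrow> U \<subseteq> N" "\<phi> \<in> Mor E U V \<Longrightarrow> V \<subseteq> N"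
  by (simp_all add: normalizer_Mor_iff)

text \<open>
  Being of \<open>p\<close>-power order, \<open>\<alpha>\<close> turns into conjugation by some
  \<open>g\<close> on a fully automised subgroup, under a suitable isomorphism
  \<open>\<omega>\<close>. This \<open>g\<close> centralises \<open>\<omega>(Q)\<close> because
  \<open>\<alpha>\<close> fixes \<open>Q\<close>. As \<open>Q\<close> is centric, \<open>g\<close>
  is in \<open>\<omega>(Q)\<close>, say \<open>g = \<omega>(z)\<close>, and then
  \<open>\<alpha>\<close> is conjugation by \<open>z\<close>.
\<close>
lemma Aut_fixing_is_conj:
  assumes U: "Q \<subseteq> U" "U \<subseteq> N" and \<alpha>: "\<alpha> \<in> Mor F U U" "\<And>q. q \<in> Q \<Longrightarrow> \<alpha> q = q"
  shows "\<exists>z\<in>Q. \<forall>u\<in>U. \<alpha> u = z \<otimes> u \<otimes> inv z"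
proof -
  have sU: "subgroup U G" by (rule Mor_subgroup(1)[OF \<alpha>(1)])
  obtain V where iso: "fusion_iso F U V" and fV: "fully_automised p F V"
    using sat sU unfolding saturated_def grp_F by blast
  obtain \<chi> where \<chi>: "\<chi> \<in> Mor F U V" "\<chi> ` U = V" using iso by (auto simp: fusion_iso_iff)
  have sV: "subgroup V G" by (rule Mor_subgroup(2)[OF \<chi>(1)])
  interpret A: group "Aut_fus F V" by (rule group_Aut[OF sV])
  obtain \<iota> where \<iota>: "\<iota> \<in> Mor F V U" "\<And>x. x \<in> U \<Longrightarrow> \<iota> (\<chi> x) = x" "\<And>y. y \<in> V \<Longrightarrow> \<chi> (\<iota> y) = y"
    using Mor_inverse[OF \<chi>] by metis
  define \<beta> where "\<beta> = (\<lambda>x\<in>V. \<chi> (\<alpha> (\<iota> x)))"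
  have \<beta>: "\<beta> \<in> Mor F V V"
    using Mor_comp[OF Mor_comp[OF \<iota>(1) \<alpha>(1)] \<chi>(1)] Mor_mem[OF \<iota>(1)] by (simp add: \<beta>_def cong: restrict_cong)
  have \<beta>\<chi>: "\<beta> (\<chi> u) = \<chi> (\<alpha> u)" if "u \<in> U" for u
    using that \<iota>(2) Mor_mem[OF \<chi>(1)] by (simp add: \<beta>_def)
  let ?R = "\<chi> ` Q"
  have sR: "subgroup ?R G" by (rule Mor_image_subgroup[OF \<chi>(1) subgroup_Q U(1)])
  have iso_res: "fusion_iso F Q (\<psi> ` Q)" if "\<psi> \<in> Mor F U W" for \<psi> W
    using Mor_restrict[OF that subgroup_Q U(1) Mor_image_subgroup[OF that subgroup_Q U(1)] order_refl]
    unfolding fusion_iso_iff by (intro bexI[of _ "restrict \<psi> Q"]) auto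
  have CR: "centralizer G (\<psi> ` Q) \<subseteq> \<psi> ` Q" if "\<psi> \<in> Mor F U W" for \<psi> W
    by (rule centric_centralizer[OF centric_iso[OF Q_centric iso_res[OF that]]])
  have RV: "?R \<subseteq> V" using \<chi>(2) U(1) by blast
  have VR: "V \<subseteq> normalizer G ?R"
  proof
    fix v assume "v \<in> V"
    then obtain u where u: "u \<in> U" "v = \<chi> u" using \<chi>(2) by blast
    then show "v \<in> normalizer G ?R"
      using Mor_image_normalizer[OF \<chi>(1) subgroup_Q U(1) refl u(1)] U(2) by blast
  qed
  have \<beta>R: "\<beta> q = q" if "q \<in> ?R" for q using that \<beta>\<chi> \<alpha>(2) U(1) by auto
  obtain P n where P: "subgroup P (Aut_fus F V)" "card P = p ^ n" "\<beta> \<in> P"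
    using p_subgroup_of_Aut_fixing[OF sR CR[OF \<chi>(1)] RV VR \<beta> \<beta>R] by blast
  have finA: "finite (carrier (Aut_fus F V))" using finite_Aut[OF sV] by simp
  obtain \<gamma> where \<gamma>: "\<gamma> \<in> carrier (Aut_fus F V)"
    "\<And>x. x \<in> P \<Longrightarrow> \<gamma> \<otimes>\<^bsub>Aut_fus F V\<^esub> x \<otimes>\<^bsub>Aut_fus F V\<^esub> inv\<^bsub>Aut_fus F V\<^esub> \<gamma> \<in> conj_aut G V"
    using A.sylow_conjugacy[OF finA p_prime P(1,2) fV[unfolded fully_automised_sylow]] by blast
  have \<gamma>M: "\<gamma> \<in> Mor F V V" using \<gamma>(1) by simp
  have \<gamma>\<beta>: "\<gamma> \<otimes>\<^bsub>Aut_fus F V\<^esub> \<beta> \<in> Mor F V V" using A.m_closed \<gamma>(1) \<beta> by simp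
  obtain g where g: "g \<in> normalizer G V"
    "\<gamma> \<otimes>\<^bsub>Aut_fus F V\<^esub> \<beta> \<otimes>\<^bsub>Aut_fus F V\<^esub> inv\<^bsub>Aut_fus F V\<^esub> \<gamma> = conj_map G g V"
    using \<gamma>(2)[OF P(3)] by (auto simp: conj_aut_def)
  define \<omega> where "\<omega> = (\<lambda>x\<in>U. \<gamma> (\<chi> x))"
  have \<omega>: "\<omega> \<in> Mor F U V" unfolding \<omega>_def by (rule Mor_comp[OF \<chi>(1) \<gamma>M])
  have gc: "g \<in> carrier G" using g(1) normalizer_iff[OF sV] by blast
  have \<omega>\<alpha>: "\<omega> (\<alpha> u) = g \<otimes> \<omega> u \<otimes> inv g" if u: "u \<in> U" for u
  proof -
    have v: "\<gamma> (\<chi> u) \<in> V" "\<chi> u \<in> V" using Mor_mem[OF \<gamma>M] Mor_mem[OF \<chi>(1) u] by auto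
    have "(\<gamma> \<otimes>\<^bsub>Aut_fus F V\<^esub> \<beta> \<otimes>\<^bsub>Aut_fus F V\<^esub> inv\<^bsub>Aut_fus F V\<^esub> \<gamma>) (\<gamma> (\<chi> u)) = \<gamma> (\<chi> (\<alpha> u))"
      using v \<gamma>\<beta> \<gamma>M \<beta> Aut_inv_closed[OF \<gamma>M] \<beta>\<chi>[OF u] by simp
    then show ?thesis using u v Mor_mem[OF \<alpha>(1) u] unfolding g(2) by (simp add: \<omega>_def)
  qed
  have "g \<in> centralizer G (\<omega> ` Q)"
    unfolding centralizer_iff
  proof (intro conjI ballI gc)
    fix x assume "x \<in> \<omega> ` Q"
    then obtain q where q: "q \<in> Q" "x = \<omega> q" by blast
    then have "g \<otimes> x \<otimes> inv g = x" using \<omega>\<alpha>[of q] \<alpha>(2)[OF q(1)] U(1) by auto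
    then show "g \<otimes> x = x \<otimes> g" using conj_eq_iff[OF gc, of x x] Mor_carrier[OF \<omega>, of q] q U(1) by auto
  qed
  then obtain z where z: "z \<in> Q" "g = \<omega> z" using CR[OF \<omega>] by blast
  have zU: "z \<in> U" using z U(1) by blast
  have "\<alpha> u = z \<otimes> u \<otimes> inv z" if u: "u \<in> U" for u
  proof (rule Mor_inj[OF \<omega>])
    show "\<alpha> u \<in> U" by (rule Mor_mem[OF \<alpha>(1) u])
    show "z \<otimes> u \<otimes> inv z \<in> U" by (rule subgroup_conj_closed[OF sU zU u])
    show "\<omega> (\<alpha> u) = \<omega> (z \<otimes> u \<otimes> inv z)" using \<omega>\<alpha>[OF u] Mor_conj[OF \<omega> zU u] z(2) by simp
  qed
  then show ?thesis using z(1) by blast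
qed

lemma conj_eq_on_Q:
  assumes "a \<in> carrier G" "b \<in> carrier G" "\<And>x. x \<in> Q \<Longrightarrow> a \<otimes> x \<otimes> inv a = b \<otimes> x \<otimes> inv b"
  shows "\<exists>q\<in>Q. a = b \<otimes> q"
proof
  show "inv b \<otimes> a \<in> Q"
    using conj_eq_imp_centralizer[OF subgroup.subset[OF subgroup_Q] assms] centralizer_Q by blast
  show "a = b \<otimes> (inv b \<otimes> a)" using assms by (simp flip: m_assoc)
qed

text \<open>
  Receptivity of \<open>Q\<close> in \<open>F\<close> extends the restriction of
  \<open>\<phi>\<close> to \<open>Q\<close>. As \<open>C\<^sub>S(Q) \<le> Q \<le> V\<close>, it
  maps \<open>U\<close> to \<open>V\<close>; it agrees with \<open>\<phi>\<close> on
  \<open>Q\<close>, so on \<open>U\<close> it differs from \<open>\<phi>\<close> by conjugation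
  with some \<open>z \<in> Q\<close>, which can be undone on the whole control subgroup.
\<close>
lemma E_receptive:
  assumes V: "Q \<subseteq> V"
  shows "receptive E V"
  unfolding receptive_def E.grp_F
proof (intro allI ballI impI)
  fix U \<phi> assume \<phi>E: "\<phi> \<in> Mor E U V" and onto: "\<phi> ` U = V"
  note \<phi> = E_Mor(1)[OF \<phi>E] and UN = E_Mor(2)[OF \<phi>E] and VN = E_Mor(3)[OF \<phi>E]
  note sU = Mor_subgroup(1)[OF \<phi>] and sV = Mor_subgroup(2)[OF \<phi>]
  obtain \<iota> where \<iota>: "\<iota> \<in> Mor E V U" "\<And>x. x \<in> U \<Longrightarrow> \<iota> (\<phi> x) = x" "\<And>y. y \<in> V \<Longrightarrow> \<phi> (\<iota> y) = y"
    using E.Mor_inverse[OF \<phi>E onto] by metis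
  have \<iota>F: "\<iota> \<in> Mor F V U" and \<iota>Q: "\<iota> ` Q = Q" using \<iota>(1) E_Mor_iff[OF V] by blast+
  have "\<iota> ` Q \<subseteq> U" using image_mono[OF V] Mor_image_sub[OF \<iota>F] by (rule order_trans)
  then have QU: "Q \<subseteq> U" unfolding \<iota>Q .
  have \<phi>Q: "\<phi> ` Q = Q" using \<phi>E E_Mor_iff[OF QU] by blast
  let ?D = "ext_control E U V \<phi>"
  have "subgroup ?D GN" by (rule E.subgroup_ext_control[OF \<phi>E onto])
  then have sD: "subgroup ?D G" and DN: "?D \<subseteq> N" using subgroup_GN by auto
  have UD: "U \<subseteq> ?D" by (rule E.subset_ext_control(1)[OF \<phi>E onto])
  have D: "g \<in> N \<inter> normalizer G U \<and> (\<exists>h\<in>N \<inter> normalizer G V. \<forall>u\<in>U. \<phi> (g \<otimes> u \<otimes> inv g) = h \<otimes> \<phi> u \<otimes> inv h)"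
    if g: "g \<in> ?D" for g
  proof -
    have gN: "g \<in> N" using g DN by blast
    obtain h where h: "h \<in> normalizer GN V" "\<forall>u\<in>U. \<phi> (g \<otimes> u \<otimes> inv\<^bsub>GN\<^esub> g) = h \<otimes> \<phi> u \<otimes> inv\<^bsub>GN\<^esub> h"
      and g': "g \<in> normalizer GN U" using g unfolding E.ext_control_iff[OF \<phi>E onto] by auto
    then show ?thesis unfolding normalizer_GN[OF sV VN] normalizer_GN[OF sU UN] using inv_GN gN by auto
  qed
  let ?\<alpha> = "restrict \<phi> Q"
  have \<alpha>: "?\<alpha> \<in> Mor F Q Q" by (rule Mor_restrict[OF \<phi> subgroup_Q QU subgroup_Q]) (simp add: \<phi>Q)
  have \<alpha>Q: "?\<alpha> ` Q = Q" using \<phi>Q by simp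
  have QD: "Q \<subseteq> ?D" using QU UD by blast
  have "\<exists>h\<in>N. \<forall>u\<in>Q. ?\<alpha> (g \<otimes> u \<otimes> inv g) = h \<otimes> ?\<alpha> u \<otimes> inv h" if g: "g \<in> ?D" for g
  proof -
    obtain h where h: "h \<in> N" "\<forall>u\<in>U. \<phi> (g \<otimes> u \<otimes> inv g) = h \<otimes> \<phi> u \<otimes> inv h" using D[OF g] by blast
    have "?\<alpha> (g \<otimes> u \<otimes> inv g) = h \<otimes> ?\<alpha> u \<otimes> inv h" if "u \<in> Q" for u
      using h(2) that QU normalizer_conj(1)[OF subgroup_Q, of g u] g DN by auto
    then show ?thesis using h(1) by blast
  qed
  then obtain \<psi> where \<psi>: "\<psi> \<in> Mor F ?D (carrier G)" "\<And>u. u \<in> Q \<Longrightarrow> \<psi> u = ?\<alpha> u"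
    using receptive_extends[OF receptive_Q \<alpha> \<alpha>Q sD QD DN] by blast
  have \<psi>\<phi>: "\<psi> q = \<phi> q" if "q \<in> Q" for q using \<psi>(2)[OF that] that by simp
  have \<psi>V: "\<psi> u \<in> V" if u: "u \<in> U" for u
  proof -
    have uD: "u \<in> ?D" using u UD by blast
    have uN: "u \<in> N" using u UN by blast
    have "\<psi> u \<otimes> x \<otimes> inv (\<psi> u) = \<phi> u \<otimes> x \<otimes> inv (\<phi> u)" if x: "x \<in> Q" for x
    proof -
      obtain q where q: "q \<in> Q" "x = \<phi> q" using \<phi>Q x by blast
      have uq: "u \<otimes> q \<otimes> inv u \<in> Q" by (rule normalizer_conj(1)[OF subgroup_Q uN q(1)])
      have "\<psi> u \<otimes> x \<otimes> inv (\<psi> u) = \<psi> (u \<otimes> q \<otimes> inv u)"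
        using Mor_conj[OF \<psi>(1) uD, of q] QD q \<psi>\<phi> by auto
      also have "\<dots> = \<phi> (u \<otimes> q \<otimes> inv u)" by (rule \<psi>\<phi>[OF uq])
      also have "\<dots> = \<phi> u \<otimes> x \<otimes> inv (\<phi> u)" using Mor_conj[OF \<phi> u, of q] QU q by auto
      finally show ?thesis .
    qed
    then obtain q where "q \<in> Q" "\<psi> u = \<phi> u \<otimes> q"
      using conj_eq_on_Q[OF Mor_carrier[OF \<psi>(1) uD] Mor_carrier[OF \<phi> u]] by blast
    then show ?thesis using subgroup.m_closed[OF sV Mor_mem[OF \<phi> u]] V by auto
  qed
  have \<psi>r: "restrict \<psi> U \<in> Mor F U V" by (rule Mor_restrict[OF \<psi>(1) sU UD sV]) (use \<psi>V in blast)
  define \<delta> where "\<delta> = (\<lambda>x\<in>V. \<psi> (\<iota> x))"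
  have \<iota>U: "\<iota> x \<in> U" if "x \<in> V" for x using Mor_mem[OF \<iota>F that] .
  have \<delta>: "\<delta> \<in> Mor F V V" using Mor_comp[OF \<iota>F \<psi>r] \<iota>U by (simp add: \<delta>_def cong: restrict_cong)
  have \<delta>Q: "\<delta> q = q" if q: "q \<in> Q" for q
  proof -
    have "\<iota> q \<in> Q" using \<iota>Q q by blast
    then show ?thesis using \<psi>\<phi> \<iota>(3)[of q] q V by (auto simp: \<delta>_def)
  qed
  obtain z where z: "z \<in> Q" "\<forall>u\<in>V. \<delta> u = z \<otimes> u \<otimes> inv z"
    using Aut_fixing_is_conj[OF V VN \<delta> \<delta>Q] by blast
  have zc: "z \<in> carrier G" using subgroup.mem_carrier[OF subgroup_Q z(1)] .
  have \<psi>z: "\<psi> u = z \<otimes> \<phi> u \<otimes> inv z" if u: "u \<in> U" for u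
  proof -
    have "\<delta> (\<phi> u) = \<psi> u" using \<iota>(2)[OF u] Mor_mem[OF \<phi> u] by (simp add: \<delta>_def)
    then show ?thesis using z(2) Mor_mem[OF \<phi> u] by simp
  qed
  have cz: "conj_map G (inv z) (carrier G) \<in> Mor F (carrier G) (carrier G)"
    by (rule Mor_conj_map[OF subgroup_self subgroup_self]) (use zc in auto)
  define \<theta> where "\<theta> = (\<lambda>x\<in>?D. conj_map G (inv z) (carrier G) (\<psi> x))"
  have \<theta>: "\<theta> \<in> Mor F ?D (carrier G)" unfolding \<theta>_def by (rule Mor_comp[OF \<psi>(1) cz])
  have \<theta>\<phi>: "\<theta> u = \<phi> u" if u: "u \<in> U" for u
    using u UD \<psi>z[OF u] Mor_carrier[OF \<phi> u] Mor_carrier[OF \<psi>(1), of u] zc by (auto simp: \<theta>_def)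
  have "\<theta> ` Q = \<phi> ` Q" by (rule image_cong) (use \<theta>\<phi> QU in auto)
  then have \<theta>Q: "\<theta> ` Q = Q" using \<phi>Q by (rule trans)
  have "\<theta> d \<in> N" if "d \<in> ?D" for d
    by (rule Mor_image_normalizer[OF \<theta> subgroup_Q QD \<theta>Q that]) (use that DN in blast)
  then have "\<theta> \<in> Mor F ?D N" by (intro Mor_codomain[OF \<theta> subgroup_N]) blast
  then have "\<theta> \<in> Mor E ?D N" using \<theta>Q DN unfolding E_Mor_iff[OF QD] by blast
  moreover have "restrict \<theta> U = \<phi>"
    by (rule extensionalityI[OF _ Mor_props(1)[OF \<phi>]]) (use \<theta>\<phi> in auto)
  ultimately show "\<exists>\<psi>\<in>Mor E ?D (carrier GN). restrict \<psi> U = \<phi>" by auto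
qed

text \<open>
  It suffices that \<open>Aut\<^sub>N(V)\<close> is a maximal \<open>p\<close>-subgroup of
  \<open>Aut\<^sub>E(V)\<close>. Let \<open>Y\<close> be a \<open>p\<close>-subgroup containing
  it. Some \<open>\<gamma> \<in> Aut\<^sub>F(Q)\<close> conjugates the restrictions to
  \<open>Q\<close> of the elements of \<open>Y\<close> into \<open>Aut\<^sub>S(Q)\<close>, hence
  \<open>\<gamma>\<close> extends to a morphism \<open>\<psi>\<close> on
  \<open>N\<^sub>N(V)\<close>. Because \<open>V\<close> is fully normalised in \<open>E\<close>,
  the image of \<open>\<psi>\<close> is the whole normaliser of \<open>\<psi>(V)\<close> in
  \<open>N\<close>. For \<open>y \<in> Y\<close>, the restriction of \<open>\<gamma> y
  \<gamma>\<^sup>-\<^sup>1\<close> to \<open>Q\<close> is conjugation by some \<open>g\<close>,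
  which normalises \<open>\<psi>(V)\<close> and is therefore \<open>\<psi>(h)\<close> with
  \<open>h \<in> N\<^sub>N(V)\<close>. So \<open>y\<close> agrees on \<open>Q\<close> with
  conjugation by \<open>h\<close>, and on \<open>V\<close> with conjugation by \<open>h z\<close>
  for some \<open>z \<in> Q\<close>.
\<close>
lemma E_fully_automised:
  assumes V: "fully_normalised E V" "Q \<subseteq> V"
  shows "fully_automised p E V"
proof -
  let ?B = "Aut_fus F Q"
  have "subgroup V GN" using V(1) by (simp add: fully_normalised_def)
  then have sV: "subgroup V G" and VN: "V \<subseteq> N" and sVE: "subgroup V GN" using subgroup_GN by auto
  interpret A: group "Aut_fus E V" by (rule E.group_Aut[OF sVE])
  interpret B: group "?B" by (rule group_Aut[OF subgroup_Q])
  have finA: "finite (carrier (Aut_fus E V))" using E.finite_Aut[OF sVE] by simp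
  have finB: "finite (carrier (?B))" using finite_Aut[OF subgroup_Q] by simp
  obtain k where k: "card (conj_aut GN V) = p ^ k" using E.p_group_conj_aut(2)[OF sVE] by blast
  let ?M = "N \<inter> normalizer G V"
  have NV: "normalizer GN V = ?M" by (rule normalizer_GN[OF sV VN])
  have sM: "subgroup ?M G" 
    by (rule subgroups_Inter_pair[OF subgroup_N subgroup_normalizer[OF subgroup.subset[OF sV]]])
  have QM: "Q \<subseteq> ?M" using V(2) Q_subset_N subset_normalizer[OF sV] by blast
  have QM': "q \<in> ?M" if "q \<in> Q" for q using that QM by (rule subsetD[rotated])
  have VM: "V \<subseteq> ?M" using VN subset_normalizer[OF sV] by blast
  have "sylow_subgroup p (Aut_fus E V) (conj_aut GN V)"
  proof (rule A.sylow_subgroup_of_maximal[OF finA p_prime E.p_group_conj_aut(1)[OF sVE] k])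
    fix Y m assume Y: "subgroup Y (Aut_fus E V)" "card Y = p ^ m" "conj_aut GN V \<subseteq> Y"
    have YE: "y \<in> Mor E V V" if "y \<in> Y" for y using subgroup.mem_carrier[OF Y(1) that] by simp
    have YF: "y \<in> Mor F V V" "y ` Q = Q" if "y \<in> Y" for y using YE[OF that] E_Mor_iff[OF V(2)] by blast+
    have res: "restrict y Q \<in> Mor F Q Q" if "y \<in> Mor E V V" for y
    proof -
      have y: "y \<in> Mor F V V" "y ` Q = Q" using that E_Mor_iff[OF V(2)] by simp_all
      show ?thesis by (rule Mor_restrict[OF y(1) subgroup_Q V(2) subgroup_Q]) (simp add: y(2))
    qed
    have hom: "(\<lambda>y. restrict y Q) \<in> hom ((Aut_fus E V)\<lparr>carrier := Y\<rparr>) (?B)"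
    proof (rule homI)
      fix x y assume "x \<in> carrier ((Aut_fus E V)\<lparr>carrier := Y\<rparr>)" "y \<in> carrier ((Aut_fus E V)\<lparr>carrier := Y\<rparr>)"
      then have xy: "x \<in> Mor E V V" "y \<in> Mor E V V" using YE by auto
      have "y ` Q = Q" using xy(2) E_Mor_iff[OF V(2)] by simp
      then have yQ: "y q \<in> Q" if "q \<in> Q" for q using that by blast
      have "restrict (x \<otimes>\<^bsub>Aut_fus E V\<^esub> y) Q = restrict x Q \<otimes>\<^bsub>?B\<^esub> restrict y Q"
        unfolding Aut_mult[OF res[OF xy(1)] res[OF xy(2)]] E.Aut_mult[OF xy]
        by (rule restrict_ext) (use yQ V(2) in auto)
      then show "restrict (x \<otimes>\<^bsub>(Aut_fus E V)\<lparr>carrier := Y\<rparr>\<^esub> y) Q = restrict x Q \<otimes>\<^bsub>?B\<^esub> restrict y Q"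
        by simp
    qed (use res YE in auto)
    let ?Y = "(\<lambda>y. restrict y Q) ` Y"
    have sY: "subgroup ?Y (?B)" and "\<exists>m. card ?Y = p ^ m"
      using A.p_power_card_hom_image[OF p_prime Y(1,2) B.is_group hom] by blast+
    then obtain m' where m': "card ?Y = p ^ m'" by blast
    obtain \<gamma> where \<gamma>: "\<gamma> \<in> carrier (?B)"
      "\<And>x. x \<in> ?Y \<Longrightarrow> \<gamma> \<otimes>\<^bsub>?B\<^esub> x \<otimes>\<^bsub>?B\<^esub> inv\<^bsub>?B\<^esub> \<gamma> \<in> conj_aut G Q"
      using B.sylow_conjugacy[OF finB p_prime sY m' fully_automised_Q[unfolded fully_automised_sylow]] by blast
    have \<gamma>M: "\<gamma> \<in> Mor F Q Q" using \<gamma>(1) by simp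
    have \<gamma>Q: "\<gamma> q \<in> Q" if "q \<in> Q" for q using Mor_mem[OF \<gamma>M that] .
    have \<gamma>Y: "\<exists>g\<in>N. \<forall>q\<in>Q. \<gamma> (y q) = g \<otimes> \<gamma> q \<otimes> inv g" if y: "y \<in> Y" for y
    proof -
      let ?y = "restrict y Q"
      have yM: "?y \<in> Mor F Q Q" using res YE[OF y] by blast
      have yi: "?y \<in> ?Y" using y by blast
      obtain g where g: "g \<in> N" "\<gamma> \<otimes>\<^bsub>?B\<^esub> ?y \<otimes>\<^bsub>?B\<^esub> inv\<^bsub>?B\<^esub> \<gamma> = conj_map G g Q"
        using \<gamma>(2)[OF yi] by (auto simp: conj_aut_def)
      have gy: "\<gamma> \<otimes>\<^bsub>?B\<^esub> ?y \<in> Mor F Q Q" using B.m_closed \<gamma>(1) yM by simp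
      have "\<gamma> (y q) = g \<otimes> \<gamma> q \<otimes> inv g" if q: "q \<in> Q" for q
      proof -
        have "(\<gamma> \<otimes>\<^bsub>?B\<^esub> ?y \<otimes>\<^bsub>?B\<^esub> inv\<^bsub>?B\<^esub> \<gamma>) (\<gamma> q) = \<gamma> (?y q)"
          using \<gamma>Q[OF q] q gy yM \<gamma>M Aut_inv_closed[OF \<gamma>M] by (simp del: restrict_apply)
        then show ?thesis using q \<gamma>Q[OF q] unfolding g(2) by simp
      qed
      then show ?thesis using g(1) by blast
    qed
    have conjY: "conj_map G g V \<in> Y" if g: "g \<in> ?M" for g
    proof -
      have "conj_map GN g V = conj_map G g V" using inv_GN g by (simp add: conj_map_def)
      moreover have "conj_map GN g V \<in> conj_aut GN V" using g NV by (auto simp: conj_aut_def)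
      ultimately show ?thesis using Y(3) by auto
    qed
    have "\<exists>h\<in>N. \<forall>q\<in>Q. \<gamma> (g \<otimes> q \<otimes> inv g) = h \<otimes> \<gamma> q \<otimes> inv h" if g: "g \<in> ?M" for g
    proof -
      obtain h where "h \<in> N" "\<forall>q\<in>Q. \<gamma> (conj_map G g V q) = h \<otimes> \<gamma> q \<otimes> inv h"
        using \<gamma>Y[OF conjY[OF g]] by blast
      moreover have "conj_map G g V q = g \<otimes> q \<otimes> inv g" if "q \<in> Q" for q using that V(2) by auto
      ultimately show ?thesis by auto
    qed
    then obtain \<psi> where \<psi>: "\<psi> \<in> Mor F ?M (carrier G)" "\<And>q. q \<in> Q \<Longrightarrow> \<psi> q = \<gamma> q"
      using receptive_extends[OF receptive_Q \<gamma>M Mor_endo_onto[OF \<gamma>M] sM QM] by blast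
    have "\<psi> ` Q = \<gamma> ` Q" by (rule image_cong[OF refl \<psi>(2)])
    then have \<psi>Q: "\<psi> ` Q = Q" using Mor_endo_onto[OF \<gamma>M] by (rule trans)
    let ?V = "\<psi> ` V"
    have sV': "subgroup ?V G" by (rule Mor_image_subgroup[OF \<psi>(1) sV VM])
    have \<psi>N: "\<psi> h \<in> N" if "h \<in> ?M" for h
      by (rule Mor_image_normalizer[OF \<psi>(1) subgroup_Q QM \<psi>Q that]) (use that in blast)
    have \<psi>NV: "\<psi> h \<in> normalizer G ?V" if "h \<in> ?M" for h
      by (rule Mor_image_normalizer[OF \<psi>(1) sV VM refl that]) (use that in blast)
    have V'N: "?V \<subseteq> N" using \<psi>N VM by blast
    have QV': "Q \<subseteq> ?V" using image_mono[OF V(2), of \<psi>] \<psi>Q by simp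
    have "restrict \<psi> V \<in> Mor F V ?V" by (rule Mor_restrict[OF \<psi>(1) sV VM sV' order_refl])
    moreover have "restrict \<psi> V ` Q = Q"
    proof -
      have "restrict \<psi> V ` Q = \<psi> ` Q" by (rule image_cong) (use V(2) in auto)
      then show ?thesis using \<psi>Q by simp
    qed
    ultimately have "restrict \<psi> V \<in> Mor E V ?V" unfolding E_Mor_iff[OF V(2)] using VN V'N by blast
    then have "fusion_iso E V ?V" unfolding E.fusion_iso_iff by (intro bexI[of _ "restrict \<psi> V"]) auto
    then have "card (normalizer GN ?V) \<le> card (normalizer GN V)"
      using V(1) by (simp add: fully_normalised_def)
    then have le: "card (N \<inter> normalizer G ?V) \<le> card ?M"
      unfolding normalizer_GN[OF sV' V'N] NV .
    have onto: "\<psi> ` ?M = N \<inter> normalizer G ?V"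
    proof (rule card_seteq)
      show "finite (N \<inter> normalizer G ?V)" using finite_subgroup[OF subgroup_N] by blast
      show "\<psi> ` ?M \<subseteq> N \<inter> normalizer G ?V" using \<psi>N \<psi>NV by blast
      show "card (N \<inter> normalizer G ?V) \<le> card (\<psi> ` ?M)" using le Mor_card[OF \<psi>(1) order_refl] by simp
    qed
    show "Y \<subseteq> conj_aut GN V"
    proof
      fix y assume y: "y \<in> Y"
      obtain g where g: "g \<in> N" and gy: "\<And>q. q \<in> Q \<Longrightarrow> \<gamma> (y q) = g \<otimes> \<gamma> q \<otimes> inv g"
        using \<gamma>Y[OF y] by blast
      have gc: "g \<in> carrier G" using subgroup.mem_carrier[OF subgroup_N g] .
      note yF = YF(1)[OF y]
      have yQ: "y q \<in> Q" if "q \<in> Q" for q using YF(2)[OF y] that by blast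
      have "g \<otimes> w \<otimes> inv g \<in> ?V" if w: "w \<in> ?V" for w
      proof -
        obtain v where v: "v \<in> V" "w = \<psi> v" using w by blast
        have vM: "v \<in> ?M" "y v \<in> ?M" using v(1) Mor_mem[OF yF v(1)] VM by auto
        have yv: "\<psi> (y v) \<in> ?V" using Mor_mem[OF yF v(1)] by blast
        have c: "w \<in> carrier G" "\<psi> (y v) \<in> carrier G"
          using Mor_carrier[OF \<psi>(1) vM(1)] Mor_carrier[OF \<psi>(1) vM(2)] v(2) by auto
        have "(g \<otimes> w \<otimes> inv g) \<otimes> x \<otimes> inv (g \<otimes> w \<otimes> inv g) = \<psi> (y v) \<otimes> x \<otimes> inv (\<psi> (y v))"
          if x: "x \<in> Q" for x
        proof -
          \<comment> \<open>Every element of \<open>Q\<close> has the form \<open>\<gamma>(y(q))\<close>, on which conjugation by \<open>g\<close> is known through \<open>\<gamma> y \<gamma>\<^sup>-\<^sup>1\<close>.\<close>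
          obtain r where r: "r \<in> Q" "x = \<gamma> r" using x Mor_endo_onto[OF \<gamma>M] by blast
          obtain q where q: "q \<in> Q" "r = y q" using r(1) YF(2)[OF y] by blast
          have qc: "\<gamma> q \<in> carrier G" using \<gamma>Q[OF q(1)] subgroup.mem_carrier[OF subgroup_Q] by blast
          have vq: "v \<otimes> q \<otimes> inv v \<in> Q" using normalizer_conj(1)[OF subgroup_Q _ q(1)] v(1) VN by blast
          have yvq: "y v \<otimes> y q \<otimes> inv (y v) \<in> Q"
            using normalizer_conj(1)[OF subgroup_Q _ yQ[OF q(1)]] Mor_mem[OF yF v(1)] VN by blast
          have xg: "x = g \<otimes> \<gamma> q \<otimes> inv g" using gy[OF q(1)] r(2) q(2) by simp
          have "(g \<otimes> w \<otimes> inv g) \<otimes> x \<otimes> inv (g \<otimes> w \<otimes> inv g) = g \<otimes> (w \<otimes> \<gamma> q \<otimes> inv w) \<otimes> inv g"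
            unfolding xg using conj_conj[of "g \<otimes> w \<otimes> inv g" g "\<gamma> q"] conj_conj[of g w "\<gamma> q"] gc c(1) qc
            by (simp add: m_assoc)
          also have "w \<otimes> \<gamma> q \<otimes> inv w = \<gamma> (v \<otimes> q \<otimes> inv v)"
            using Mor_conj[OF \<psi>(1) vM(1) QM'[OF q(1)]] \<psi>(2)[OF q(1)] \<psi>(2)[OF vq] v(2) by simp
          also have "g \<otimes> \<gamma> (v \<otimes> q \<otimes> inv v) \<otimes> inv g = \<gamma> (y (v \<otimes> q \<otimes> inv v))" using gy[OF vq] by simp
          also have "y (v \<otimes> q \<otimes> inv v) = y v \<otimes> y q \<otimes> inv (y v)"
            using Mor_conj[OF yF v(1), of q] q(1) V(2) by auto
          also have "\<gamma> (y v \<otimes> y q \<otimes> inv (y v)) = \<psi> (y v) \<otimes> x \<otimes> inv (\<psi> (y v))"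
            using Mor_conj[OF \<psi>(1) vM(2) QM'[OF yQ[OF q(1)]]] \<psi>(2)[OF yQ[OF q(1)]] \<psi>(2)[OF yvq] r(2) q(2) by simp
          finally show ?thesis .
        qed
        then obtain q where "q \<in> Q" "g \<otimes> w \<otimes> inv g = \<psi> (y v) \<otimes> q"
          using conj_eq_on_Q[of "g \<otimes> w \<otimes> inv g" "\<psi> (y v)"] gc c by auto
        then show ?thesis using subgroup.m_closed[OF sV' yv] QV' by auto
      qed
      then have "g \<in> N \<inter> normalizer G ?V" using g gc normalizer_iff[OF sV'] by blast
      then obtain h where h: "h \<in> ?M" "g = \<psi> h" using onto by blast
      have hc: "h \<in> carrier G" using subgroup.mem_carrier[OF sM h(1)] .
      have hV: "h \<otimes> v \<otimes> inv h \<in> V" "inv h \<otimes> v \<otimes> h \<in> V" if "v \<in> V" for v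
        using normalizer_conj[OF sV _ that] h(1) by blast+
      have yh: "y q = h \<otimes> q \<otimes> inv h" if q: "q \<in> Q" for q
      proof (rule Mor_inj[OF \<gamma>M yQ[OF q]])
        show hq: "h \<otimes> q \<otimes> inv h \<in> Q" using normalizer_conj(1)[OF subgroup_Q _ q] h(1) by blast
        show "\<gamma> (y q) = \<gamma> (h \<otimes> q \<otimes> inv h)"
          using gy[OF q] Mor_conj[OF \<psi>(1) h(1) QM'[OF q]] \<psi>(2)[OF q] \<psi>(2)[OF hq] h(2) by simp
      qed
      define \<alpha> where "\<alpha> = (\<lambda>x\<in>V. conj_map G (inv h) V (y x))"
      have ch: "conj_map G (inv h) V \<in> Mor F V V"
        by (rule Mor_conj_map[OF sV sV]) (use hc hV(2) in auto)
      have \<alpha>: "\<alpha> \<in> Mor F V V" unfolding \<alpha>_def by (rule Mor_comp[OF yF ch])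
      have \<alpha>y: "\<alpha> v = inv h \<otimes> y v \<otimes> h" if "v \<in> V" for v
        using that Mor_mem[OF yF that] hc by (simp add: \<alpha>_def)
      have "\<alpha> q = q" if q: "q \<in> Q" for q
        using \<alpha>y[of q] yh[OF q] q V(2) hc subgroup.mem_carrier[OF subgroup_Q q] by auto
      then obtain z where z: "z \<in> Q" "\<forall>u\<in>V. \<alpha> u = z \<otimes> u \<otimes> inv z"
        using Aut_fixing_is_conj[OF V(2) VN \<alpha>] by blast
      have zc: "z \<in> carrier G" using subgroup.mem_carrier[OF subgroup_Q z(1)] .
      have hz: "h \<otimes> z \<in> ?M" using subgroup.m_closed[OF sM h(1)] z(1) QM by blast
      have "y v = (h \<otimes> z) \<otimes> v \<otimes> inv (h \<otimes> z)" if v: "v \<in> V" for v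
      proof -
        have c: "v \<in> carrier G" "y v \<in> carrier G" using subgroup.mem_carrier[OF sV v] Mor_carrier[OF yF v] by auto
        have "y v = h \<otimes> (inv h \<otimes> y v \<otimes> h) \<otimes> inv h" using hc c by simp
        also have "inv h \<otimes> y v \<otimes> h = z \<otimes> v \<otimes> inv z" using \<alpha>y[OF v] z(2) v by simp
        also have "h \<otimes> (z \<otimes> v \<otimes> inv z) \<otimes> inv h = (h \<otimes> z) \<otimes> v \<otimes> inv (h \<otimes> z)"
          by (rule conj_conj[OF hc zc c(1)])
        finally show ?thesis .
      qed
      moreover have "inv\<^bsub>GN\<^esub> (h \<otimes> z) = inv (h \<otimes> z)" using inv_GN hz by blast
      ultimately show "y \<in> conj_aut GN V"
        unfolding E.conj_aut_iff[OF YE[OF y]] NV by (intro bexI[OF _ hz]) simp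
    qed
  qed
  then show ?thesis by (simp add: E.fully_automised_sylow)
qed

lemma E_saturated_above:
  assumes U: "subgroup U GN" "Q \<subseteq> U"
  shows "\<exists>V. fusion_iso E U V \<and> fully_automised p E V \<and> receptive E V"
proof -
  have "\<exists>V. fusion_iso E U V \<and> (\<forall>W. fusion_iso E U W \<longrightarrow> card (normalizer GN W) \<le> card (normalizer GN V))"
  proof (rule Lattices_Big.ex_has_greatest_nat[of "fusion_iso E U" U])
    show "fusion_iso E U U" by (rule E.fusion_iso_refl[OF U(1)])
    have "card (normalizer GN W) \<le> card (carrier GN)" if "fusion_iso E U W" for W
    proof -
      have "subgroup W GN" using that E.Mor_subgroup(2) by (auto simp: E.fusion_iso_iff)
      then have "subgroup (normalizer GN W) GN" by (intro E.subgroup_normalizer subgroup.subset)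
      then show ?thesis by (intro card_mono[OF E.finite_G subgroup.subset])
    qed
    then show "\<forall>W. fusion_iso E U W \<longrightarrow> card (normalizer GN W) < Suc (card (carrier GN))"
      by (simp add: less_Suc_eq_le)
  qed
  then obtain V where iso: "fusion_iso E U V"
    and max: "\<And>W. fusion_iso E U W \<Longrightarrow> card (normalizer GN W) \<le> card (normalizer GN V)" by blast
  obtain \<phi> where \<phi>: "\<phi> \<in> Mor E U V" "\<phi> ` U = V" using iso by (auto simp: E.fusion_iso_iff)
  have "\<phi> ` Q = Q" using \<phi>(1) E_Mor_iff[OF U(2)] by blast
  then have QV: "Q \<subseteq> V" using image_mono[OF U(2), of \<phi>] \<phi>(2) by simp
  have "fully_normalised E V"
    unfolding fully_normalised_def E.grp_F
    using E.Mor_subgroup(2)[OF \<phi>(1)] max E.fusion_iso_trans[OF iso] by blast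
  then show ?thesis using iso E_fully_automised E_receptive QV by blast
qed

end

section \<open>Local rank\<close>

lemma Max_image_eq_iff:
  assumes "finite A" "A \<noteq> {}"
  shows "Max (f ` A) = m \<longleftrightarrow> (\<exists>x\<in>A. f x = m) \<and> (\<forall>x\<in>A. f x \<le> m)"
  using Max_eq_iff[of "f ` A" m] assms by auto

context fusion_sys
begin

lemma group_Out: "subgroup U G \<Longrightarrow> group (Out_fus F U)"
  unfolding Out_fus_def grp_F by (rule normal.factorgroup_is_group[OF normal_inner_aut(1)])

lemma finite_Out: "subgroup U G \<Longrightarrow> finite (carrier (Out_fus F U))"
  unfolding Out_fus_def grp_F carrier_FactGroup using finite_Aut by simp

lemma essentials_subset_fcr: "essentials p F \<subseteq> fcr p F"
proof
  fix V assume V: "V \<in> essentials p F"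
  then obtain H where fn: "fully_normalised F V" and "centric F V" and H: "strongly_embedded p (Out_fus F V) H"
    by (auto simp: essentials_def)
  then have sV: "subgroup V G" by (simp add: fully_normalised_def)
  have "p_core p (Out_fus F V) = {\<one>\<^bsub>Out_fus F V\<^esub>}"
    by (rule group.strongly_embedded_imp_p_core_trivial[OF group_Out[OF sV] finite_Out[OF sV] p_prime H])
  then show "V \<in> fcr p F" using fn \<open>centric F V\<close> sV by (simp add: fcr_def radical_def)
qed

lemma fcrD:
  assumes "R \<in> fcr p F"
  shows "subgroup R G" "radical p F R" "centralizer G R \<subseteq> R" "centric F R" "fully_normalised F R" "fus_core F \<subseteq> R"
  using assms centric_centralizer fus_core_subset_radical[of R] by (auto simp: fcr_def centric_def)

lemma fusion_iso_carrier:
  assumes "fusion_iso F (carrier G) V" shows "V = carrier G"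
proof -
  obtain \<phi> where \<phi>: "\<phi> \<in> Mor F (carrier G) V" "\<phi> ` carrier G = V" using assms by (auto simp: fusion_iso_iff)
  then have "card V = card (carrier G)" using Mor_card[OF \<phi>(1) order_refl] by simp
  then show ?thesis using Mor_sub(2)[OF \<phi>(1)] card_subset_eq[OF finite_G] by blast
qed

lemma normalizer_carrier: "normalizer G (carrier G) = carrier G"
  using normalizer_iff[OF subgroup_self] by auto

text \<open>
  A Sylow subgroup of the automorphism group is \<open>Aut\<^sub>S(S) = Inn(S)\<close>, where
  \<open>S\<close> is the carrier.
\<close>
lemma Out_carrier_p':
  assumes fa: "fully_automised p F (carrier G)"
  shows "\<not> p dvd order (Out_fus F (carrier G))"
proof
  interpret A: group "Aut_fus F (carrier G)" by (rule group_Aut[OF subgroup_self])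
  have N: "normal (inner_aut G (carrier G)) (Aut_fus F (carrier G))" by (rule normal_inner_aut(1)[OF subgroup_self])
  have "inner_aut G (carrier G) = conj_aut G (carrier G)"
    unfolding inner_aut_image conj_aut_image normalizer_carrier ..
  then have c: "card (inner_aut G (carrier G)) = p ^ multiplicity p (order (Aut_fus F (carrier G)))"
    using fa by (simp add: fully_automised_sylow sylow_subgroup_def)
  have lag: "order (Out_fus F (carrier G)) * card (inner_aut G (carrier G)) = order (Aut_fus F (carrier G))"
    using A.lagrange[OF normal_imp_subgroup[OF N]] by (simp add: Out_fus_def FactGroup_def order_def)
  have o: "order (Aut_fus F (carrier G)) \<noteq> 0"
    using A.order_gt_0_iff_finite finite_Aut[OF subgroup_self] by simp
  assume "p dvd order (Out_fus F (carrier G))"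
  then have "p ^ Suc (multiplicity p (order (Aut_fus F (carrier G)))) dvd order (Aut_fus F (carrier G))"
    using lag c by (metis mult_dvd_mono dvd_refl power_Suc)
  then have "Suc (multiplicity p (order (Aut_fus F (carrier G)))) \<le> multiplicity p (order (Aut_fus F (carrier G)))"
    by (intro multiplicity_geI) (use o p_prime in \<open>auto dest: not_prime_unit\<close>)
  then show False by simp
qed

lemma carrier_fcr_not_essential:
  assumes fa: "fully_automised p F (carrier G)"
  shows "carrier G \<in> fcr p F" "carrier G \<notin> essentials p F"
proof -
  note S = subgroup_self
  have "fully_normalised F (carrier G)"
    unfolding fully_normalised_def grp_F using S fusion_iso_carrier by blast
  moreover have "centric F (carrier G)"
    by (rule centricI[OF S]) (use fusion_iso_carrier in \<open>auto simp: centralizer_def\<close>)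
  moreover have "radical p F (carrier G)"
    unfolding radical_def using S group.p_core_trivial_p'[OF group_Out[OF S] Out_carrier_p'[OF fa]] by simp
  ultimately show "carrier G \<in> fcr p F" by (simp add: fcr_def)
  show "carrier G \<notin> essentials p F"
    using group.not_strongly_embedded_p'[OF group_Out[OF S] finite_Out[OF S] Out_carrier_p'[OF fa]]
    by (simp add: essentials_def)
qed

lemma finite_fcr: "finite (fcr p F)"
proof (rule finite_subset)
  show "fcr p F \<subseteq> Pow (carrier G)" using fcrD(1) subgroup.subset by blast
qed (simp add: finite_G)

lemma local_rank_zero_iff: "local_rank p F = 0 \<longleftrightarrow> fus_core F = carrier G"
  using fusion by (simp add: local_rank.simps[of p F])

lemma local_rank_step:
  "fus_core F \<noteq> carrier G \<Longrightarrow>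
    local_rank p F = 1 + (MAX R \<in> {R \<in> fcr p F. fus_core F \<subset> R}. local_rank p (normalizer_fus F R))"
  using fusion by (simp add: local_rank.simps[of p F])

text \<open>
  The core of the normaliser of \<open>R\<close> is \<open>R\<close>, and \<open>R\<close> is its
  own normaliser only if it is the whole group.
\<close>
lemma local_rank_normalizer_zero_iff:
  assumes R: "R \<in> fcr p F"
  shows "local_rank p (normalizer_fus F R) = 0 \<longleftrightarrow> R = carrier G"
proof -
  note sR = fcrD(1)[OF R]
  interpret E: fusion_sys "G\<lparr>carrier := normalizer G R\<rparr>" p "normalizer_fus F R" by (rule fusion_sys_normalizer[OF sR])
  have "local_rank p (normalizer_fus F R) = 0 \<longleftrightarrow> R = normalizer G R"
    unfolding E.local_rank_zero_iff fus_core_normalizer[OF fcrD(2,3)[OF R]] by simp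
  also have "\<dots> \<longleftrightarrow> R = carrier G" using normalizer_grows[OF sR] normalizer_carrier by auto
  finally show ?thesis .
qed

lemma local_rank_one_iff:
  assumes core: "fus_core F \<noteq> carrier G" and S: "carrier G \<in> fcr p F"
  shows "local_rank p F = 1 \<longleftrightarrow> (\<forall>R\<in>fcr p F. fus_core F \<subset> R \<longrightarrow> R = carrier G)"
proof -
  let ?X = "{R \<in> fcr p F. fus_core F \<subset> R}"
  have "finite ?X" "?X \<noteq> {}" using finite_fcr S fcrD(6)[OF S] core by auto
  then have "local_rank p F = 1 \<longleftrightarrow> (\<forall>R\<in>?X. local_rank p (normalizer_fus F R) = 0)"
    unfolding local_rank_step[OF core]
    using Max_image_eq_iff[of ?X "\<lambda>R. local_rank p (normalizer_fus F R)" 0] by auto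
  then show ?thesis using local_rank_normalizer_zero_iff by auto
qed

text \<open>
  All members of \<open>fcr p F\<close> contain the core, and the whole group contributes local
  rank \<open>0\<close> to the maximum, while each other member contributes a positive one.
\<close>
lemma local_rank_two_iff:
  assumes core: "fus_core F \<noteq> carrier G" and S: "carrier G \<in> fcr p F"
  shows "local_rank p F = 2 \<longleftrightarrow> (\<exists>R\<in>fcr p F. R \<noteq> carrier G \<and> R \<noteq> fus_core F) \<and>
    (\<forall>R\<in>fcr p F. R \<noteq> carrier G \<and> R \<noteq> fus_core F \<longrightarrow> local_rank p (normalizer_fus F R) = 1)"
proof -
  define X where "X = {R \<in> fcr p F. fus_core F \<subset> R}"
  define r where "r = (\<lambda>R. local_rank p (normalizer_fus F R))"
  have memX: "R \<in> X \<longleftrightarrow> R \<in> fcr p F \<and> R \<noteq> fus_core F" for R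
    using fcrD(6)[of R] by (auto simp: X_def)
  have zero: "r R = 0 \<longleftrightarrow> R = carrier G" if "R \<in> X" for R
    unfolding r_def by (rule local_rank_normalizer_zero_iff) (use that in \<open>simp add: X_def\<close>)
  have "carrier G \<in> X" using S core unfolding memX by simp
  moreover have "finite X" using finite_fcr by (simp add: X_def)
  ultimately have X: "finite X" "X \<noteq> {}" by blast+
  have "local_rank p F = 2 \<longleftrightarrow> Max (r ` X) = 1"
    unfolding local_rank_step[OF core] X_def r_def by simp
  also have "\<dots> \<longleftrightarrow> (\<exists>R\<in>X. r R = 1) \<and> (\<forall>R\<in>X. r R \<le> 1)"
    by (rule Max_image_eq_iff[OF X])
  also have "(\<forall>R\<in>X. r R \<le> 1) \<longleftrightarrow> (\<forall>R\<in>X. R \<noteq> carrier G \<longrightarrow> r R = 1)"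
  proof (rule ball_cong[OF refl])
    fix R assume "R \<in> X"
    then show "r R \<le> 1 \<longleftrightarrow> (R \<noteq> carrier G \<longrightarrow> r R = 1)" unfolding zero[OF \<open>R \<in> X\<close>, symmetric] by linarith
  qed
  also have "(\<exists>R\<in>X. r R = 1) \<and> (\<forall>R\<in>X. R \<noteq> carrier G \<longrightarrow> r R = 1) \<longleftrightarrow>
      (\<exists>R\<in>X. R \<noteq> carrier G) \<and> (\<forall>R\<in>X. R \<noteq> carrier G \<longrightarrow> r R = 1)"
  proof (cases "\<forall>R\<in>X. R \<noteq> carrier G \<longrightarrow> r R = 1")
    case True
    have "r R = 1 \<longleftrightarrow> R \<noteq> carrier G" if "R \<in> X" for R
      using zero[OF that] bspec[OF True that] by auto
    then have "(\<exists>R\<in>X. r R = 1) \<longleftrightarrow> (\<exists>R\<in>X. R \<noteq> carrier G)" by (rule bex_cong[OF refl])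
    then show ?thesis by (simp only:)
  qed (simp only: simp_thms)
  also have "(\<exists>R\<in>X. R \<noteq> carrier G) \<longleftrightarrow> (\<exists>R\<in>fcr p F. R \<noteq> carrier G \<and> R \<noteq> fus_core F)"
    by (auto simp: memX)
  also have "(\<forall>R\<in>X. R \<noteq> carrier G \<longrightarrow> r R = 1) \<longleftrightarrow>
      (\<forall>R\<in>fcr p F. R \<noteq> carrier G \<and> R \<noteq> fus_core F \<longrightarrow> r R = 1)"
    by (auto simp: memX)
  finally show ?thesis unfolding r_def .
qed

end

context centric_normaliser
begin

lemma E_iso_Q:
  assumes "fusion_iso E Q W" shows "W = Q"
proof -
  obtain \<phi> where "\<phi> \<in> Mor E Q W" "\<phi> ` Q = W" using assms by (auto simp: E.fusion_iso_iff)
  then show ?thesis using E_Mor_iff[OF order_refl] by simp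
qed

lemma Q_fcr:
  assumes rad: "radical p F Q"
  shows "Q \<in> fcr p E"
proof -
  have sE: "subgroup Q GN" using subgroup_Q Q_subset_N subgroup_GN by simp
  have "fully_normalised E Q" unfolding fully_normalised_def E.grp_F using sE E_iso_Q by blast
  moreover have "centric E Q"
  proof (rule E.centricI[OF sE])
    fix W assume "fusion_iso E Q W"
    then have "W = Q" by (rule E_iso_Q)
    moreover have "centralizer GN Q \<subseteq> centralizer G Q"
      using subgroup.mem_carrier[OF subgroup_N] by (auto simp: centralizer_def)
    ultimately show "centralizer GN W \<subseteq> W" using centralizer_Q by simp
  qed
  moreover have "radical p E Q"
  proof -
    have "Mor E Q Q = Mor F Q Q"
      using E_Mor_iff[OF order_refl] Mor_endo_onto Q_subset_N by auto
    then have "Aut_fus E Q = Aut_fus F Q" by (simp add: Aut_fus_def)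
    moreover have "conj_map GN g Q = conj_map G g Q" if "g \<in> Q" for g
      using inv_GN[of g] that Q_subset_N by (auto simp: conj_map_def)
    then have "inner_aut GN Q = inner_aut G Q"
      unfolding E.inner_aut_image inner_aut_image by (rule image_cong[OF refl])
    ultimately have "Out_fus E Q = Out_fus F Q" by (simp add: Out_fus_def)
    then show ?thesis using rad sE by (simp add: radical_def)
  qed
  ultimately show ?thesis by (simp add: fcr_def)
qed

lemma normal_Q: "normal_in_fus Q E"
  by (rule normal_in_normalizer_fus[OF prefusion_F]) (simp add: subgroup_Q)

text \<open>
  Local rank one says that no member of \<open>fcr p E\<close> lies strictly between
  \<open>Q\<close>, the core of \<open>E\<close>, and \<open>N\<close>. If there is none, then
  \<open>Q\<close> is the only candidate for an essential subgroup, and there is one because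
  \<open>Q\<close> is itself radical and different from \<open>N\<close>. Conversely, a member
  strictly between would give an essential subgroup of larger order than \<open>Q\<close>.
\<close>
lemma local_rank_one_iff_essentials:
  assumes rad: "radical p F Q" and QG: "Q \<noteq> carrier G"
  shows "local_rank p E = 1 \<longleftrightarrow> essentials p E = {Q}"
proof -
  have coreE: "fus_core E = Q" by (rule fus_core_normalizer[OF rad centralizer_Q])
  have QneN: "Q \<noteq> N" using normalizer_grows[OF subgroup_Q] QG by auto
  have "subgroup N GN" using E.subgroup_self by simp
  \<comment> \<open>Only \<open>N\<close> is isomorphic to \<open>N\<close>, so saturation makes \<open>N\<close> itself fully automised.\<close>
  then obtain V where "fusion_iso E N V" "fully_automised p E V" using E_saturated_above Q_subset_N by blast
  then have faN: "fully_automised p E (carrier GN)" using E.fusion_iso_carrier[of V] by simp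
  note carrier = E.carrier_fcr_not_essential[OF faN]
  have one: "local_rank p E = 1 \<longleftrightarrow> (\<forall>R\<in>fcr p E. Q \<subset> R \<longrightarrow> R = N)"
    using E.local_rank_one_iff[OF _ carrier(1)] QneN by (simp add: coreE)
  have ess: "\<exists>V\<in>essentials p E. card R \<le> card V" if R: "R \<in> fcr p E" "R \<noteq> N" for R
    by (rule E.exists_essential[OF normal_Q E_saturated_above E.fcrD(2,3)[OF R(1)]]) (use R(2) in auto)
  show ?thesis
  proof
    assume "local_rank p E = 1"
    then have fcr: "R = Q \<or> R = N" if "R \<in> fcr p E" for R
      using one E.fcrD(6)[OF that] that unfolding coreE by blast
    have le: "essentials p E \<subseteq> {Q}" using E.essentials_subset_fcr fcr carrier(2) by auto
    moreover have "essentials p E \<noteq> {}" using ess[OF Q_fcr[OF rad] QneN] by blast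
    ultimately show "essentials p E = {Q}" by blast
  next
    assume eq: "essentials p E = {Q}"
    have "R = N" if R: "R \<in> fcr p E" "Q \<subset> R" for R
    proof (rule ccontr)
      assume "R \<noteq> N"
      then have "card R \<le> card Q" using ess[OF R(1)] eq by simp
      moreover have "card Q < card R"
        by (rule psubset_card_mono[OF E.finite_subgroup[OF E.fcrD(1)[OF R(1)]] R(2)])
      ultimately show False by simp
    qed
    then show "local_rank p E = 1" using one by blast
  qed
qed

end

theorem proposition5p4:
  fixes p :: nat and S :: "'a monoid" and F :: "'a fusion"
  assumes "saturated p F" and "grp F = S"
  shows "local_rank p F = 2 \<longleftrightarrow>
    essentials p F - {fus_core F} \<noteq> {} \<and>
    (\<forall>Q \<in> fcr p F - {carrier S, fus_core F}. essentials p (normalizer_fus F Q) = {Q})"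
proof -
  interpret F: fusion_sys S p F
    by unfold_locales (use assms in \<open>auto simp: saturated_def\<close>)
  have sat: "\<exists>V. fusion_iso F U V \<and> fully_automised p F V \<and> receptive F V" if "subgroup U S" for U
    using assms that by (simp add: saturated_def)
  obtain V where "fusion_iso F (carrier S) V" "fully_automised p F V" using sat[OF F.subgroup_self] by blast
  then have faS: "fully_automised p F (carrier S)" using F.fusion_iso_carrier[of V] by simp
  note carrier = F.carrier_fcr_not_essential[OF faS]
  have normaliser: "local_rank p (normalizer_fus F Q) = 1 \<longleftrightarrow> essentials p (normalizer_fus F Q) = {Q}"
    if Q: "Q \<in> fcr p F" "Q \<noteq> carrier S" for Q
  proof -
    interpret centric_normaliser S p F Q
      by unfold_locales (use assms(1) F.fcrD(4,5)[OF Q(1)] in auto)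
    show ?thesis by (rule local_rank_one_iff_essentials[OF F.fcrD(2)[OF Q(1)] Q(2)])
  qed
  show ?thesis
  proof (cases "fus_core F = carrier S")
    case True
    have "essentials p F - {fus_core F} = {}"
      using F.essentials_subset_fcr F.fcrD(1,6) carrier(2) True subgroup.subset by blast
    moreover have "local_rank p F \<noteq> 2" using F.local_rank_zero_iff True by simp
    ultimately show ?thesis by simp
  next
    case False
    have "(\<exists>R\<in>fcr p F. R \<noteq> carrier S \<and> R \<noteq> fus_core F) \<longleftrightarrow> essentials p F - {fus_core F} \<noteq> {}"
    proof
      assume "\<exists>R\<in>fcr p F. R \<noteq> carrier S \<and> R \<noteq> fus_core F"
      then obtain R where R: "R \<in> fcr p F" "R \<noteq> carrier S" "R \<noteq> fus_core F" by blast
      obtain V where V: "V \<in> essentials p F" "card R \<le> card V"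
        using F.exists_essential[OF normal_in_fus_trivial[OF F.prefusion_F] sat F.fcrD(2,3)[OF R(1)] R(2)] by blast
      have "fus_core F \<subset> R" using F.fcrD(6)[OF R(1)] R(3) by blast
      then have "card (fus_core F) < card R"
        by (rule psubset_card_mono[OF F.finite_subgroup[OF F.fcrD(1)[OF R(1)]]])
      then show "essentials p F - {fus_core F} \<noteq> {}" using V by auto
    next
      assume "essentials p F - {fus_core F} \<noteq> {}"
      then obtain V where V: "V \<in> essentials p F" "V \<noteq> fus_core F" by blast
      then have "V \<noteq> carrier S" using carrier(2) by blast
      then show "\<exists>R\<in>fcr p F. R \<noteq> carrier S \<and> R \<noteq> fus_core F"
        using subsetD[OF F.essentials_subset_fcr V(1)] V(2) by blast
    qed
    moreover have "(\<forall>R\<in>fcr p F. R \<noteq> carrier S \<and> R \<noteq> fus_core F \<longrightarrow> local_rank p (normalizer_fus F R) = 1) \<longleftrightarrow>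
        (\<forall>Q\<in>fcr p F - {carrier S, fus_core F}. essentials p (normalizer_fus F Q) = {Q})"
    proof -
      have "(\<forall>Q\<in>fcr p F - {carrier S, fus_core F}. essentials p (normalizer_fus F Q) = {Q}) \<longleftrightarrow>
          (\<forall>Q\<in>fcr p F - {carrier S, fus_core F}. local_rank p (normalizer_fus F Q) = 1)"
        by (rule ball_cong[OF refl], rule normaliser[symmetric]) simp_all
      then show ?thesis by (simp only: Ball_def Diff_iff insert_iff empty_iff) blast
    qed
    ultimately show ?thesis
      unfolding F.local_rank_two_iff[OF False carrier(1)] by (simp only:)
  qed
qed

end
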